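(* Consider the Lurye system $y_1=Gu_1$, $y_2=\phi u_2$, $u_1=r_1-y_2$, $u_2=y_1+r_2$, assumed well-posed, with $G:\mathcal{L}_{2e}\to\mathcal{L}_{2e}$ linear time-invariant, causal and stable, and $\phi:\mathcal{L}_{2e}\to\mathcal{L}_{2e}$ a (nonlinear) operator. Suppose that: (i) for $y=\phi u$, $y(t)=0$ whenever $u(t)=0$; the nonlinearity of $\phi$ is bounded below by $\underline{\alpha}$ and above by $\overline{\alpha}$, where $\underline{\alpha},\overline{\alpha}:\mathbb{R}\to\mathbb{R}$ are monotone and bounded, and $\underline\alpha(x)/x\ge 0$ for all $x\neq 0$; the nonlinearity is also bounded below by $\underline{\beta}$ and above by $\overline{\beta}$, where $\underline{\beta},\overline{\beta}:\mathbb{R}\to\mathbb{R}$ are monotone, bounded and odd, and $\underline\beta(x)/x\ge 0$ for all $x\neq 0$; (ii) $\overline{\alpha}$ is bounded above by $\underline{\alpha}$ (so that the nonlinearity is single-valued and monotone), and there is a (possibly infinite) $B\ge 1$ such that $\overline{\beta}$ is bounded above by $B\underline{\beta}$. Let $H_+$ and $H_-$ be (not necessarily causal) convolution operators whose impulse responses are respectively $h_+\in\mathbf{H_p}$ and $h_-\in\mathbf{H_p}$, satisfying $$\|h_+\|_H+B\|h_-\|_H<1 .$$ Let $M=1-H_++H_-$. Then for any $u\in\mathcal{L}_2$, $$\int_{-\infty}^{\infty}(Mu)(t)\,(\phi u)(t)\,dt\ge 0 ,$$ and the Lurye system is stable provided there exists $\varepsilon>0$ such that $\mathrm{Re}\left[M(j\omega)G(j\omega)\right]\ge\varepsilon$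 for all $\omega\in\mathbb{R}$.
   Context: Signals are real-valued measurable functions of $t\in\mathbb{R}$. $\mathcal{L}_2$ is the space of square-integrable signals; $\mathcal{L}_{2e}$ is the extended space of signals all of whose truncations $x_T$ ($x_T(t)=x(t)$ for $t\le T$, $x_T(t)=0$ for $t>T$) lie in $\mathcal{L}_2$. Pointwise conditions on signals are understood for almost all $t$. The Lurye system is well-posed if for all $r_1,r_2\in\mathcal{L}_{2e}$ there are unique $u_1,u_2,y_1,y_2\in\mathcal{L}_{2e}$ satisfying its equations. It is stable if $r_1,r_2\in\mathcal{L}_2$ implies $u_1,u_2,y_1,y_2\in\mathcal{L}_2$. Stability of $G$ means that it maps $\mathcal{L}_2$ boundedly into $\mathcal{L}_2$; $G(j\omega)$ and $M(j\omega)$ denote frequency responses. A function $\alpha:\mathbb{R}\to\mathbb{R}$ is monotone if $\alpha(x_1)\ge\alpha(x_2)$ whenever $x_1\ge x_2$; bounded if there is $C\ge0$ with $|\alpha(x)|\le C|x|$ for all $x$; odd if $\alpha(-x)=-\alpha(x)$ for all $x$. The nonlinearity of $\phi$ (the relation between $u(t)$ and $y(t)=(\phi u)(t)$) is bounded below by $\underline\alpha$ and above by $\overline\alpha$ if, for all $u\in\mathcal{L}_{2e}$ and $y=\phi u$, $\frac{\underline\alpha(u(t))}{u(t)}\le\frac{y(t)}{u(t)}\le\frac{\overline\alpha(u(t))}{u(t)}$ for all $t$ with $u(t)\ne0$. A function $f:\mathbb{R}\to\mathbb{R}$ is bounded above by $g:\mathbb{R}\to\mathbb{R}$ if $f(x)/x\le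 g(x)/x$ for all $x\ne0$. When $B=\infty$ the condition that $\overline\beta$ is bounded above by $B\underline\beta$ is void, and $B\|h_-\|_H$ is read as $0$ if $h_-=0$ and $\infty$ otherwise. $\mathbf{H}$ is the set of generalized functions $h(t)=\sum_i h_i\delta(t-t_i)+h_a(t)$ with $t_i\neq0$, $h_a(0)=0$, $h_i\in\mathbb{R}$, $h_a(t)\in\mathbb{R}$, and $\|h\|_H=\sum_i|h_i|+\int_{-\infty}^{\infty}|h_a(t)|\,dt<\infty$. $\mathbf{H_p}\subset\mathbf{H}$ is the subset with $h_i\ge0$ for all $i$ and $h_a(t)\ge0$ for all $t$. $M=1-H_++H_-$ has impulse response $\delta(t)-h_+(t)+h_-(t)$. *)

theory Defs
  imports "HOL-Analysis.Analysis"
begin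

text \<open>
  A signal is represented by a Borel function \<open>real \<Rightarrow> real\<close>, and two signals are
  identified when they agree almost everywhere. Hence operators must respect almost-everywhere
  equality, and every equation or inequality between signals is stated with \<open>AE\<close>.
\<close>

definition L2 :: "(real \<Rightarrow> real) set" where
  "L2 = {x \<in> borel_measurable borel. integrable lborel (\<lambda>t. (x t)\<^sup>2)}"

definition L2_norm :: "(real \<Rightarrow> real) \<Rightarrow> real" where
  "L2_norm x = sqrt (\<integral>t. (x t)\<^sup>2 \<partial>lborel)"

definition trunc :: "real \<Rightarrow> (real \<Rightarrow> real) \<Rightarrow> real \<Rightarrow> real" where
  "trunc T x = (\<lambda>t. if t \<le> T then x t else 0)"

definition L2e :: "(real \<Rightarrow> real) set" where
  "L2e = {x \<in> borel_measurable borel. \<forall>T. trunc T x \<in> L2}"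

type_synonym operator = "(real \<Rightarrow> real) \<Rightarrow> (real \<Rightarrow> real)"

definition L2e_operator :: "operator \<Rightarrow> bool" where
  "L2e_operator F \<longleftrightarrow>
     (\<forall>x\<in>L2e. F x \<in> L2e) \<and>
     (\<forall>x\<in>L2e. \<forall>y\<in>L2e. (AE t in lborel. x t = y t) \<longrightarrow> (AE t in lborel. F x t = F y t))"

definition linear_op :: "operator \<Rightarrow> bool" where
  "linear_op F \<longleftrightarrow> (\<forall>x\<in>L2e. \<forall>y\<in>L2e. \<forall>a b.
     AE t in lborel. F (\<lambda>s. a * x s + b * y s) t = a * F x t + b * F y t)"

definition time_invariant :: "operator \<Rightarrow> bool" where
  "time_invariant F \<longleftrightarrow> (\<forall>x\<in>L2e. \<forall>d. AE t in lborel. F (\<lambda>s. x (s - d)) t = F x (t - d))"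

definition causal :: "operator \<Rightarrow> bool" where
  "causal F \<longleftrightarrow> (\<forall>x\<in>L2e. \<forall>T. AE t in lborel. trunc T (F x) t = trunc T (F (trunc T x)) t)"

definition stable_op :: "operator \<Rightarrow> bool" where
  "stable_op F \<longleftrightarrow> (\<exists>c. \<forall>x\<in>L2. F x \<in> L2 \<and> L2_norm (F x) \<le> c * L2_norm x)"


subsection \<open>The Lurye system\<close>

definition lurye_solution ::
  "operator \<Rightarrow> operator \<Rightarrow> (real \<Rightarrow> real) \<Rightarrow> (real \<Rightarrow> real) \<Rightarrow>
   (real \<Rightarrow> real) \<Rightarrow> (real \<Rightarrow> real) \<Rightarrow> (real \<Rightarrow> real) \<Rightarrow> (real \<Rightarrow> real) \<Rightarrow> bool" where
  "lurye_solution G \<phi> r1 r2 u1 u2 y1 y2 \<longleftrightarrow>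
     u1 \<in> L2e \<and> u2 \<in> L2e \<and> y1 \<in> L2e \<and> y2 \<in> L2e \<and>
     (AE t in lborel. y1 t = G u1 t) \<and>
     (AE t in lborel. y2 t = \<phi> u2 t) \<and>
     (AE t in lborel. u1 t = r1 t - y2 t) \<and>
     (AE t in lborel. u2 t = y1 t + r2 t)"

definition lurye_well_posed :: "operator \<Rightarrow> operator \<Rightarrow> bool" where
  "lurye_well_posed G \<phi> \<longleftrightarrow> (\<forall>r1\<in>L2e. \<forall>r2\<in>L2e.
     (\<exists>u1 u2 y1 y2. lurye_solution G \<phi> r1 r2 u1 u2 y1 y2) \<and>
     (\<forall>u1 u2 y1 y2 u1' u2' y1' y2'.
        lurye_solution G \<phi> r1 r2 u1 u2 y1 y2 \<longrightarrow> lurye_solution G \<phi> r1 r2 u1' u2' y1' y2' \<longrightarrow>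
        (AE t in lborel. u1 t = u1' t \<and> u2 t = u2' t \<and> y1 t = y1' t \<and> y2 t = y2' t)))"

definition lurye_stable :: "operator \<Rightarrow> operator \<Rightarrow> bool" where
  "lurye_stable G \<phi> \<longleftrightarrow> (\<forall>r1\<in>L2. \<forall>r2\<in>L2. \<forall>u1 u2 y1 y2.
     lurye_solution G \<phi> r1 r2 u1 u2 y1 y2 \<longrightarrow> u1 \<in> L2 \<and> u2 \<in> L2 \<and> y1 \<in> L2 \<and> y2 \<in> L2)"


subsection \<open>Bounds on functions and nonlinearities\<close>

definition lin_bounded :: "(real \<Rightarrow> real) \<Rightarrow> bool" where
  "lin_bounded f \<longleftrightarrow> (\<exists>C\<ge>0. \<forall>x. \<bar>f x\<bar> \<le> C * \<bar>x\<bar>)"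

definition odd_fun :: "(real \<Rightarrow> real) \<Rightarrow> bool" where
  "odd_fun f \<longleftrightarrow> (\<forall>x. f (- x) = - f x)"

definition fun_bounded_above_by :: "(real \<Rightarrow> real) \<Rightarrow> (real \<Rightarrow> real) \<Rightarrow> bool" where
  "fun_bounded_above_by f g \<longleftrightarrow> (\<forall>x. x \<noteq> 0 \<longrightarrow> f x / x \<le> g x / x)"

definition nonlin_bounded_by :: "operator \<Rightarrow> (real \<Rightarrow> real) \<Rightarrow> (real \<Rightarrow> real) \<Rightarrow> bool" where
  "nonlin_bounded_by \<phi> lo up \<longleftrightarrow> (\<forall>u\<in>L2e. AE t in lborel. u t \<noteq> 0 \<longrightarrow>
     lo (u t) / u t \<le> \<phi> u t / u t \<and> \<phi> u t / u t \<le> up (u t) / u t)"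


subsection \<open>Generalized impulse responses\<close>

text \<open>
  A value of this type stands for the generalized function
  \<open>(\<Sum>i. wt h i * \<delta>(t - loc h i)) + dens h t\<close>. Finite sums of impulses are obtained with zero
  weights. The locations are not required to be distinct, which is harmless in \<open>Hp_set\<close>: merging
  coinciding impulses of nonnegative weight changes neither the norm nor the operator.
\<close>

record impulse_response =
  wt :: "nat \<Rightarrow> real"
  loc :: "nat \<Rightarrow> real"
  dens :: "real \<Rightarrow> real"

text \<open>Summability and integrability together say that the norm below is finite.\<close>

definition H_set :: "impulse_response set" where
  "H_set = {h. (\<forall>i. loc h i \<noteq> 0) \<and> dens h 0 = 0 \<and> dens h \<in> borel_measurable borel \<and>
               summable (\<lambda>i. \<bar>wt h i\<bar>) \<and> integrable lborel (dens h)}"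

definition Hp_set :: "impulse_response set" where
  "Hp_set = {h \<in> H_set. (\<forall>i. wt h i \<ge> 0) \<and> (\<forall>t. dens h t \<ge> 0)}"

definition H_norm :: "impulse_response \<Rightarrow> real" where
  "H_norm h = (\<Sum>i. \<bar>wt h i\<bar>) + (\<integral>t. \<bar>dens h t\<bar> \<partial>lborel)"

definition conv_op :: "impulse_response \<Rightarrow> operator" where
  "conv_op h u = (\<lambda>t. (\<Sum>i. wt h i * u (t - loc h i)) + (\<integral>s. dens h s * u (t - s) \<partial>lborel))"

definition conv_freq :: "impulse_response \<Rightarrow> real \<Rightarrow> complex" where
  "conv_freq h \<omega> = (\<Sum>i. of_real (wt h i) * cis (- (\<omega> * loc h i))) +
                    (\<integral>t. of_real (dens h t) * cis (- (\<omega> * t)) \<partial>lborel)"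

text \<open>The multiplier \<open>M = 1 - H\<^sub>+ + H\<^sub>-\<close> and its frequency response \<open>M(j\<omega>)\<close>.\<close>

definition mult_op :: "impulse_response \<Rightarrow> impulse_response \<Rightarrow> operator" where
  "mult_op hp hm u = (\<lambda>t. u t - conv_op hp u t + conv_op hm u t)"

definition mult_freq :: "impulse_response \<Rightarrow> impulse_response \<Rightarrow> real \<Rightarrow> complex" where
  "mult_freq hp hm \<omega> = 1 - conv_freq hp \<omega> + conv_freq hm \<omega>"


subsection \<open>Frequency response of an operator\<close>

text \<open>
  \<open>X\<close> is a representative of the Fourier--Plancherel transform of the \<open>L2\<close> signal \<open>x\<close>: the
  \<open>L2\<close> limit of the transforms of \<open>x\<close> restricted to \<open>[-T, T]\<close>.
\<close>

definition is_fourier_L2 :: "(real \<Rightarrow> real) \<Rightarrow> (real \<Rightarrow> complex) \<Rightarrow> bool" where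
  "is_fourier_L2 x X \<longleftrightarrow> X \<in> borel_measurable borel \<and>
     ((\<lambda>T. \<integral>\<^sup>+\<omega>. ennreal ((cmod (X \<omega> - (\<integral>t\<in>{-T..T}. of_real (x t) * cis (- (\<omega> * t)) \<partial>lborel)))\<^sup>2)
         \<partial>lborel) \<longlongrightarrow> 0) at_top"

text \<open>
  \<open>F\<close> acts on \<open>L2\<close> as multiplication by \<open>Fj\<close> in the frequency domain, where \<open>Fj \<omega>\<close> stands for
  \<open>F(j\<omega>)\<close>. A bounded time-invariant linear operator on \<open>L2\<close> determines \<open>Fj\<close> only up to a null
  set, which is why this is a predicate satisfied by every representative.
\<close>

definition is_freq_response :: "operator \<Rightarrow> (real \<Rightarrow> complex) \<Rightarrow> bool" where
  "is_freq_response F Fj \<longleftrightarrow> Fj \<in> borel_measurable borel \<and>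
     (\<forall>x\<in>L2. \<forall>X. is_fourier_L2 x X \<longrightarrow> is_fourier_L2 (F x) (\<lambda>\<omega>. Fj \<omega> * X \<omega>))"

end

theory Submission
  imports Defs "HOL-Probability.Characteristic_Functions"
begin

text \<open>
  The bounds force \<open>\<phi>\<close> to be the memoryless monotone map \<open>\<alpha>_lo\<close>. With \<open>w = \<phi> u\<close>, a primitive of
  \<open>\<alpha>_lo\<close> is convex, so \<open>\<integral> u(t - s) w(t) dt \<le> \<integral> u w\<close> for every shift \<open>s\<close>; comparison with the odd
  bounds gives \<open>\<integral> u(t - s) w(t) dt \<ge> - B \<integral> u w\<close>. Averaging over the impulse responses yields
  \<open>\<integral> (M u) w \<ge> (1 - \<parallel>h\<^sub>+\<parallel> - B \<parallel>h\<^sub>-\<parallel>) \<integral> u w \<ge> 0\<close>.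

  For stability no factorization of the noncausal \<open>M\<close> is needed. Fix \<open>T\<close>, write the loop as
  \<open>u = f - G w\<close> with \<open>f = r\<^sub>2 + G r\<^sub>1\<close>, and continue \<open>u\<close> and \<open>w\<close> beyond \<open>T\<close> to \<open>L\<^sub>2\<close> signals \<open>v\<close> and \<open>z\<close>
  such that \<open>M v\<close> and \<open>M* z\<close> (almost) vanish after \<open>T\<close>; this is possible because \<open>\<parallel>1 - M\<parallel> < 1\<close>. Up to
  arbitrarily small errors \<open>0 \<le> \<langle>M v, \<phi> v\<rangle> = \<langle>M v, z\<rangle> = \<langle>v, M* z\<rangle> = \<langle>f - G z, M* z\<rangle>\<close>, whereas
  \<open>\<langle>G z, M* z\<rangle> \<ge> \<epsilon> \<parallel>z\<parallel>\<^sup>2\<close> by Plancherel. This bounds the truncation of \<open>w\<close> uniformly in \<open>T\<close>.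
\<close>

subsection \<open>Square-integrable signals\<close>

text \<open>\<open>M\<close> is noncausal, so its positivity on \<open>L2\<close> says nothing about
  integrals stopped at \<open>T\<close>, while \<open>u\<close> and \<open>w\<close> are only known
  to lie in \<open>L2e\<close>. The continuations repair this: \<open>\<phi> v\<close> and
  \<open>z\<close> agree up to \<open>T\<close> because \<open>\<phi>\<close> is memoryless,
  \<open>v\<close> and \<open>f - G z\<close> agree up to \<open>T\<close> because \<open>G\<close>
  is causal. Both discrepancies thus live after \<open>T\<close>, exactly where \<open>M v\<close>
  and the adjoint image of \<open>z\<close> are small. The norms of the continuations may grow with
  \<open>T\<close>, but the admissible tail size is chosen after they are known, so the total error
  is at most \<epsilon> for every \<open>T\<close>. What remains is \<epsilon> |z|^2 <= 2 |f| |z| +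
  \<epsilon>, where 2 bounds the norm of the adjoint of \<open>M\<close>; hence the bound 2 |f| /
  \<epsilon> + 1, free of \<open>T\<close>. Plancherel's theorem comes from the autocorrelation: its
  transform is the power spectrum, Gaussian weights make the exchange of integrals absolutely
  convergent, and continuity of translation in \<open>L2\<close> identifies the limit.\<close>

lemma integrable_mult_square:
  fixes f g :: "'a \<Rightarrow> real"
  assumes [measurable]: "f \<in> borel_measurable M" "g \<in> borel_measurable M"
    and "integrable M (\<lambda>x. (f x)\<^sup>2)" "integrable M (\<lambda>x. (g x)\<^sup>2)"
  shows "integrable M (\<lambda>x. f x * g x)"
proof (rule Bochner_Integration.integrable_bound)
  show "integrable M (\<lambda>x. (f x)\<^sup>2 + (g x)\<^sup>2)" using assms by simp
  have "\<bar>a * b\<bar> \<le> a\<^sup>2 + b\<^sup>2" for a b :: real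
  proof -
    have "0 \<le> \<bar>a\<bar> * \<bar>b\<bar>" by simp
    moreover have "2 * (\<bar>a\<bar> * \<bar>b\<bar>) \<le> a\<^sup>2 + b\<^sup>2"
      using sum_squares_bound[of "\<bar>a\<bar>" "\<bar>b\<bar>"] by (simp add: mult.assoc)
    ultimately show ?thesis unfolding abs_mult by linarith
  qed
  then show "AE x in M. norm (f x * g x) \<le> norm ((f x)\<^sup>2 + (g x)\<^sup>2)" by simp
qed simp

text \<open>The polynomial \<open>l \<mapsto> \<integral> (f + l g)\<^sup>2\<close> has no negative
  values; evaluating it at a suitable \<open>l\<close> gives the inequality.\<close>

lemma integral_Cauchy_Schwarz:
  fixes f g :: "'a \<Rightarrow> real"
  assumes f: "f \<in> borel_measurable M" "integrable M (\<lambda>x. (f x)\<^sup>2)"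
    and g: "g \<in> borel_measurable M" "integrable M (\<lambda>x. (g x)\<^sup>2)"
  shows "(\<integral>x. f x * g x \<partial>M)\<^sup>2 \<le> (\<integral>x. (f x)\<^sup>2 \<partial>M) * (\<integral>x. (g x)\<^sup>2 \<partial>M)"
proof -
  define A C D where "A = (\<integral>x. (f x)\<^sup>2 \<partial>M)" and "C = (\<integral>x. f x * g x \<partial>M)"
    and "D = (\<integral>x. (g x)\<^sup>2 \<partial>M)"
  have fg: "integrable M (\<lambda>x. f x * g x)" using integrable_mult_square f g by blast
  have q: "0 \<le> A + 2 * l * C + l\<^sup>2 * D" for l
  proof -
    have "0 \<le> (\<integral>x. (f x + l * g x)\<^sup>2 \<partial>M)" by simp
    also have "(\<integral>x. (f x + l * g x)\<^sup>2 \<partial>M)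
        = (\<integral>x. (f x)\<^sup>2 + 2 * l * (f x * g x) + l\<^sup>2 * (g x)\<^sup>2 \<partial>M)"
      by (simp add: power2_sum power_mult_distrib algebra_simps)
    also have "\<dots> = A + 2 * l * C + l\<^sup>2 * D"
      using f g fg by (simp add: A_def C_def D_def)
    finally show ?thesis .
  qed
  have D: "D \<ge> 0" by (simp add: D_def)
  show ?thesis
  proof (cases "D = 0")
    case True
    \<comment> \<open>For \<open>D = 0\<close> the polynomial is affine in \<open>l\<close>; at
      \<open>l = - (A + 1) / (2 * C)\<close> it would take the value \<open>-1\<close>.\<close>
    have "C = 0"
    proof (rule ccontr)
      assume "C \<noteq> 0"
      then show False using q[of "- (A + 1) / (2 * C)"] True by (simp add: field_simps)
    qed
    then show ?thesis using True by (simp add: A_def C_def D_def)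
  next
    case False
    \<comment> \<open>\<open>- C / D\<close> is the minimizer of the quadratic, whose value there is
      \<open>A - C\<^sup>2 / D\<close>.\<close>
    then show ?thesis using q[of "- C / D"] D
      by (simp add: flip: A_def C_def D_def) (simp add: field_simps power2_eq_square)
  qed
qed

definition L2_inner :: "(real \<Rightarrow> real) \<Rightarrow> (real \<Rightarrow> real) \<Rightarrow> real" where
  "L2_inner x y = (\<integral>t. x t * y t \<partial>lborel)"

lemma L2_measurable: "x \<in> L2 \<Longrightarrow> x \<in> borel_measurable borel"
  by (simp add: L2_def)

lemma L2_square_integrable: "x \<in> L2 \<Longrightarrow> integrable lborel (\<lambda>t. (x t)\<^sup>2)"
  by (simp add: L2_def)

lemma L2_mult_integrable: "x \<in> L2 \<Longrightarrow> y \<in> L2 \<Longrightarrow> integrable lborel (\<lambda>t. x t * y t)"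
  by (rule integrable_mult_square) (auto simp: L2_def)

lemma L2_add: assumes "x \<in> L2" "y \<in> L2" shows "(\<lambda>t. x t + y t) \<in> L2"
proof -
  have "integrable lborel (\<lambda>t. (x t)\<^sup>2 + (y t)\<^sup>2 + 2 * (x t * y t))"
    using L2_mult_integrable[OF assms] assms by (auto simp: L2_def)
  moreover have "(\<lambda>t. (x t)\<^sup>2 + (y t)\<^sup>2 + 2 * (x t * y t)) = (\<lambda>t. (x t + y t)\<^sup>2)"
    by (simp add: power2_sum algebra_simps)
  ultimately show ?thesis using assms by (auto simp: L2_def)
qed

lemma L2_scale: assumes "x \<in> L2" shows "(\<lambda>t. a * x t) \<in> L2"
  using assms by (auto simp: L2_def power_mult_distrib)

lemma L2_diff: assumes "x \<in> L2" "y \<in> L2" shows "(\<lambda>t. x t - y t) \<in> L2"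
  using L2_add[OF assms(1) L2_scale[OF assms(2), of "-1"]] by simp

lemma L2_bound:
  assumes "y \<in> L2" "x \<in> borel_measurable borel" "AE t in lborel. \<bar>x t\<bar> \<le> c * \<bar>y t\<bar>"
  shows "x \<in> L2"
proof -
  have "integrable lborel (\<lambda>t. (x t)\<^sup>2)"
  proof (rule Bochner_Integration.integrable_bound)
    show "integrable lborel (\<lambda>t. c\<^sup>2 * (y t)\<^sup>2)" using assms by (simp add: L2_def)
    show "AE t in lborel. norm ((x t)\<^sup>2) \<le> norm (c\<^sup>2 * (y t)\<^sup>2)"
      using assms(3)
    proof eventually_elim
      case (elim t)
      then have "\<bar>x t\<bar>\<^sup>2 \<le> (c * \<bar>y t\<bar>)\<^sup>2" by (intro power_mono) auto
      then show ?case by (simp add: power_mult_distrib)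
    qed
  qed (use assms in simp)
  then show ?thesis using assms by (simp add: L2_def)
qed

lemma L2_AE_cong:
  "x \<in> L2 \<Longrightarrow> y \<in> borel_measurable borel \<Longrightarrow> AE t in lborel. y t = x t \<Longrightarrow> y \<in> L2"
  by (rule L2_bound[where c = 1 and y = x]) auto

lemma L2_norm_nonneg [simp]: "0 \<le> L2_norm x"
  by (simp add: L2_norm_def)

lemma L2_norm_power2: "(L2_norm x)\<^sup>2 = L2_inner x x"
  by (simp add: L2_norm_def L2_inner_def power2_eq_square)

lemma L2_inner_commute: "L2_inner x y = L2_inner y x"
  by (simp add: L2_inner_def mult.commute)

lemma L2_inner_add_left:
  "x \<in> L2 \<Longrightarrow> y \<in> L2 \<Longrightarrow> z \<in> L2 \<Longrightarrow> L2_inner (\<lambda>t. x t + y t) z = L2_inner x z + L2_inner y z"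
  by (simp add: L2_inner_def algebra_simps L2_mult_integrable)

lemma L2_inner_add_right:
  "x \<in> L2 \<Longrightarrow> y \<in> L2 \<Longrightarrow> z \<in> L2 \<Longrightarrow> L2_inner z (\<lambda>t. x t + y t) = L2_inner z x + L2_inner z y"
  by (simp add: L2_inner_def algebra_simps L2_mult_integrable)

lemma L2_inner_diff_left:
  "x \<in> L2 \<Longrightarrow> y \<in> L2 \<Longrightarrow> z \<in> L2 \<Longrightarrow> L2_inner (\<lambda>t. x t - y t) z = L2_inner x z - L2_inner y z"
  by (simp add: L2_inner_def algebra_simps L2_mult_integrable)

lemma L2_inner_diff_right:
  "x \<in> L2 \<Longrightarrow> y \<in> L2 \<Longrightarrow> z \<in> L2 \<Longrightarrow> L2_inner z (\<lambda>t. x t - y t) = L2_inner z x - L2_inner z y"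
  by (simp add: L2_inner_def algebra_simps L2_mult_integrable)

text \<open>Signals are functions, not classes, so almost-everywhere identities have to be
  transported into inner products by a rule of their own.\<close>

lemma L2_inner_cong:
  assumes "x \<in> borel_measurable borel" "x' \<in> borel_measurable borel"
    "y \<in> borel_measurable borel" "y' \<in> borel_measurable borel"
    "AE t in lborel. x t = x' t" "AE t in lborel. y t = y' t"
  shows "L2_inner x y = L2_inner x' y'"
  unfolding L2_inner_def
proof (rule integral_cong_AE)
  show "AE t in lborel. x t * y t = x' t * y' t"
    using assms(5,6) by eventually_elim simp
qed (use assms in auto)

lemma L2_norm_cong:
  assumes "x \<in> borel_measurable borel" "y \<in> borel_measurable borel" "AE t in lborel. x t = y t"
  shows "L2_norm x = L2_norm y"
proof -
  have "(L2_norm x)\<^sup>2 = (L2_norm y)\<^sup>2"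
    unfolding L2_norm_power2 by (rule L2_inner_cong) (use assms in auto)
  then show ?thesis by simp
qed

lemma L2_Cauchy_Schwarz:
  assumes "x \<in> L2" "y \<in> L2" shows "\<bar>L2_inner x y\<bar> \<le> L2_norm x * L2_norm y"
proof -
  have "(L2_inner x y)\<^sup>2 \<le> (L2_norm x * L2_norm y)\<^sup>2"
    using integral_Cauchy_Schwarz[of x lborel y] assms
    by (simp add: L2_def L2_inner_def power_mult_distrib L2_norm_def)
  then show ?thesis by (metis L2_norm_nonneg abs_le_square_iff abs_of_nonneg mult_nonneg_nonneg)
qed

lemma L2_norm_triangle:
  assumes "x \<in> L2" "y \<in> L2" shows "L2_norm (\<lambda>t. x t + y t) \<le> L2_norm x + L2_norm y"
proof -
  have "(L2_norm (\<lambda>t. x t + y t))\<^sup>2 = (L2_inner x x + L2_inner x y) + (L2_inner y x + L2_inner y y)"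
    unfolding L2_norm_power2 L2_inner_add_left[OF assms L2_add[OF assms]]
      L2_inner_add_right[OF assms assms(1)] L2_inner_add_right[OF assms assms(2)] ..
  also have "\<dots> = L2_inner x x + 2 * L2_inner x y + L2_inner y y"
    by (simp add: L2_inner_commute[of y x])
  also have "\<dots> \<le> (L2_norm x + L2_norm y)\<^sup>2"
    using L2_Cauchy_Schwarz[OF assms] by (simp add: power2_sum L2_norm_power2[symmetric])
  finally show ?thesis by (rule power2_le_imp_le) simp
qed

lemma L2_norm_scale: "L2_norm (\<lambda>t. a * x t) = \<bar>a\<bar> * L2_norm x"
  by (simp add: L2_norm_def power_mult_distrib real_sqrt_mult)

lemma L2_norm_triangle_diff:
  assumes "x \<in> L2" "y \<in> L2" shows "L2_norm (\<lambda>t. x t - y t) \<le> L2_norm x + L2_norm y"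
  using L2_norm_triangle[OF assms(1) L2_scale[OF assms(2), of "-1"]] L2_norm_scale[of "-1" y]
  by simp

lemma L2_norm_mono:
  assumes "y \<in> L2" "x \<in> borel_measurable borel" "AE t in lborel. \<bar>x t\<bar> \<le> \<bar>y t\<bar>"
  shows "L2_norm x \<le> L2_norm y"
  unfolding L2_norm_def
proof (intro real_sqrt_le_mono integral_mono_AE)
  have "x \<in> L2" by (rule L2_bound[where c = 1 and y = y]) (use assms in auto)
  then show "integrable lborel (\<lambda>t. (x t)\<^sup>2)" "integrable lborel (\<lambda>t. (y t)\<^sup>2)"
    using assms by (auto simp: L2_def)
  show "AE t in lborel. (x t)\<^sup>2 \<le> (y t)\<^sup>2"
    using assms(3) by eventually_elim (simp only: abs_le_square_iff)
qed

lemma L2_shift: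
  assumes "x \<in> L2" shows "(\<lambda>t. x (t - s)) \<in> L2" "L2_norm (\<lambda>t. x (t - s)) = L2_norm x"
proof -
  show "(\<lambda>t. x (t - s)) \<in> L2"
    using assms lborel_integrable_real_affine[of "\<lambda>t. (x t)\<^sup>2" 1 "- s"] by (auto simp: L2_def)
  show "L2_norm (\<lambda>t. x (t - s)) = L2_norm x"
    unfolding L2_norm_def lborel_integral_real_affine[of 1 "\<lambda>t. (x t)\<^sup>2" "- s", simplified]
    by simp
qed

lemma L2_trunc: assumes "x \<in> L2" shows "trunc T x \<in> L2" "L2_norm (trunc T x) \<le> L2_norm x"
proof -
  show "trunc T x \<in> L2"
    by (rule L2_bound[where c = 1 and y = x]) (use assms in \<open>auto simp: trunc_def L2_def\<close>)
  show "L2_norm (trunc T x) \<le> L2_norm x"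
    by (rule L2_norm_mono) (use assms in \<open>auto simp: trunc_def L2_def\<close>)
qed

lemma L2_subset_L2e: "x \<in> L2 \<Longrightarrow> x \<in> L2e"
  by (auto simp: L2e_def L2_trunc L2_measurable)

lemma L2e_measurable: "x \<in> L2e \<Longrightarrow> x \<in> borel_measurable borel"
  by (simp add: L2e_def)

lemma L2e_trunc: "x \<in> L2e \<Longrightarrow> trunc T x \<in> L2"
  by (simp add: L2e_def)

text \<open>Lebesgue's theorem for the squared error, dominated by
  \<open>(\<bar>x t\<bar> + \<bar>b t\<bar>)\<^sup>2\<close>. It serves the approximations by
  clipping, by cutting off and by small shifts.\<close>

lemma L2_dominated_convergence:
  assumes x: "x \<in> L2" and y: "\<And>n. y n \<in> borel_measurable borel"
    and lim: "AE t in lborel. (\<lambda>n. y n t) \<longlonglongrightarrow> x t"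
    and b: "b \<in> L2" "\<And>n. AE t in lborel. \<bar>y n t\<bar> \<le> \<bar>b t\<bar>"
  shows "\<And>n. y n \<in> L2" "(\<lambda>n. L2_norm (\<lambda>t. x t - y n t)) \<longlonglongrightarrow> 0"
proof -
  show yL: "y n \<in> L2" for n by (rule L2_bound[where c = 1 and y = b]) (use b y in auto)
  have bb: "(\<lambda>t. \<bar>x t\<bar> + \<bar>b t\<bar>) \<in> L2"
    by (rule L2_add) (rule L2_bound[where c = 1 and y = x] L2_bound[where c = 1 and y = b];
      use x b in \<open>auto simp: L2_def\<close>)+
  have "(\<lambda>n. \<integral>t. (x t - y n t)\<^sup>2 \<partial>lborel) \<longlonglongrightarrow> (\<integral>t. 0 \<partial>(lborel::real measure))"
  proof (rule integral_dominated_convergence[where w = "\<lambda>t. (\<bar>x t\<bar> + \<bar>b t\<bar>)\<^sup>2"])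
    show "integrable lborel (\<lambda>t. (\<bar>x t\<bar> + \<bar>b t\<bar>)\<^sup>2)" using bb by (simp add: L2_def)
    show "AE t in lborel. (\<lambda>n. (x t - y n t)\<^sup>2) \<longlonglongrightarrow> 0"
      using lim
    proof eventually_elim
      case (elim t)
      have "(\<lambda>n. (x t - y n t)\<^sup>2) \<longlonglongrightarrow> (x t - x t)\<^sup>2" by (intro tendsto_intros elim)
      then show ?case by simp
    qed
    show "AE t in lborel. norm ((x t - y n t)\<^sup>2) \<le> (\<bar>x t\<bar> + \<bar>b t\<bar>)\<^sup>2" for n
      using b(2)[of n]
    proof eventually_elim
      case (elim t)
      then have "\<bar>x t - y n t\<bar> \<le> \<bar>\<bar>x t\<bar> + \<bar>b t\<bar>\<bar>" by linarith
      then have "(x t - y n t)\<^sup>2 \<le> (\<bar>x t\<bar> + \<bar>b t\<bar>)\<^sup>2" by (simp only: abs_le_square_iff)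
      then show ?case by simp
    qed
  qed (use x y in \<open>auto simp: L2_def\<close>)
  then have "(\<lambda>n. sqrt (\<integral>t. (x t - y n t)\<^sup>2 \<partial>lborel)) \<longlonglongrightarrow> sqrt 0"
    by (intro tendsto_real_sqrt) simp
  then show "(\<lambda>n. L2_norm (\<lambda>t. x t - y n t)) \<longlonglongrightarrow> 0" by (simp add: L2_norm_def)
qed

subsection \<open>Translation is continuous on square-integrable signals\<close>

lemma clip_limit:
  fixes a :: real
  assumes "f \<longlonglongrightarrow> a"
  shows "(\<lambda>n. max (- c) (min c (f n))) \<longlonglongrightarrow> max (- c) (min c a)"
  by (intro tendsto_intros assms)

lemma L2_indicator: "(\<lambda>t. c * indicator {a..b} t) \<in> L2"
proof -
  have "(\<lambda>t. (c * indicator {a..b} t)\<^sup>2) = (\<lambda>t. c\<^sup>2 * indicator {a..b} t)"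
    by (auto simp: indicator_def)
  moreover have "integrable lborel (indicator {a..b} :: real \<Rightarrow> real)"
    by (rule integrable_real_indicator) (simp_all add: emeasure_lborel_Icc_eq)
  ultimately show ?thesis by (simp add: L2_def)
qed

text \<open>Two approximations are chained. Clipping \<open>x\<close> at height \<open>n\<close> and
  cutting it off outside \<open>[-n, n]\<close> gives a bounded signal. Continuous functions
  converging to \<open>x\<close> almost everywhere, clipped and cut off in the same way, then
  acquire a common square-integrable bound. The cutoff costs continuity only at
  \<open>\<bar>t\<bar> = K\<close>, a null set, so the result is still good enough for dominated
  convergence.\<close>

lemma L2_approx_continuous:
  assumes x: "x \<in> L2" and e: "e > 0"
  obtains c K where "c \<in> L2" "L2_norm (\<lambda>t. x t - c t) < e" "\<And>t. \<bar>c t\<bar> \<le> K"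
    "\<And>t. \<bar>t\<bar> > K \<Longrightarrow> c t = 0" "\<And>t. \<bar>t\<bar> \<noteq> K \<Longrightarrow> isCont c t"
proof -
  have xm [measurable]: "x \<in> borel_measurable borel" using x by (rule L2_measurable)
  define cl where "cl n a = max (- real n) (min (real n) a)" for n and a :: real
  define y where "y n t = (if \<bar>t\<bar> \<le> real n then cl n (x t) else 0)" for n t
  have y_meas: "y n \<in> borel_measurable borel" for n
    unfolding y_def cl_def by simp
  have y_lim: "(\<lambda>n. y n t) \<longlonglongrightarrow> x t" for t
  proof (rule tendsto_eventually)
    obtain m where m: "real m \<ge> max \<bar>t\<bar> \<bar>x t\<bar>" using real_arch_simple by blast
    show "\<forall>\<^sub>F n in sequentially. y n t = x t"
      using eventually_ge_at_top[of m]
    proof eventually_elim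
      case (elim n)
      then have "real n \<ge> real m" by simp
      then show ?case using m by (auto simp: y_def cl_def)
    qed
  qed
  have y_le: "\<bar>y n t\<bar> \<le> \<bar>x t\<bar>" for n t by (auto simp: y_def cl_def)
  have y_L2: "y n \<in> L2" for n
    by (rule L2_dominated_convergence(1)[where b = x and x = x and y = y]) (use x y_meas y_lim y_le in auto)
  have "(\<lambda>n. L2_norm (\<lambda>t. x t - y n t)) \<longlonglongrightarrow> 0"
    by (rule L2_dominated_convergence(2)[where b = x]) (use x y_meas y_lim y_le in auto)
  then have "\<forall>\<^sub>F n in sequentially. L2_norm (\<lambda>t. x t - y n t) < e / 2"
    by (rule order_tendstoD) (use e in simp)
  then obtain n where n: "L2_norm (\<lambda>t. x t - y n t) < e / 2"
    using eventually_happens' sequentially_bot by blast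
  have "x \<in> borel_measurable lebesgue" using xm by (simp add: measurable_completion)
  then have "x measurable_on UNIV" by (simp add: lebesgue_measurable_imp_measurable_on)
  \<comment> \<open>Unfolding \<open>measurable_on\<close> exhibits \<open>x\<close> as a pointwise
    limit of continuous functions off a negligible set.\<close>
  then obtain N g where N: "negligible N" and g: "\<And>k. continuous_on UNIV (g k)"
    and lim: "\<And>t. t \<notin> N \<Longrightarrow> (\<lambda>k. g k t) \<longlonglongrightarrow> x t"
    unfolding measurable_on_def by auto
  have "AE t in lebesgue. t \<notin> N"
    using N by (simp add: negligible_iff_null_sets AE_not_in)
  then have AEN: "AE t in lborel. t \<notin> N" by (simp add: AE_completion_iff)
  define c where "c k t = (if \<bar>t\<bar> \<le> real n then cl n (g k t) else 0)" for k t
  have gm [measurable]: "g k \<in> borel_measurable borel" for k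
    using g by (rule borel_measurable_continuous_onI)
  have c_meas: "c k \<in> borel_measurable borel" for k
    unfolding c_def cl_def by simp
  have c_lim: "AE t in lborel. (\<lambda>k. c k t) \<longlonglongrightarrow> y n t"
    using AEN
  proof eventually_elim
    case (elim t)
    then show ?case using clip_limit[OF lim[OF elim], of "real n"] by (simp add: c_def y_def cl_def)
  qed
  define b where "b t = real n * indicator {- real n..real n} t" for t :: real
  have b: "b \<in> L2"
    unfolding b_def by (rule L2_indicator)
  have c_le: "AE t in lborel. \<bar>c k t\<bar> \<le> \<bar>b t\<bar>" for k
    by (auto simp: c_def b_def cl_def indicator_def)
  have c_L2: "c k \<in> L2" for k
    by (rule L2_dominated_convergence(1)[where b = b and x = "y n" and y = c])
      (use y_L2 c_meas c_lim c_le b in auto)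
  have "(\<lambda>k. L2_norm (\<lambda>t. y n t - c k t)) \<longlonglongrightarrow> 0"
    by (rule L2_dominated_convergence(2)[where b = b]) (use y_L2 c_meas c_lim c_le b in auto)
  then have "\<forall>\<^sub>F k in sequentially. L2_norm (\<lambda>t. y n t - c k t) < e / 2"
    by (rule order_tendstoD) (use e in simp)
  then obtain k where k: "L2_norm (\<lambda>t. y n t - c k t) < e / 2"
    using eventually_happens' sequentially_bot by blast
  show ?thesis
  proof (rule that[of "c k" "real n"])
    have "L2_norm (\<lambda>t. x t - c k t) = L2_norm (\<lambda>t. (x t - y n t) + (y n t - c k t))" by simp
    also have "\<dots> \<le> L2_norm (\<lambda>t. x t - y n t) + L2_norm (\<lambda>t. y n t - c k t)"
      by (intro L2_norm_triangle L2_diff x y_L2 c_L2)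
    finally show "L2_norm (\<lambda>t. x t - c k t) < e" using n k by simp
    show "isCont (c k) t" if t: "\<bar>t\<bar> \<noteq> real n" for t
    proof (cases "\<bar>t\<bar> < real n")
      case True
      have "isCont (\<lambda>t. cl n (g k t)) t"
        unfolding cl_def using g[of k] by (intro continuous_intros) (simp add: continuous_on_eq_continuous_at)
      moreover have "\<forall>\<^sub>F s in nhds t. c k s = cl n (g k s)"
        by (rule eventually_nhds_in_open[of "{- real n<..<real n}", THEN eventually_mono])
          (use True in \<open>auto simp: c_def\<close>)
      ultimately show ?thesis by (simp add: isCont_cong)
    next
      case False
      have "\<forall>\<^sub>F s in nhds t. c k s = 0"
        by (rule eventually_nhds_in_open[of "- {- real n..real n}", THEN eventually_mono])
          (use False t in \<open>auto simp: c_def\<close>)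
      then have "isCont (c k) t \<longleftrightarrow> isCont (\<lambda>_. 0 :: real) t" by (rule isCont_cong)
      then show ?thesis by simp
    qed
  qed (auto simp: c_L2, auto simp: c_def cl_def)
qed

definition autocorr :: "(real \<Rightarrow> real) \<Rightarrow> real \<Rightarrow> real" where
  "autocorr x r = L2_inner x (\<lambda>t. x (t - r))"

lemma autocorr_bound: "x \<in> L2 \<Longrightarrow> \<bar>autocorr x r\<bar> \<le> (L2_norm x)\<^sup>2"
  unfolding autocorr_def using L2_Cauchy_Schwarz[of x "\<lambda>t. x (t - r)"]
  by (simp add: L2_shift power2_eq_square)

text \<open>Shifting preserves the norm, so replacing \<open>x\<close> by an approximant
  \<open>c\<close> costs the same small error before and after the shift. For \<open>c\<close>,
  bounded with bounded support and continuous off two points, dominated convergence applies.\<close>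

lemma L2_translation_continuous:
  assumes x: "x \<in> L2" and r: "r \<longlonglongrightarrow> 0"
  shows "(\<lambda>k. L2_norm (\<lambda>t. x t - x (t - r k))) \<longlonglongrightarrow> 0"
proof (rule LIMSEQ_I)
  fix e :: real assume e: "e > 0"
  obtain c K where c: "c \<in> L2" "L2_norm (\<lambda>t. x t - c t) < e / 3" "\<And>t. \<bar>c t\<bar> \<le> K"
    "\<And>t. \<bar>t\<bar> > K \<Longrightarrow> c t = 0" "\<And>t. \<bar>t\<bar> \<noteq> K \<Longrightarrow> isCont c t"
    using L2_approx_continuous[OF x, of "e / 3"] e by auto
  have K: "K \<ge> 0" using c(3)[of 0] by linarith
  have [measurable]: "c \<in> borel_measurable borel" "x \<in> borel_measurable borel"
    using c x by (auto simp: L2_def)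
  \<comment> \<open>A convergent sequence is bounded; widening the support by \<open>M\<close> on
    both sides gives one dominating function for all shifts.\<close>
  obtain M where M: "\<And>k. \<bar>r k\<bar> \<le> M"
    using r convergent_imp_Bseq[of r] by (auto simp: convergent_def Bseq_def)
  define b where "b t = K * indicator {- K - M..K + M} t" for t :: real
  have b: "b \<in> L2"
    unfolding b_def by (rule L2_indicator)
  have "(\<lambda>k. L2_norm (\<lambda>t. c t - c (t - r k))) \<longlonglongrightarrow> 0"
  proof (rule L2_dominated_convergence(2)[where b = b])
    have "AE t in lborel. t \<noteq> K \<and> t \<noteq> - K" by (intro AE_conjI AE_lborel_singleton)
    then show "AE t in lborel. (\<lambda>k. c (t - r k)) \<longlonglongrightarrow> c t"
    proof eventually_elim
      case (elim t)
      then have "isCont c t" using K by (intro c) auto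
      moreover have "(\<lambda>k. t - r k) \<longlonglongrightarrow> t - 0" by (intro tendsto_intros r)
      ultimately show ?case using isCont_tendsto_compose by force
    qed
    have "\<bar>c (t - r k)\<bar> \<le> \<bar>b t\<bar>" for t k
      using c(3)[of "t - r k"] c(4)[of "t - r k"] M[of k] K by (auto simp: b_def indicator_def)
    then show "AE t in lborel. \<bar>c (t - r k)\<bar> \<le> \<bar>b t\<bar>" for k by simp
  qed (use c b in auto)
  then have "\<forall>\<^sub>F k in sequentially. L2_norm (\<lambda>t. c t - c (t - r k)) < e / 3"
    by (rule order_tendstoD) (use e in simp)
  then obtain k0 where k0: "\<And>k. k \<ge> k0 \<Longrightarrow> L2_norm (\<lambda>t. c t - c (t - r k)) < e / 3"
    by (auto simp: eventually_sequentially)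
  show "\<exists>k0. \<forall>k\<ge>k0. norm (L2_norm (\<lambda>t. x t - x (t - r k)) - 0) < e"
  proof (intro exI allI impI)
    fix k assume "k \<ge> k0"
    have xc: "(\<lambda>t. x t - c t) \<in> L2" using x c by (intro L2_diff)
    have "L2_norm (\<lambda>t. x t - x (t - r k))
        = L2_norm (\<lambda>t. (x t - c t) + (c t - c (t - r k)) - (x (t - r k) - c (t - r k)))"
      by (simp add: algebra_simps)
    also have "\<dots> \<le> L2_norm (\<lambda>t. (x t - c t) + (c t - c (t - r k))) + L2_norm (\<lambda>t. x (t - r k) - c (t - r k))"
      using x c by (intro L2_norm_triangle_diff L2_add L2_diff L2_shift)
    also have "L2_norm (\<lambda>t. x (t - r k) - c (t - r k)) = L2_norm (\<lambda>t. x t - c t)"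
      using L2_shift(2)[OF xc] .
    also have "L2_norm (\<lambda>t. (x t - c t) + (c t - c (t - r k)))
        \<le> L2_norm (\<lambda>t. x t - c t) + L2_norm (\<lambda>t. c t - c (t - r k))"
      using x c by (intro L2_norm_triangle L2_diff L2_shift)
    finally show "norm (L2_norm (\<lambda>t. x t - x (t - r k)) - 0) < e"
      using c(2) k0[OF \<open>k \<ge> k0\<close>] by simp
  qed
qed

text \<open>Cauchy-Schwarz turns continuity of translation into continuity of the autocorrelation at
  \<open>0\<close>. This limit is the source of the norm in Plancherel's theorem.\<close>

lemma autocorr_limit:
  assumes x: "x \<in> L2" and r: "r \<longlonglongrightarrow> 0"
  shows "(\<lambda>k. autocorr x (r k)) \<longlonglongrightarrow> (L2_norm x)\<^sup>2"
proof -
  have d: "(\<lambda>k. L2_inner x (\<lambda>t. x t - x (t - r k))) \<longlonglongrightarrow> 0"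
  proof (rule tendsto_rabs_zero_cancel, rule tendsto_sandwich[where f = "\<lambda>_. 0"])
    have "(\<lambda>k. L2_norm x * L2_norm (\<lambda>t. x t - x (t - r k))) \<longlonglongrightarrow> L2_norm x * 0"
      by (intro tendsto_intros L2_translation_continuous x r)
    then show "(\<lambda>k. L2_norm x * L2_norm (\<lambda>t. x t - x (t - r k))) \<longlonglongrightarrow> 0" by simp
    show "\<forall>\<^sub>F k in sequentially. 0 \<le> \<bar>L2_inner x (\<lambda>t. x t - x (t - r k))\<bar>" by simp
    show "\<forall>\<^sub>F k in sequentially. \<bar>L2_inner x (\<lambda>t. x t - x (t - r k))\<bar>
        \<le> L2_norm x * L2_norm (\<lambda>t. x t - x (t - r k))"
      using x by (intro always_eventually allI L2_Cauchy_Schwarz L2_diff L2_shift)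
  qed auto
  have "autocorr x (r k) = (L2_norm x)\<^sup>2 - L2_inner x (\<lambda>t. x t - x (t - r k))" for k
    unfolding autocorr_def L2_norm_power2 using x L2_shift(1)[OF x] by (simp add: L2_inner_diff_right)
  moreover have "(\<lambda>k. (L2_norm x)\<^sup>2 - L2_inner x (\<lambda>t. x t - x (t - r k))) \<longlonglongrightarrow> (L2_norm x)\<^sup>2 - 0"
    by (intro tendsto_intros d)
  ultimately show ?thesis by simp
qed

subsection \<open>The Plancherel theorem\<close>

lemma borel_measurable_cis [measurable]: "cis \<in> borel_measurable borel"
  by (intro borel_measurable_continuous_onI continuous_intros)

lemma integrable_of_real_cis:
  fixes f g :: "'a \<Rightarrow> real"
  assumes "integrable M f" and [measurable]: "g \<in> borel_measurable M"
  shows "integrable M (\<lambda>t. complex_of_real (f t) * cis (g t))"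
proof (rule Bochner_Integration.integrable_bound[OF assms(1)])
  have [measurable]: "f \<in> borel_measurable M" using assms(1) by simp
  show "(\<lambda>t. complex_of_real (f t) * cis (g t)) \<in> borel_measurable M" by measurable
qed (simp add: norm_mult)

lemma integrable_reflect_shift:
  fixes f :: "real \<Rightarrow> real"
  assumes "integrable lborel f" shows "integrable lborel (\<lambda>r. f (t - r))"
  using lborel_integrable_real_affine[OF assms, of "-1" t] by simp

lemma integral_reflect_shift:
  fixes f :: "real \<Rightarrow> 'a :: {banach, second_countable_topology}"
  shows "(\<integral>r. f (t - r) \<partial>lborel) = (\<integral>r. f r \<partial>lborel)"
  using lborel_integral_real_affine[of "-1" f t] by simp

definition fourier :: "(real \<Rightarrow> real) \<Rightarrow> real \<Rightarrow> complex" where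
  "fourier x \<omega> = (\<integral>t. of_real (x t) * cis (- (\<omega> * t)) \<partial>lborel)"

lemma fourier_measurable [measurable]:
  assumes [measurable]: "x \<in> borel_measurable borel"
  shows "fourier x \<in> borel_measurable borel"
  unfolding fourier_def by measurable

lemma fourier_cnj: "cnj (fourier x \<omega>) = (\<integral>t. of_real (x t) * cis (\<omega> * t) \<partial>lborel)"
proof -
  have "(\<integral>t. complex_of_real (x t) * cis (\<omega> * t) \<partial>lborel)
      = (\<integral>t. cnj (complex_of_real (x t) * cis (- (\<omega> * t))) \<partial>lborel)"
    by (rule Bochner_Integration.integral_cong) (simp_all add: cis_cnj)
  also have "\<dots> = cnj (fourier x \<omega>)"
    unfolding fourier_def by (rule Bochner_Integration.integral_cnj)
  finally show ?thesis ..
qed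

lemma fourier_bound:
  assumes "integrable lborel x" shows "cmod (fourier x \<omega>) \<le> (\<integral>t. \<bar>x t\<bar> \<partial>lborel)"
  unfolding fourier_def
  by (rule order_trans[OF integral_norm_bound]) (simp add: norm_mult)

text \<open>The modulus of the integrand is \<open>\<bar>x t\<bar> * \<bar>x (t - r)\<bar>\<close>,
  whose double integral is the square of the integral of \<open>\<bar>x\<bar>\<close>.\<close>

lemma autocorr_fubini:
  assumes x: "integrable lborel x"
  shows "integrable (lborel \<Otimes>\<^sub>M lborel)
    (case_prod (\<lambda>t r. complex_of_real (x t * x (t - r)) * cis (- (\<omega> * r))))"
proof (rule lborel_pair.Fubini_integrable)
  have [measurable]: "x \<in> borel_measurable borel" using x by simp
  show "case_prod (\<lambda>t r. complex_of_real (x t * x (t - r)) * cis (- (\<omega> * r)))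
    \<in> borel_measurable (lborel \<Otimes>\<^sub>M lborel)" by measurable
  have "(\<integral>r. norm (case (t, r) of (t, r) \<Rightarrow> complex_of_real (x t * x (t - r)) * cis (- (\<omega> * r))) \<partial>lborel)
      = \<bar>x t\<bar> * (\<integral>r. \<bar>x r\<bar> \<partial>lborel)" for t
    using integral_reflect_shift[of "\<lambda>r. \<bar>x r\<bar>" t] by (simp add: norm_mult abs_mult)
  then show "integrable lborel (\<lambda>t. \<integral>r. norm (case (t, r) of (t, r) \<Rightarrow>
      complex_of_real (x t * x (t - r)) * cis (- (\<omega> * r))) \<partial>lborel)"
    using x by simp
  have "integrable lborel (\<lambda>r. complex_of_real (x t * x (t - r)) * cis (- (\<omega> * r)))" for t
    by (intro integrable_of_real_cis integrable_mult_right integrable_reflect_shift x) simp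
  then show "AE t in lborel. integrable lborel (\<lambda>r. case (t, r) of (t, r) \<Rightarrow>
      complex_of_real (x t * x (t - r)) * cis (- (\<omega> * r)))" by simp
qed

lemma autocorr_measurable:
  assumes "x \<in> L2" shows "autocorr x \<in> borel_measurable borel"
proof -
  have [measurable]: "x \<in> borel_measurable borel" using assms by (rule L2_measurable)
  show ?thesis unfolding autocorr_def L2_inner_def by measurable
qed

lemma autocorr_integrable:
  assumes x: "integrable lborel x" shows "integrable lborel (autocorr x)"
proof -
  \<comment> \<open>At frequency \<open>0\<close> the phase factor is \<open>1\<close>, so the
    partial integral over \<open>t\<close> is the autocorrelation embedded in the complex
    numbers.\<close>
  have "integrable lborel (\<lambda>r. Re (\<integral>t. complex_of_real (x t * x (t - r)) * cis (- (0 * r)) \<partial>lborel))"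
    by (intro integrable_Re lborel_pair.integrable_snd autocorr_fubini x)
  then show ?thesis by (simp add: autocorr_def[abs_def] L2_inner_def del: of_real_mult)
qed

text \<open>The Wiener-Khinchin identity. The phase splits as \<open>cis (- (\<omega> * r)) = cis (-
  (\<omega> * t)) * cis (\<omega> * (t - r))\<close>, so the integral over \<open>r\<close> yields
  the conjugate transform and the one over \<open>t\<close> the transform itself.\<close>

lemma power_spectrum:
  assumes x: "integrable lborel x"
  shows "complex_of_real ((cmod (fourier x \<omega>))\<^sup>2)
    = (\<integral>r. of_real (autocorr x r) * cis (- (\<omega> * r)) \<partial>lborel)"
proof -
  have inner: "(\<integral>r. complex_of_real (x t * x (t - r)) * cis (- (\<omega> * r)) \<partial>lborel)
      = complex_of_real (x t) * cis (- (\<omega> * t)) * cnj (fourier x \<omega>)" for t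
  proof -
    have "(\<integral>r. complex_of_real (x t * x (t - r)) * cis (- (\<omega> * r)) \<partial>lborel)
        = (\<integral>r. (complex_of_real (x t) * cis (- (\<omega> * t)))
              * (complex_of_real (x (t - r)) * cis (\<omega> * (t - r))) \<partial>lborel)"
      by (rule Bochner_Integration.integral_cong) (simp_all add: cis_mult algebra_simps)
    also have "\<dots> = complex_of_real (x t) * cis (- (\<omega> * t))
        * (\<integral>r. complex_of_real (x (t - r)) * cis (\<omega> * (t - r)) \<partial>lborel)"
      by simp
    also have "(\<integral>r. complex_of_real (x (t - r)) * cis (\<omega> * (t - r)) \<partial>lborel) = cnj (fourier x \<omega>)"
      unfolding fourier_cnj
      by (rule integral_reflect_shift[of "\<lambda>s. complex_of_real (x s) * cis (\<omega> * s)"])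
    finally show ?thesis .
  qed
  have "complex_of_real ((cmod (fourier x \<omega>))\<^sup>2) = fourier x \<omega> * cnj (fourier x \<omega>)"
    by (rule complex_norm_square)
  also have "\<dots> = (\<integral>t. complex_of_real (x t) * cis (- (\<omega> * t)) * cnj (fourier x \<omega>) \<partial>lborel)"
    unfolding fourier_def by simp
  also have "\<dots> = (\<integral>t. (\<integral>r. complex_of_real (x t * x (t - r)) * cis (- (\<omega> * r)) \<partial>lborel) \<partial>lborel)"
    unfolding inner ..
  also have "\<dots> = (\<integral>r. (\<integral>t. complex_of_real (x t * x (t - r)) * cis (- (\<omega> * r)) \<partial>lborel) \<partial>lborel)"
    by (rule lborel_pair.Fubini_integral[symmetric, OF autocorr_fubini[OF x]])
  also have "\<dots> = (\<integral>r. of_real (autocorr x r) * cis (- (\<omega> * r)) \<partial>lborel)"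
    by (simp add: autocorr_def L2_inner_def del: of_real_mult)
  finally show ?thesis .
qed

section \<open>Gaussian regularization of the power spectrum\<close>

lemma gaussian_integrable: "a > 0 \<Longrightarrow> integrable lborel (\<lambda>\<omega>. std_normal_density (a * \<omega>))"
  using lborel_integrable_real_affine[of std_normal_density a 0] by simp

text \<open>A rescaling of the characteristic function \<open>exp (- \<theta>\<^sup>2 / 2)\<close>
  of the standard normal law; the factor \<open>sqrt (2 * pi)\<close> turns the exponential back
  into a density.\<close>

lemma gaussian_fourier:
  assumes a: "a > 0"
  shows "(\<integral>\<omega>. complex_of_real (std_normal_density (a * \<omega>)) * cis (- (\<omega> * r)) \<partial>lborel)
    = of_real (sqrt (2 * pi) / a * std_normal_density (r / a))"
proof -
  \<comment> \<open>Chosen so that the substitution \<open>v = a * \<omega>\<close> turns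
    \<open>\<theta> * v\<close> into \<open>- (\<omega> * r)\<close>.\<close>
  define \<theta> where "\<theta> = - r / a"
  have "complex_of_real (exp (- \<theta>\<^sup>2 / 2)) = char std_normal_distribution \<theta>"
    by (simp add: char_std_normal_distribution)
  also have "\<dots> = (\<integral>v. std_normal_density v *\<^sub>R iexp (\<theta> * v) \<partial>lborel)"
    unfolding char_def by (rule integral_density) auto
  also have "\<dots> = (\<integral>v. complex_of_real (std_normal_density v) * cis (\<theta> * v) \<partial>lborel)"
    by (simp add: scaleR_conv_of_real cis_conv_exp)
  also have "\<dots> = \<bar>a\<bar> *\<^sub>R (\<integral>\<omega>. complex_of_real (std_normal_density (0 + a * \<omega>)) * cis (\<theta> * (0 + a * \<omega>)) \<partial>lborel)"
    by (rule lborel_integral_real_affine) (use a in simp)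
  also have "\<dots> = of_real a * (\<integral>\<omega>. complex_of_real (std_normal_density (a * \<omega>)) * cis (- (\<omega> * r)) \<partial>lborel)"
    using a by (simp add: \<theta>_def scaleR_conv_of_real mult.commute)
  finally have "(\<integral>\<omega>. complex_of_real (std_normal_density (a * \<omega>)) * cis (- (\<omega> * r)) \<partial>lborel)
      = of_real (exp (- \<theta>\<^sup>2 / 2)) / of_real a"
    using a by (simp add: field_simps)
  also have "exp (- \<theta>\<^sup>2 / 2) = sqrt (2 * pi) * std_normal_density (r / a)"
    by (simp add: std_normal_density_def \<theta>_def)
  finally show ?thesis by simp
qed

text \<open>Integrability of the power spectrum is not yet available here; the Gaussian in
  \<open>\<omega>\<close> and the integrable autocorrelation in \<open>r\<close> make the double
  integral absolutely convergent. The substitution \<open>r = a * v\<close> then moves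
  \<open>a\<close> from the density into the autocorrelation, ready for \<open>a\<close> to tend to
  \<open>0\<close>.\<close>

lemma gaussian_power_spectrum:
  assumes x: "x \<in> L2" "integrable lborel x" and a: "a > 0"
  shows "(\<integral>\<omega>. (cmod (fourier x \<omega>))\<^sup>2 * std_normal_density (a * \<omega>) \<partial>lborel)
    = sqrt (2 * pi) * (\<integral>v. autocorr x (a * v) * std_normal_density v \<partial>lborel)"
proof -
  have [measurable]: "autocorr x \<in> borel_measurable borel" using autocorr_measurable x by blast
  define f where "f = (\<lambda>(\<omega>, r).
    complex_of_real (std_normal_density (a * \<omega>) * autocorr x r) * cis (- (\<omega> * r)))"
  have f: "integrable (lborel \<Otimes>\<^sub>M lborel) f"
  proof (rule lborel_pair.Fubini_integrable)
    show "f \<in> borel_measurable (lborel \<Otimes>\<^sub>M lborel)" unfolding f_def by measurable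
    show "integrable lborel (\<lambda>\<omega>. \<integral>r. norm (f (\<omega>, r)) \<partial>lborel)"
      using gaussian_integrable[OF a] by (simp add: f_def norm_mult abs_mult)
    show "AE \<omega> in lborel. integrable lborel (\<lambda>r. f (\<omega>, r))"
      unfolding f_def prod.case
      by (intro always_eventually allI integrable_of_real_cis integrable_mult_right autocorr_integrable x) simp
  qed
  have "complex_of_real (\<integral>\<omega>. (cmod (fourier x \<omega>))\<^sup>2 * std_normal_density (a * \<omega>) \<partial>lborel)
      = (\<integral>\<omega>. complex_of_real (std_normal_density (a * \<omega>)) * complex_of_real ((cmod (fourier x \<omega>))\<^sup>2) \<partial>lborel)"
    by (subst integral_complex_of_real[symmetric]) (simp add: mult.commute)
  also have "\<dots> = (\<integral>\<omega>. (\<integral>r. f (\<omega>, r) \<partial>lborel) \<partial>lborel)"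
    unfolding power_spectrum[OF x(2)] f_def by (simp add: mult.assoc)
  also have "\<dots> = (\<integral>r. (\<integral>\<omega>. f (\<omega>, r) \<partial>lborel) \<partial>lborel)"
    using lborel_pair.Fubini_integral[of "\<lambda>\<omega> r. f (\<omega>, r)"] f by simp
  also have "\<dots> = (\<integral>r. of_real (autocorr x r * (sqrt (2 * pi) / a * std_normal_density (r / a))) \<partial>lborel)"
  proof (rule Bochner_Integration.integral_cong[OF refl])
    fix r
    have "(\<integral>\<omega>. f (\<omega>, r) \<partial>lborel) = (\<integral>\<omega>. of_real (autocorr x r)
        * (complex_of_real (std_normal_density (a * \<omega>)) * cis (- (\<omega> * r))) \<partial>lborel)"
      by (simp add: f_def mult_ac)
    then show "(\<integral>\<omega>. f (\<omega>, r) \<partial>lborel)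
        = of_real (autocorr x r * (sqrt (2 * pi) / a * std_normal_density (r / a)))"
      by (simp add: gaussian_fourier[OF a])
  qed
  also have "\<dots> = of_real (\<integral>r. autocorr x r * (sqrt (2 * pi) / a * std_normal_density (r / a)) \<partial>lborel)"
    by (rule integral_complex_of_real)
  finally have "(\<integral>\<omega>. (cmod (fourier x \<omega>))\<^sup>2 * std_normal_density (a * \<omega>) \<partial>lborel)
      = (\<integral>r. autocorr x r * (sqrt (2 * pi) / a * std_normal_density (r / a)) \<partial>lborel)"
    by (simp only: of_real_eq_iff)
  also have "\<dots> = \<bar>a\<bar> *\<^sub>R (\<integral>v. autocorr x (0 + a * v)
      * (sqrt (2 * pi) / a * std_normal_density ((0 + a * v) / a)) \<partial>lborel)"
    by (rule lborel_integral_real_affine) (use a in simp)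
  also have "\<dots> = a * (\<integral>v. sqrt (2 * pi) / a * (autocorr x (a * v) * std_normal_density v) \<partial>lborel)"
    using a by (simp add: mult_ac)
  also have "\<dots> = sqrt (2 * pi) * (\<integral>v. autocorr x (a * v) * std_normal_density v \<partial>lborel)"
    unfolding integral_mult_right_zero using a by simp
  finally show ?thesis .
qed

text \<open>As the Gaussian flattens, the weighted power spectrum increases, while the weighted
  autocorrelation converges by dominated convergence. Monotone convergence then delivers
  integrability and value together.\<close>

theorem Plancherel:
  assumes x: "x \<in> L2" "integrable lborel x"
  shows "integrable lborel (\<lambda>\<omega>. (cmod (fourier x \<omega>))\<^sup>2)"
    and "(\<integral>\<omega>. (cmod (fourier x \<omega>))\<^sup>2 \<partial>lborel) = 2 * pi * (L2_norm x)\<^sup>2"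
proof -
  have [measurable]: "autocorr x \<in> borel_measurable borel" "x \<in> borel_measurable borel"
    using autocorr_measurable L2_measurable x by blast+
  define a :: "nat \<Rightarrow> real" where "a k = 1 / real (Suc k)" for k
  have a: "a k > 0" for k by (simp add: a_def)
  have a_lim: "a \<longlonglongrightarrow> 0" unfolding a_def by (rule LIMSEQ_Suc[OF lim_1_over_n])
  have a_mono: "a n \<le> a m" if "m \<le> n" for m n using that by (simp add: a_def frac_le)
  \<comment> \<open>The factor \<open>sqrt (2 * pi)\<close> normalizes the Gaussian to
    \<open>1\<close> at the origin, so that \<open>f k\<close> increases to the power spectrum
    itself; it also completes \<open>2 * pi\<close> in the result.\<close>
  define f where "f k \<omega> = sqrt (2 * pi) * ((cmod (fourier x \<omega>))\<^sup>2 * std_normal_density (a k * \<omega>))" for k \<omega>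
  have f_int: "integrable lborel (f k)" for k
    unfolding f_def
  proof (rule integrable_mult_right, rule Bochner_Integration.integrable_bound)
    show "integrable lborel (\<lambda>\<omega>. (\<integral>t. \<bar>x t\<bar> \<partial>lborel)\<^sup>2 * std_normal_density (a k * \<omega>))"
      using gaussian_integrable[OF a] by simp
    show "AE \<omega> in lborel. norm ((cmod (fourier x \<omega>))\<^sup>2 * std_normal_density (a k * \<omega>))
        \<le> norm ((\<integral>t. \<bar>x t\<bar> \<partial>lborel)\<^sup>2 * std_normal_density (a k * \<omega>))"
    proof (intro always_eventually allI)
      fix \<omega>
      have "(cmod (fourier x \<omega>))\<^sup>2 * std_normal_density (a k * \<omega>)
          \<le> (\<integral>t. \<bar>x t\<bar> \<partial>lborel)\<^sup>2 * std_normal_density (a k * \<omega>)"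
        by (intro mult_right_mono power_mono fourier_bound x) simp_all
      then show "norm ((cmod (fourier x \<omega>))\<^sup>2 * std_normal_density (a k * \<omega>))
          \<le> norm ((\<integral>t. \<bar>x t\<bar> \<partial>lborel)\<^sup>2 * std_normal_density (a k * \<omega>))"
        by simp
    qed
  qed simp
  have f_mono: "mono (\<lambda>k. f k \<omega>)" for \<omega>
  proof (rule monoI)
    fix m n :: nat assume "m \<le> n"
    then have "(a n * \<omega>)\<^sup>2 \<le> (a m * \<omega>)\<^sup>2"
      unfolding power_mult_distrib
      by (intro mult_right_mono power_mono a_mono less_imp_le[OF a]) simp_all
    then show "f m \<omega> \<le> f n \<omega>"
      unfolding f_def std_normal_density_def by (intro mult_left_mono) auto
  qed
  have f_lim: "(\<lambda>k. f k \<omega>) \<longlonglongrightarrow> (cmod (fourier x \<omega>))\<^sup>2" for \<omega>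
  proof -
    have "(\<lambda>k. sqrt (2 * pi) * ((cmod (fourier x \<omega>))\<^sup>2 * std_normal_density (a k * \<omega>)))
        \<longlonglongrightarrow> sqrt (2 * pi) * ((cmod (fourier x \<omega>))\<^sup>2 * std_normal_density (0 * \<omega>))"
      unfolding std_normal_density_def by (intro tendsto_intros a_lim) auto
    then show ?thesis by (simp add: f_def std_normal_density_def)
  qed
  have "(\<lambda>k. \<integral>v. autocorr x (a k * v) * std_normal_density v \<partial>lborel)
      \<longlonglongrightarrow> (\<integral>v. (L2_norm x)\<^sup>2 * std_normal_density v \<partial>lborel)"
  proof (rule integral_dominated_convergence[where w = "\<lambda>v. (L2_norm x)\<^sup>2 * std_normal_density v"])
    show "AE v in lborel. (\<lambda>k. autocorr x (a k * v) * std_normal_density v)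
        \<longlonglongrightarrow> (L2_norm x)\<^sup>2 * std_normal_density v"
    proof (intro always_eventually allI tendsto_intros autocorr_limit x)
      fix v :: real
      show "(\<lambda>k. a k * v) \<longlonglongrightarrow> 0" using tendsto_mult_right[OF a_lim, of v] by simp
    qed
    show "AE v in lborel. norm (autocorr x (a k * v) * std_normal_density v)
        \<le> (L2_norm x)\<^sup>2 * std_normal_density v" for k
    proof (intro always_eventually allI)
      fix v
      have "\<bar>autocorr x (a k * v)\<bar> * std_normal_density v \<le> (L2_norm x)\<^sup>2 * std_normal_density v"
        by (intro mult_right_mono autocorr_bound x) simp
      then show "norm (autocorr x (a k * v) * std_normal_density v) \<le> (L2_norm x)\<^sup>2 * std_normal_density v"
        by (simp add: abs_mult)
    qed
  qed auto
  then have "(\<lambda>k. sqrt (2 * pi) * (sqrt (2 * pi) * (\<integral>v. autocorr x (a k * v) * std_normal_density v \<partial>lborel)))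
      \<longlonglongrightarrow> sqrt (2 * pi) * (sqrt (2 * pi) * (L2_norm x)\<^sup>2)"
    by (intro tendsto_mult_left) simp
  moreover have "integral\<^sup>L lborel (f k)
      = sqrt (2 * pi) * (sqrt (2 * pi) * (\<integral>v. autocorr x (a k * v) * std_normal_density v \<partial>lborel))" for k
    unfolding f_def using gaussian_power_spectrum[OF x a[of k]] by simp
  ultimately have f_ilim: "(\<lambda>k. integral\<^sup>L lborel (f k)) \<longlonglongrightarrow> 2 * pi * (L2_norm x)\<^sup>2"
    by (simp add: mult.assoc[symmetric])
  show "integrable lborel (\<lambda>\<omega>. (cmod (fourier x \<omega>))\<^sup>2)"
    by (rule integrable_monotone_convergence[OF f_int _ _ f_ilim]) (use f_mono f_lim in auto)
  show "(\<integral>\<omega>. (cmod (fourier x \<omega>))\<^sup>2 \<partial>lborel) = 2 * pi * (L2_norm x)\<^sup>2"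
    by (rule integral_monotone_convergence[OF f_int _ _ f_ilim]) (use f_mono f_lim in auto)
qed

section \<open>Transforms of square-integrable signals as limits over cutoffs\<close>

definition cutoff :: "real \<Rightarrow> (real \<Rightarrow> real) \<Rightarrow> real \<Rightarrow> real" where
  "cutoff T x t = indicator {-T..T} t * x t"

lemma cutoff_measurable [measurable]:
  "x \<in> borel_measurable borel \<Longrightarrow> cutoff T x \<in> borel_measurable borel"
  unfolding cutoff_def[abs_def] by measurable

lemma cutoff_L2: assumes "x \<in> L2" shows "cutoff T x \<in> L2"
  using assms cutoff_measurable[OF L2_measurable[OF assms]]
  by (rule L2_bound[where c = 1]) (simp add: cutoff_def indicator_def)

lemma cutoff_integrable: assumes "x \<in> L2" shows "integrable lborel (cutoff T x)"
  using L2_mult_integrable[OF L2_indicator[of 1 "-T" T] assms] by (simp add: cutoff_def[abs_def])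

lemma cutoff_tendsto:
  assumes x: "x \<in> L2" and T: "filterlim T at_top sequentially"
  shows "(\<lambda>n. L2_norm (\<lambda>t. x t - cutoff (T n) x t)) \<longlonglongrightarrow> 0"
proof (rule L2_dominated_convergence(2)[where b = x])
  have "(\<lambda>n. cutoff (T n) x t) \<longlonglongrightarrow> x t" for t
  proof (rule tendsto_eventually)
    show "\<forall>\<^sub>F n in sequentially. cutoff (T n) x t = x t"
      using T[unfolded filterlim_at_top, rule_format, of "\<bar>t\<bar>"]
      by eventually_elim (auto simp: cutoff_def indicator_def)
  qed
  then show "AE t in lborel. (\<lambda>n. cutoff (T n) x t) \<longlonglongrightarrow> x t" by simp
  show "AE t in lborel. \<bar>cutoff (T n) x t\<bar> \<le> \<bar>x t\<bar>" for n
    by (auto simp: cutoff_def indicator_def)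
qed (use x cutoff_measurable[OF L2_measurable[OF x]] in auto)

lemma fourier_cutoff:
  "(\<integral>t\<in>{-T..T}. of_real (x t) * cis (- (\<omega> * t)) \<partial>lborel) = fourier (cutoff T x) \<omega>"
  unfolding fourier_def set_lebesgue_integral_def cutoff_def
  by (rule Bochner_Integration.integral_cong) (auto simp: indicator_def)

lemma is_fourier_L2_iff:
  "is_fourier_L2 x X \<longleftrightarrow> X \<in> borel_measurable borel \<and>
    ((\<lambda>T. \<integral>\<^sup>+\<omega>. ennreal ((cmod (X \<omega> - fourier (cutoff T x) \<omega>))\<^sup>2) \<partial>lborel) \<longlongrightarrow> 0) at_top"
  by (simp add: is_fourier_L2_def fourier_cutoff)

lemma fourier_diff:
  assumes "integrable lborel x" "integrable lborel y"
  shows "fourier (\<lambda>t. x t - y t) \<omega> = fourier x \<omega> - fourier y \<omega>"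
  using integrable_of_real_cis[OF assms(1), of "\<lambda>t. - (\<omega> * t)"]
    integrable_of_real_cis[OF assms(2), of "\<lambda>t. - (\<omega> * t)"]
  by (simp add: fourier_def algebra_simps)

lemma fourier_add:
  assumes "integrable lborel x" "integrable lborel y"
  shows "fourier (\<lambda>t. x t + y t) \<omega> = fourier x \<omega> + fourier y \<omega>"
  using integrable_of_real_cis[OF assms(1), of "\<lambda>t. - (\<omega> * t)"]
    integrable_of_real_cis[OF assms(2), of "\<lambda>t. - (\<omega> * t)"]
  by (simp add: fourier_def algebra_simps)

text \<open>By Plancherel the transform of the cutoff error is as small as the error. Since
  \<open>is_freq_response\<close> speaks of representatives in the sense of
  \<open>is_fourier_L2\<close>, this is the way to feed it a pointwise transform.\<close>

lemma is_fourier_L2_fourier: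
  assumes x: "x \<in> L2" "integrable lborel x"
  shows "is_fourier_L2 x (fourier x)"
  unfolding is_fourier_L2_iff
proof (intro conjI tendsto_at_topI_sequentially)
  show "fourier x \<in> borel_measurable borel" using x by (intro fourier_measurable L2_measurable)
  fix T :: "nat \<Rightarrow> real" assume T: "filterlim T at_top sequentially"
  have "(\<integral>\<^sup>+\<omega>. ennreal ((cmod (fourier x \<omega> - fourier (cutoff (T n) x) \<omega>))\<^sup>2) \<partial>lborel)
      = ennreal (2 * pi * (L2_norm (\<lambda>t. x t - cutoff (T n) x t))\<^sup>2)" for n
  proof -
    let ?d = "\<lambda>t. x t - cutoff (T n) x t"
    have d: "?d \<in> L2" "integrable lborel ?d"
      using x by (auto intro!: L2_diff cutoff_L2 cutoff_integrable)
    have "(\<integral>\<^sup>+\<omega>. ennreal ((cmod (fourier ?d \<omega>))\<^sup>2) \<partial>lborel) = ennreal (2 * pi * (L2_norm ?d)\<^sup>2)"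
      using nn_integral_eq_integral[OF Plancherel(1)[OF d]] Plancherel(2)[OF d] by simp
    then show ?thesis using fourier_diff[OF x(2) cutoff_integrable[OF x(1)]] by simp
  qed
  moreover have "(\<lambda>n. ennreal (2 * pi * (L2_norm (\<lambda>t. x t - cutoff (T n) x t))\<^sup>2)) \<longlonglongrightarrow> ennreal (2 * pi * 0\<^sup>2)"
    by (intro tendsto_ennrealI tendsto_intros cutoff_tendsto x T)
  ultimately show "(\<lambda>n. \<integral>\<^sup>+\<omega>. ennreal ((cmod (fourier x \<omega> - fourier (cutoff (T n) x) \<omega>))\<^sup>2) \<partial>lborel)
      \<longlonglongrightarrow> 0" by simp
qed

text \<open>Prepares polarization. The estimate
  \<open>(a + b)\<^sup>2 \<le> 2 * a\<^sup>2 + 2 * b\<^sup>2\<close> keeps the argument inside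
  extended nonnegative integrals, where infinite errors do no harm.\<close>

lemma is_fourier_L2_add:
  assumes x: "x \<in> L2" "is_fourier_L2 x X" and y: "y \<in> L2" "is_fourier_L2 y Y"
  shows "is_fourier_L2 (\<lambda>t. x t + y t) (\<lambda>\<omega>. X \<omega> + Y \<omega>)"
  unfolding is_fourier_L2_iff
proof (intro conjI)
  have [measurable]: "X \<in> borel_measurable borel" "Y \<in> borel_measurable borel"
    "x \<in> borel_measurable borel" "y \<in> borel_measurable borel"
    using x y by (auto simp: is_fourier_L2_def L2_def)
  show "(\<lambda>\<omega>. X \<omega> + Y \<omega>) \<in> borel_measurable borel" by simp
  let ?E = "\<lambda>x X T. \<integral>\<^sup>+\<omega>. ennreal ((cmod (X \<omega> - fourier (cutoff T x) \<omega>))\<^sup>2) \<partial>lborel"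
  have le: "?E (\<lambda>t. x t + y t) (\<lambda>\<omega>. X \<omega> + Y \<omega>) T \<le> 2 * ?E x X T + 2 * ?E y Y T" for T
  proof -
    have sq: "(cmod (a + b))\<^sup>2 \<le> 2 * (cmod a)\<^sup>2 + 2 * (cmod b)\<^sup>2" for a b
    proof -
      have "(cmod (a + b))\<^sup>2 \<le> (cmod a + cmod b)\<^sup>2" by (intro power_mono norm_triangle_ineq) simp
      also have "\<dots> \<le> 2 * (cmod a)\<^sup>2 + 2 * (cmod b)\<^sup>2"
        using sum_squares_bound[of "cmod a" "cmod b"] by (simp add: power2_sum)
      finally show ?thesis .
    qed
    have split: "fourier (cutoff T (\<lambda>t. x t + y t)) \<omega> = fourier (cutoff T x) \<omega> + fourier (cutoff T y) \<omega>" for \<omega>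
      using fourier_add[OF cutoff_integrable[OF x(1)] cutoff_integrable[OF y(1)]]
      by (simp add: cutoff_def[abs_def] algebra_simps)
    have "?E (\<lambda>t. x t + y t) (\<lambda>\<omega>. X \<omega> + Y \<omega>) T
        \<le> (\<integral>\<^sup>+\<omega>. 2 * ennreal ((cmod (X \<omega> - fourier (cutoff T x) \<omega>))\<^sup>2)
              + 2 * ennreal ((cmod (Y \<omega> - fourier (cutoff T y) \<omega>))\<^sup>2) \<partial>lborel)"
    proof (rule nn_integral_mono)
      fix \<omega>
      have "(cmod (X \<omega> + Y \<omega> - fourier (cutoff T (\<lambda>t. x t + y t)) \<omega>))\<^sup>2
          \<le> 2 * (cmod (X \<omega> - fourier (cutoff T x) \<omega>))\<^sup>2 + 2 * (cmod (Y \<omega> - fourier (cutoff T y) \<omega>))\<^sup>2"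
        using sq[of "X \<omega> - fourier (cutoff T x) \<omega>" "Y \<omega> - fourier (cutoff T y) \<omega>"]
        by (simp add: split algebra_simps)
      then have "ennreal ((cmod (X \<omega> + Y \<omega> - fourier (cutoff T (\<lambda>t. x t + y t)) \<omega>))\<^sup>2)
          \<le> ennreal (2 * (cmod (X \<omega> - fourier (cutoff T x) \<omega>))\<^sup>2 + 2 * (cmod (Y \<omega> - fourier (cutoff T y) \<omega>))\<^sup>2)"
        by (rule ennreal_leI)
      then show "ennreal ((cmod (X \<omega> + Y \<omega> - fourier (cutoff T (\<lambda>t. x t + y t)) \<omega>))\<^sup>2)
          \<le> 2 * ennreal ((cmod (X \<omega> - fourier (cutoff T x) \<omega>))\<^sup>2)
            + 2 * ennreal ((cmod (Y \<omega> - fourier (cutoff T y) \<omega>))\<^sup>2)"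
        by (simp add: ennreal_plus ennreal_mult)
    qed
    also have "\<dots> = 2 * ?E x X T + 2 * ?E y Y T"
      by (simp add: nn_integral_add nn_integral_cmult)
    finally show ?thesis .
  qed
  have "((\<lambda>T. 2 * ?E x X T + 2 * ?E y Y T) \<longlongrightarrow> 2 * 0 + 2 * 0) at_top"
    using x(2) y(2) by (intro tendsto_add ennreal_tendsto_cmult) (simp_all add: is_fourier_L2_iff)
  then have lim: "((\<lambda>T. 2 * ?E x X T + 2 * ?E y Y T) \<longlongrightarrow> 0) at_top" by simp
  show "((\<lambda>T. ?E (\<lambda>t. x t + y t) (\<lambda>\<omega>. X \<omega> + Y \<omega>) T) \<longlongrightarrow> 0) at_top"
    by (rule tendsto_sandwich[OF _ _ tendsto_const lim]) (use le in auto)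
qed

text \<open>For the transforms \<open>Y n\<close> of the cutoffs the identity is Plancherel's, and
  both sides converge. As \<open>L2\<close> consists of real signals, moduli are compared, through
  the reverse triangle inequality.\<close>

lemma is_fourier_L2_isometry:
  assumes x: "x \<in> L2" "is_fourier_L2 x X"
  shows "(\<lambda>\<omega>. cmod (X \<omega>)) \<in> L2" "(L2_norm (\<lambda>\<omega>. cmod (X \<omega>)))\<^sup>2 = 2 * pi * (L2_norm x)\<^sup>2"
proof -
  have [measurable]: "X \<in> borel_measurable borel" "x \<in> borel_measurable borel"
    using x by (auto simp: is_fourier_L2_def L2_def)
  define Y where "Y n = fourier (cutoff (real n) x)" for n :: nat
  have Ym [measurable]: "Y n \<in> borel_measurable borel" for n unfolding Y_def by measurable
  have cL: "cutoff (real n) x \<in> L2" "integrable lborel (cutoff (real n) x)" for n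
    using x(1) by (auto intro: cutoff_L2 cutoff_integrable)
  have YL: "(\<lambda>\<omega>. cmod (Y n \<omega>)) \<in> L2" for n
    using Plancherel(1)[OF cL] by (simp add: L2_def Y_def[symmetric])
  have Yn: "L2_norm (\<lambda>\<omega>. cmod (Y n \<omega>)) = sqrt (2 * pi) * L2_norm (cutoff (real n) x)" for n
    using Plancherel(2)[OF cL, of n] by (simp add: L2_norm_def Y_def[symmetric] real_sqrt_mult)
  define D where "D n = (\<integral>\<^sup>+\<omega>. ennreal ((cmod (X \<omega> - Y n \<omega>))\<^sup>2) \<partial>lborel)" for n
  have "((\<lambda>T. \<integral>\<^sup>+\<omega>. ennreal ((cmod (X \<omega> - fourier (cutoff T x) \<omega>))\<^sup>2) \<partial>lborel) \<longlongrightarrow> 0) at_top"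
    using x(2) by (simp add: is_fourier_L2_iff)
  then have D: "D \<longlonglongrightarrow> 0"
    unfolding D_def Y_def by (rule filterlim_compose) (rule filterlim_real_sequentially)
  then have "\<forall>\<^sub>F n in sequentially. D n < 1" by (rule order_tendstoD) simp
  then obtain n0 where n0: "\<And>n. n \<ge> n0 \<Longrightarrow> D n < 1" by (auto simp: eventually_sequentially)
  \<comment> \<open>From \<open>n0\<close> on the error is finite, which is also what puts the
    modulus of \<open>X\<close> into \<open>L2\<close>.\<close>
  have dL: "(\<lambda>\<omega>. cmod (X \<omega> - Y n \<omega>)) \<in> L2" if "n \<ge> n0" for n
  proof -
    have "integrable lborel (\<lambda>\<omega>. (cmod (X \<omega> - Y n \<omega>))\<^sup>2)"
      using n0[OF that] less_trans[OF _ ennreal_one_less_top] by (intro integrableI_nonneg) (auto simp: D_def)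
    then show ?thesis by (simp add: L2_def)
  qed
  \<comment> \<open>Valid also where \<open>D n\<close> is infinite: the Bochner integral and
    \<open>enn2real\<close> then both default to \<open>0\<close>.\<close>
  have dn: "(L2_norm (\<lambda>\<omega>. cmod (X \<omega> - Y n \<omega>)))\<^sup>2 = enn2real (D n)" for n
    unfolding D_def L2_norm_def by (simp add: integral_eq_nn_integral)
  have "(\<lambda>n. enn2real (D n)) \<longlonglongrightarrow> enn2real 0" by (rule tendsto_enn2real) (use D in auto)
  then have "(\<lambda>n. sqrt ((L2_norm (\<lambda>\<omega>. cmod (X \<omega> - Y n \<omega>)))\<^sup>2)) \<longlonglongrightarrow> sqrt 0"
    unfolding dn by (intro tendsto_real_sqrt) simp
  then have dlim: "(\<lambda>n. L2_norm (\<lambda>\<omega>. cmod (X \<omega> - Y n \<omega>))) \<longlonglongrightarrow> 0" by simp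
  have diffL: "(\<lambda>\<omega>. cmod (X \<omega>) - cmod (Y n \<omega>)) \<in> L2"
    "L2_norm (\<lambda>\<omega>. cmod (X \<omega>) - cmod (Y n \<omega>)) \<le> L2_norm (\<lambda>\<omega>. cmod (X \<omega> - Y n \<omega>))" if "n \<ge> n0" for n
    by (rule L2_bound[OF dL[OF that], of _ 1] L2_norm_mono[OF dL[OF that]]; simp add: norm_triangle_ineq3)+
  show XL: "(\<lambda>\<omega>. cmod (X \<omega>)) \<in> L2"
    using L2_add[OF diffL(1)[of n0] YL[of n0]] by simp
  have close: "\<bar>L2_norm (\<lambda>\<omega>. cmod (X \<omega>)) - L2_norm (\<lambda>\<omega>. cmod (Y n \<omega>))\<bar>
      \<le> L2_norm (\<lambda>\<omega>. cmod (X \<omega> - Y n \<omega>))" if "n \<ge> n0" for n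
  proof -
    have "L2_norm (\<lambda>\<omega>. cmod (X \<omega>)) \<le> L2_norm (\<lambda>\<omega>. cmod (X \<omega>) - cmod (Y n \<omega>)) + L2_norm (\<lambda>\<omega>. cmod (Y n \<omega>))"
      using L2_norm_triangle[OF diffL(1)[OF that] YL[of n]] by simp
    moreover have "L2_norm (\<lambda>\<omega>. cmod (Y n \<omega>)) \<le> L2_norm (\<lambda>\<omega>. cmod (X \<omega>)) + L2_norm (\<lambda>\<omega>. cmod (X \<omega>) - cmod (Y n \<omega>))"
      using L2_norm_triangle_diff[OF XL diffL(1)[OF that]] by simp
    ultimately show ?thesis using diffL(2)[OF that] by linarith
  qed
  have "(\<lambda>n. L2_norm (\<lambda>\<omega>. cmod (X \<omega>)) - L2_norm (\<lambda>\<omega>. cmod (Y n \<omega>))) \<longlonglongrightarrow> 0"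
  proof (rule Lim_null_comparison[OF _ dlim])
    show "\<forall>\<^sub>F n in sequentially. norm (L2_norm (\<lambda>\<omega>. cmod (X \<omega>)) - L2_norm (\<lambda>\<omega>. cmod (Y n \<omega>)))
        \<le> L2_norm (\<lambda>\<omega>. cmod (X \<omega> - Y n \<omega>))"
      using eventually_ge_at_top[of n0] by eventually_elim (use close in simp)
  qed
  then have 1: "(\<lambda>n. L2_norm (\<lambda>\<omega>. cmod (Y n \<omega>))) \<longlonglongrightarrow> L2_norm (\<lambda>\<omega>. cmod (X \<omega>))"
    by (rule Lim_transform2[OF tendsto_const])
  have "(\<lambda>n. L2_norm x - L2_norm (cutoff (real n) x)) \<longlonglongrightarrow> 0"
  proof (rule Lim_null_comparison[OF _ cutoff_tendsto[OF x(1) filterlim_real_sequentially]])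
    have "\<bar>L2_norm x - L2_norm (cutoff (real n) x)\<bar> \<le> L2_norm (\<lambda>t. x t - cutoff (real n) x t)" for n
      using L2_norm_triangle[OF L2_diff[OF x(1) cL(1)[of n]] cL(1)[of n]]
        L2_norm_triangle_diff[OF x(1) L2_diff[OF x(1) cL(1)[of n]]] by simp
    then show "\<forall>\<^sub>F n in sequentially. norm (L2_norm x - L2_norm (cutoff (real n) x))
        \<le> L2_norm (\<lambda>t. x t - cutoff (real n) x t)" by simp
  qed
  then have "(\<lambda>n. L2_norm (cutoff (real n) x)) \<longlonglongrightarrow> L2_norm x"
    by (rule Lim_transform2[OF tendsto_const])
  then have "(\<lambda>n. L2_norm (\<lambda>\<omega>. cmod (Y n \<omega>))) \<longlonglongrightarrow> sqrt (2 * pi) * L2_norm x"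
    unfolding Yn by (rule tendsto_mult_left)
  with 1 have "L2_norm (\<lambda>\<omega>. cmod (X \<omega>)) = sqrt (2 * pi) * L2_norm x" by (rule LIMSEQ_unique)
  then show "(L2_norm (\<lambda>\<omega>. cmod (X \<omega>)))\<^sup>2 = 2 * pi * (L2_norm x)\<^sup>2"
    by (simp add: power_mult_distrib)
qed

text \<open>Polarization of the isometry, applied to \<open>x + y\<close>, \<open>x\<close> and
  \<open>y\<close>.\<close>

lemma Parseval:
  assumes x: "x \<in> L2" "is_fourier_L2 x X" and y: "y \<in> L2" "is_fourier_L2 y Y"
  shows "integrable lborel (\<lambda>\<omega>. Re (X \<omega> * cnj (Y \<omega>)))"
    and "(\<integral>\<omega>. Re (X \<omega> * cnj (Y \<omega>)) \<partial>lborel) = 2 * pi * L2_inner x y"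
proof -
  let ?S = "\<lambda>X. \<lambda>\<omega>. (cmod (X \<omega>))\<^sup>2"
  have I: "integrable lborel (?S X)" "integral\<^sup>L lborel (?S X) = 2 * pi * L2_inner x x"
    if "x \<in> L2" "is_fourier_L2 x X" for x X
    using is_fourier_L2_isometry[OF that]
    by (simp_all add: L2_norm_power2) (simp_all add: L2_def L2_inner_def power2_eq_square)
  have xy: "(\<lambda>t. x t + y t) \<in> L2" "is_fourier_L2 (\<lambda>t. x t + y t) (\<lambda>\<omega>. X \<omega> + Y \<omega>)"
    by (intro L2_add is_fourier_L2_add x y)+
  have eq: "Re (X \<omega> * cnj (Y \<omega>)) = (?S (\<lambda>\<omega>. X \<omega> + Y \<omega>) \<omega> - ?S X \<omega> - ?S Y \<omega>) / 2" for \<omega>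
    by (simp add: cmod_power2 power2_sum algebra_simps)
  show "integrable lborel (\<lambda>\<omega>. Re (X \<omega> * cnj (Y \<omega>)))"
    unfolding eq using I(1)[OF x] I(1)[OF y] I(1)[OF xy] by simp
  have "(\<integral>\<omega>. Re (X \<omega> * cnj (Y \<omega>)) \<partial>lborel)
      = (2 * pi * L2_inner (\<lambda>t. x t + y t) (\<lambda>t. x t + y t) - 2 * pi * L2_inner x x - 2 * pi * L2_inner y y) / 2"
    unfolding eq using I[OF x] I[OF y] I[OF xy] by simp
  also have "\<dots> = 2 * pi * L2_inner x y"
    unfolding L2_inner_add_left[OF x(1) y(1) xy(1)]
      L2_inner_add_right[OF x(1) y(1) x(1)] L2_inner_add_right[OF x(1) y(1) y(1)]
    by (simp add: L2_inner_commute[of y x] algebra_simps)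
  finally show "(\<integral>\<omega>. Re (X \<omega> * cnj (Y \<omega>)) \<partial>lborel) = 2 * pi * L2_inner x y" .
qed

text \<open>Here \<open>m\<close> stands for the adjoint multiplier applied to \<open>z\<close>.
  Conjugating its transform brings back \<open>Mj\<close>, so the integrand in Parseval's identity
  becomes \<open>Re (Mj \<omega> * Gj \<omega>)\<close> times the power spectrum of
  \<open>z\<close>.\<close>

lemma freq_response_positive:
  assumes G: "is_freq_response G Gj" "G z \<in> L2"
    and z: "z \<in> L2" "integrable lborel z"
    and m: "m \<in> L2" "integrable lborel m" "\<And>\<omega>. fourier m \<omega> = cnj (Mj \<omega>) * fourier z \<omega>"
    and pos: "\<And>\<omega>. Re (Mj \<omega> * Gj \<omega>) \<ge> \<epsilon>"
  shows "\<epsilon> * (L2_norm z)\<^sup>2 \<le> L2_inner (G z) m"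
proof -
  have Gz: "is_fourier_L2 (G z) (\<lambda>\<omega>. Gj \<omega> * fourier z \<omega>)"
    using G z is_fourier_L2_fourier[OF z] by (auto simp: is_freq_response_def)
  note P = Parseval[OF G(2) Gz m(1) is_fourier_L2_fourier[OF m(1,2)]]
  have "2 * pi * (\<epsilon> * (L2_norm z)\<^sup>2) = (\<integral>\<omega>. \<epsilon> * (cmod (fourier z \<omega>))\<^sup>2 \<partial>lborel)"
    using Plancherel(2)[OF z] by simp
  also have "\<dots> \<le> (\<integral>\<omega>. Re (Gj \<omega> * fourier z \<omega> * cnj (fourier m \<omega>)) \<partial>lborel)"
  proof (rule integral_mono[OF _ P(1)])
    show "integrable lborel (\<lambda>\<omega>. \<epsilon> * (cmod (fourier z \<omega>))\<^sup>2)" using Plancherel(1)[OF z] by simp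
    fix \<omega>
    have re: "Re (w * complex_of_real r) = Re w * r" for w r by simp
    have "Gj \<omega> * fourier z \<omega> * cnj (fourier m \<omega>) = (Mj \<omega> * Gj \<omega>) * (fourier z \<omega> * cnj (fourier z \<omega>))"
      by (simp add: m(3))
    also have "fourier z \<omega> * cnj (fourier z \<omega>) = of_real ((cmod (fourier z \<omega>))\<^sup>2)"
      by (rule complex_norm_square[symmetric])
    finally have "Re (Gj \<omega> * fourier z \<omega> * cnj (fourier m \<omega>)) = Re (Mj \<omega> * Gj \<omega>) * (cmod (fourier z \<omega>))\<^sup>2"
      by (simp only: re)
    then show "\<epsilon> * (cmod (fourier z \<omega>))\<^sup>2 \<le> Re (Gj \<omega> * fourier z \<omega> * cnj (fourier m \<omega>))"
      using pos[of \<omega>] by (simp add: mult_right_mono)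
  qed
  also have "\<dots> = 2 * pi * L2_inner (G z) m" by (rule P(2))
  finally show ?thesis by simp
qed

subsection \<open>Convolution operators\<close>

text \<open>Convolution with the image of \<open>N\<close> under \<open>l\<close>. Keeping the pair
  lets impulses (a weighted counting measure with locations) and densities (a measure on the line
  with the identity) share all proofs.\<close>

definition mconv :: "'a measure \<Rightarrow> ('a \<Rightarrow> real) \<Rightarrow> operator" where
  "mconv N l u t = (\<integral>i. u (t - l i) \<partial>N)"

definition cross_corr :: "(real \<Rightarrow> real) \<Rightarrow> (real \<Rightarrow> real) \<Rightarrow> real \<Rightarrow> real" where
  "cross_corr u y s = L2_inner (\<lambda>t. u (t - s)) y"

lemma cross_corr_bound:
  "u \<in> L2 \<Longrightarrow> y \<in> L2 \<Longrightarrow> \<bar>cross_corr u y s\<bar> \<le> L2_norm u * L2_norm y"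
  unfolding cross_corr_def using L2_Cauchy_Schwarz[of "\<lambda>t. u (t - s)" y] by (simp add: L2_shift)

lemma cross_corr_measurable:
  assumes "u \<in> borel_measurable borel" "y \<in> borel_measurable borel"
  shows "cross_corr u y \<in> borel_measurable borel"
proof -
  note [measurable] = assms
  show ?thesis unfolding cross_corr_def[abs_def] L2_inner_def by measurable
qed

lemma cross_corr_commute: "cross_corr u y s = cross_corr y u (- s)"
  unfolding cross_corr_def L2_inner_def
  using lborel_integral_real_affine[of 1 "\<lambda>t. u (t - s) * y t" s] by (simp add: mult.commute add.commute)

context finite_measure
begin

lemma mconv_measurable:
  assumes l: "l \<in> borel_measurable M" and u: "u \<in> borel_measurable borel"
  shows "mconv M l u \<in> borel_measurable borel"
proof -
  note [measurable] = l u
  show ?thesis unfolding mconv_def[abs_def] by measurable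
qed

lemma cross_corr_integrable:
  assumes l: "l \<in> borel_measurable M" and u: "u \<in> L2" and y: "y \<in> L2"
  shows "integrable M (\<lambda>i. cross_corr u y (l i))"
proof (rule integrable_const_bound[where B = "L2_norm u * L2_norm y"])
  have [measurable]: "cross_corr u y \<in> borel_measurable borel"
    using cross_corr_measurable L2_measurable u y by blast
  note [measurable] = l
  show "(\<lambda>i. cross_corr u y (l i)) \<in> borel_measurable M" by measurable
qed (use cross_corr_bound u y in simp)

lemma mconv_square_integrable:
  assumes l: "l \<in> borel_measurable M" and u: "u \<in> L2"
  shows "integrable (lborel \<Otimes>\<^sub>M M) (\<lambda>(t, i). (u (t - l i))\<^sup>2)"
    and "(\<integral>t. (\<integral>i. (u (t - l i))\<^sup>2 \<partial>M) \<partial>lborel) = measure M (space M) * (L2_norm u)\<^sup>2"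
proof -
  interpret P: pair_sigma_finite M lborel ..
  note [measurable] = l L2_measurable[OF u]
  have sq: "(\<integral>t. (u (t - s))\<^sup>2 \<partial>lborel) = (L2_norm u)\<^sup>2" for s
    using L2_shift(2)[OF u, of s] by (simp add: L2_norm_def)
  have I: "integrable (M \<Otimes>\<^sub>M lborel) (\<lambda>(i, t). (u (t - l i))\<^sup>2)"
  proof (rule P.Fubini_integrable)
    show "(\<lambda>(i, t). (u (t - l i))\<^sup>2) \<in> borel_measurable (M \<Otimes>\<^sub>M lborel)" by measurable
    show "integrable M (\<lambda>i. \<integral>t. norm (case (i, t) of (i, t) \<Rightarrow> (u (t - l i))\<^sup>2) \<partial>lborel)"
      by (simp add: sq)
    show "AE i in M. integrable lborel (\<lambda>t. case (i, t) of (i, t) \<Rightarrow> (u (t - l i))\<^sup>2)"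
      using L2_square_integrable[OF L2_shift(1)[OF u]] by simp
  qed
  then show "integrable (lborel \<Otimes>\<^sub>M M) (\<lambda>(t, i). (u (t - l i))\<^sup>2)"
    by (subst (asm) P.integrable_product_swap_iff[symmetric]) (simp add: case_prod_beta)
  have "(\<integral>t. (\<integral>i. (u (t - l i))\<^sup>2 \<partial>M) \<partial>lborel) = (\<integral>i. (\<integral>t. (u (t - l i))\<^sup>2 \<partial>lborel) \<partial>M)"
    by (rule P.Fubini_integral[OF I])
  then show "(\<integral>t. (\<integral>i. (u (t - l i))\<^sup>2 \<partial>M) \<partial>lborel) = measure M (space M) * (L2_norm u)\<^sup>2"
    by (simp add: sq)
qed

lemma mconv_AE_square_integrable:
  assumes l: "l \<in> borel_measurable M" and u: "u \<in> L2"
  shows "AE t in lborel. integrable M (\<lambda>i. (u (t - l i))\<^sup>2)"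
proof -
  interpret Q: pair_sigma_finite lborel M ..
  show ?thesis using Q.AE_integrable_fst[OF mconv_square_integrable(1)[OF assms]] .
qed

text \<open>On a finite measure square integrability implies integrability, by multiplying with the
  constant \<open>1\<close>.\<close>

lemma mconv_AE_integrable:
  assumes l: "l \<in> borel_measurable M" and u: "u \<in> L2"
  shows "AE t in lborel. integrable M (\<lambda>i. u (t - l i))"
  using mconv_AE_square_integrable[OF assms]
proof eventually_elim
  case (elim t)
  note [measurable] = l L2_measurable[OF u]
  have "integrable M (\<lambda>i. 1 * u (t - l i))"
    by (rule integrable_mult_square) (use elim in simp_all)
  then show ?case by simp
qed

text \<open>Young's inequality for a finite measure. Pointwise Cauchy-Schwarz against the constant
  \<open>1\<close> gives one factor of the total mass, integrating the averaged squares over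
  \<open>t\<close> gives the other.\<close>

lemma mconv_L2:
  assumes l: "l \<in> borel_measurable M" and u: "u \<in> L2"
  shows "mconv M l u \<in> L2" "L2_norm (mconv M l u) \<le> measure M (space M) * L2_norm u"
proof -
  interpret Q: pair_sigma_finite lborel M ..
  note [measurable] = l L2_measurable[OF u]
  have m: "mconv M l u \<in> borel_measurable borel" by (rule mconv_measurable) simp_all
  let ?m = "measure M (space M)"
  let ?g = "\<lambda>t. ?m * (\<integral>i. (u (t - l i))\<^sup>2 \<partial>M)"
  have g: "integrable lborel ?g"
    using Q.integrable_fst[OF mconv_square_integrable(1)[OF assms]] by simp
  have le: "AE t in lborel. (mconv M l u t)\<^sup>2 \<le> ?g t"
    using mconv_AE_square_integrable[OF assms]
  proof eventually_elim
    case (elim t)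
    show ?case
      using integral_Cauchy_Schwarz[of "\<lambda>_. 1" M "\<lambda>i. u (t - l i)"] elim by (simp add: mconv_def)
  qed
  have I: "integrable lborel (\<lambda>t. (mconv M l u t)\<^sup>2)"
    by (rule Bochner_Integration.integrable_bound[OF g]) (use m le in \<open>auto elim: AE_mp\<close>)
  then show "mconv M l u \<in> L2" using m by (simp add: L2_def)
  have "(\<integral>t. (mconv M l u t)\<^sup>2 \<partial>lborel) \<le> (\<integral>t. ?g t \<partial>lborel)"
    by (rule integral_mono_AE[OF I g le])
  also have "\<dots> = (?m * L2_norm u)\<^sup>2"
    using mconv_square_integrable(2)[OF assms] by (simp add: power2_eq_square)
  finally have "(L2_norm (mconv M l u))\<^sup>2 \<le> (?m * L2_norm u)\<^sup>2" by (simp add: L2_norm_def)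
  then show "L2_norm (mconv M l u) \<le> ?m * L2_norm u" by (rule power2_le_imp_le) simp
qed

text \<open>By Fubini, pairing with a convolution is an average of cross-correlations; an inequality
  valid for every single shift therefore passes to the whole operator.\<close>

lemma mconv_inner:
  assumes l: "l \<in> borel_measurable M" and u: "u \<in> L2" and y: "y \<in> L2"
  shows "L2_inner (mconv M l u) y = (\<integral>i. cross_corr u y (l i) \<partial>M)"
proof -
  interpret P: pair_sigma_finite M lborel ..
  note [measurable] = l L2_measurable[OF u] L2_measurable[OF y]
  let ?a = "\<lambda>v t. \<bar>v t :: real\<bar>"
  \<comment> \<open>The absolute double integral is the average of the cross-correlation of
    \<open>\<bar>u\<bar>\<close> and \<open>\<bar>y\<bar>\<close>, hence finite once both are in
    \<open>L2\<close>.\<close>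
  have abs: "?a v \<in> L2" if "v \<in> L2" for v
    using that by (intro L2_bound[OF that, of _ 1]) (auto simp: L2_def)
  have I: "integrable (M \<Otimes>\<^sub>M lborel) (\<lambda>(i, t). u (t - l i) * y t)"
  proof (rule P.Fubini_integrable)
    show "(\<lambda>(i, t). u (t - l i) * y t) \<in> borel_measurable (M \<Otimes>\<^sub>M lborel)" by measurable
    show "integrable M (\<lambda>i. \<integral>t. norm (case (i, t) of (i, t) \<Rightarrow> u (t - l i) * y t) \<partial>lborel)"
      using cross_corr_integrable[OF l abs[OF u] abs[OF y]]
      by (simp add: cross_corr_def L2_inner_def abs_mult)
    show "AE i in M. integrable lborel (\<lambda>t. case (i, t) of (i, t) \<Rightarrow> u (t - l i) * y t)"
      using L2_mult_integrable[OF L2_shift(1)[OF u] y] by simp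
  qed
  have "L2_inner (mconv M l u) y = (\<integral>t. (\<integral>i. u (t - l i) * y t \<partial>M) \<partial>lborel)"
    by (simp add: L2_inner_def mconv_def)
  also have "\<dots> = (\<integral>i. (\<integral>t. u (t - l i) * y t \<partial>lborel) \<partial>M)"
    by (rule P.Fubini_integral[OF I])
  finally show ?thesis by (simp add: cross_corr_def L2_inner_def)
qed

text \<open>A shift by \<open>s\<close> multiplies the transform by
  \<open>cis (- (\<omega> * s))\<close>, and averaging the shifts averages these factors. The case
  of frequency \<open>0\<close> gives integrability.\<close>

lemma mconv_fourier:
  assumes l: "l \<in> borel_measurable M" and x: "integrable lborel x"
  shows "integrable lborel (mconv M l x)"
    and "fourier (mconv M l x) \<omega> = (\<integral>i. cis (- (\<omega> * l i)) \<partial>M) * fourier x \<omega>"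
proof -
  interpret P: pair_sigma_finite M lborel ..
  have [measurable]: "x \<in> borel_measurable borel" using x by simp
  note [measurable] = l
  have sh: "integrable lborel (\<lambda>t. x (t - s))" for s
    using lborel_integrable_real_affine[OF x, of 1 "- s"] by simp
  have I: "integrable (M \<Otimes>\<^sub>M lborel) (case_prod (\<lambda>i t. complex_of_real (x (t - l i)) * cis (- (\<omega> * t))))" for \<omega>
  proof (rule P.Fubini_integrable)
    show "case_prod (\<lambda>i t. complex_of_real (x (t - l i)) * cis (- (\<omega> * t))) \<in> borel_measurable (M \<Otimes>\<^sub>M lborel)"
      by measurable
    have "(\<integral>t. \<bar>x (t - s)\<bar> \<partial>lborel) = (\<integral>t. \<bar>x t\<bar> \<partial>lborel)" for s
      using lborel_integral_real_affine[of 1 "\<lambda>t. \<bar>x (t - s)\<bar>" s] by simp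
    then show "integrable M (\<lambda>i. \<integral>t. norm (case (i, t) of (i, t) \<Rightarrow>
        complex_of_real (x (t - l i)) * cis (- (\<omega> * t))) \<partial>lborel)"
      by (simp add: norm_mult)
    have "integrable lborel (\<lambda>t. complex_of_real (x (t - s)) * cis (- (\<omega> * t)))" for s
      by (rule integrable_of_real_cis[OF sh]) simp
    then show "AE i in M. integrable lborel (\<lambda>t. case (i, t) of (i, t) \<Rightarrow>
        complex_of_real (x (t - l i)) * cis (- (\<omega> * t)))" by simp
  qed
  have "integrable lborel (\<lambda>t. Re (\<integral>i. complex_of_real (x (t - l i)) * cis (- (0 * t)) \<partial>M))"
    by (intro integrable_Re P.integrable_snd I)
  then show "integrable lborel (mconv M l x)" by (simp add: mconv_def[abs_def])
  have inner: "(\<integral>t. complex_of_real (x (t - s)) * cis (- (\<omega> * t)) \<partial>lborel)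
      = cis (- (\<omega> * s)) * fourier x \<omega>" for s
  proof -
    have "(\<integral>t. complex_of_real (x (t - s)) * cis (- (\<omega> * t)) \<partial>lborel)
        = \<bar>1\<bar> *\<^sub>R (\<integral>t. complex_of_real (x ((s + 1 * t) - s)) * cis (- (\<omega> * (s + 1 * t))) \<partial>lborel)"
      by (rule lborel_integral_real_affine) simp
    also have "\<dots> = (\<integral>t. cis (- (\<omega> * s)) * (complex_of_real (x t) * cis (- (\<omega> * t))) \<partial>lborel)"
      unfolding abs_one scaleR_one
      by (rule Bochner_Integration.integral_cong) (simp_all add: cis_mult algebra_simps)
    finally show ?thesis by (simp add: fourier_def)
  qed
  have "fourier (mconv M l x) \<omega> = (\<integral>t. (\<integral>i. complex_of_real (x (t - l i)) * cis (- (\<omega> * t)) \<partial>M) \<partial>lborel)"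
    by (simp add: fourier_def mconv_def)
  also have "\<dots> = (\<integral>i. (\<integral>t. complex_of_real (x (t - l i)) * cis (- (\<omega> * t)) \<partial>lborel) \<partial>M)"
    by (rule P.Fubini_integral[OF I])
  also have "\<dots> = (\<integral>i. cis (- (\<omega> * l i)) \<partial>M) * fourier x \<omega>"
    unfolding inner by simp
  finally show "fourier (mconv M l x) \<omega> = (\<integral>i. cis (- (\<omega> * l i)) \<partial>M) * fourier x \<omega>" .
qed

end

section \<open>Impulse responses as pairs of finite measures\<close>

definition impulse_measure :: "impulse_response \<Rightarrow> nat measure" where
  "impulse_measure h = density (count_space UNIV) (\<lambda>i. ennreal (wt h i))"

definition dens_measure :: "impulse_response \<Rightarrow> real measure" where
  "dens_measure h = density lborel (\<lambda>s. ennreal (dens h s))"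

text \<open>Time reversal, which produces the impulse response of the adjoint convolution
  operator.\<close>

definition reflect :: "impulse_response \<Rightarrow> impulse_response" where
  "reflect h = \<lparr>wt = wt h, loc = \<lambda>i. - loc h i, dens = \<lambda>t. dens h (- t)\<rparr>"

lemma Hp_setD:
  assumes "h \<in> Hp_set"
  shows "wt h i \<ge> 0" "dens h t \<ge> 0" "dens h \<in> borel_measurable borel" "summable (wt h)"
    "integrable lborel (dens h)" "H_norm h = (\<Sum>i. wt h i) + (\<integral>t. dens h t \<partial>lborel)"
  using assms by (auto simp: Hp_set_def H_set_def H_norm_def)

lemma H_norm_nonneg: "h \<in> Hp_set \<Longrightarrow> H_norm h \<ge> 0"
  by (simp add: Hp_setD suminf_nonneg integral_nonneg_AE)

lemma reflect_Hp_set: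
  assumes "h \<in> Hp_set" shows "reflect h \<in> Hp_set" "H_norm (reflect h) = H_norm h"
proof -
  note [measurable] = Hp_setD(3)[OF assms]
  show "reflect h \<in> Hp_set"
    using assms lborel_integrable_real_affine[of "dens h" "-1" 0]
    by (auto simp: Hp_set_def H_set_def reflect_def)
  then show "H_norm (reflect h) = H_norm h"
    using lborel_integral_real_affine[of "-1" "dens h" 0] assms
    by (simp add: Hp_setD(6)) (simp add: reflect_def)
qed

lemma impulse_measurable [measurable]: "f \<in> borel_measurable (impulse_measure h)"
  by (simp add: impulse_measure_def)

lemma id_dens_measurable: "(\<lambda>s. s) \<in> borel_measurable (dens_measure h)"
  by (simp add: dens_measure_def)

lemma impulse_measure_mass:
  assumes "h \<in> Hp_set"
  shows "finite_measure (impulse_measure h)"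
    "measure (impulse_measure h) (space (impulse_measure h)) = (\<Sum>i. wt h i)"
proof -
  have e: "emeasure (impulse_measure h) (space (impulse_measure h)) = ennreal (\<Sum>i. wt h i)"
    using Hp_setD[OF assms]
    by (simp add: impulse_measure_def emeasure_density nn_integral_count_space_nat suminf_ennreal2)
  show "finite_measure (impulse_measure h)" by (rule finite_measureI) (simp add: e)
  show "measure (impulse_measure h) (space (impulse_measure h)) = (\<Sum>i. wt h i)"
    using Hp_setD[OF assms] by (simp add: measure_def e suminf_nonneg)
qed

lemma dens_measure_mass:
  assumes "h \<in> Hp_set"
  shows "finite_measure (dens_measure h)"
    "measure (dens_measure h) (space (dens_measure h)) = (\<integral>t. dens h t \<partial>lborel)"
proof -
  have e: "emeasure (dens_measure h) (space (dens_measure h)) = ennreal (\<integral>t. dens h t \<partial>lborel)"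
    using Hp_setD[OF assms] by (simp add: dens_measure_def emeasure_density nn_integral_eq_integral)
  show "finite_measure (dens_measure h)" by (rule finite_measureI) (simp add: e)
  show "measure (dens_measure h) (space (dens_measure h)) = (\<integral>t. dens h t \<partial>lborel)"
    using Hp_setD[OF assms] by (simp add: measure_def e integral_nonneg_AE)
qed

lemma integral_impulse_measure:
  fixes f :: "nat \<Rightarrow> 'b :: {banach, second_countable_topology}"
  assumes "h \<in> Hp_set" "integrable (impulse_measure h) f"
  shows "(\<integral>i. f i \<partial>impulse_measure h) = (\<Sum>i. wt h i *\<^sub>R f i)"
  using assms(2) Hp_setD(1)[OF assms(1)]
  by (simp add: impulse_measure_def integral_density integrable_density integral_count_space_nat)

lemma integral_dens_measure:
  fixes f :: "real \<Rightarrow> 'b :: {banach, second_countable_topology}"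
  assumes "h \<in> Hp_set" "f \<in> borel_measurable borel"
  shows "(\<integral>s. f s \<partial>dens_measure h) = (\<integral>s. dens h s *\<^sub>R f s \<partial>lborel)"
  using assms(2) Hp_setD[OF assms(1)] by (simp add: dens_measure_def integral_density)

abbreviation impulse_conv :: "impulse_response \<Rightarrow> operator" where
  "impulse_conv h \<equiv> mconv (impulse_measure h) (loc h)"

abbreviation dens_conv :: "impulse_response \<Rightarrow> operator" where
  "dens_conv h \<equiv> mconv (dens_measure h) (\<lambda>s. s)"

lemma conv_op_measurable:
  assumes h: "h \<in> Hp_set" and u: "u \<in> borel_measurable borel"
  shows "conv_op h u \<in> borel_measurable borel"
proof -
  note [measurable] = Hp_setD(3)[OF h] u
  show ?thesis unfolding conv_op_def by measurable
qed

text \<open>At exceptional \<open>t\<close> the series in \<open>conv_op\<close> may fail to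
  converge absolutely and then need not match the Bochner integral, which defaults to
  \<open>0\<close>. The density part agrees at every \<open>t\<close>.\<close>

lemma conv_op_AE:
  assumes h: "h \<in> Hp_set" and u: "u \<in> L2"
  shows "AE t in lborel. conv_op h u t = impulse_conv h u t + dens_conv h u t"
  using finite_measure.mconv_AE_integrable[OF impulse_measure_mass(1)[OF h] impulse_measurable u, of "loc h"]
proof eventually_elim
  case (elim t)
  note [measurable] = L2_measurable[OF u]
  have "(\<integral>s. u (t - s) \<partial>dens_measure h) = (\<integral>s. dens h s *\<^sub>R u (t - s) \<partial>lborel)"
    by (rule integral_dens_measure[OF h]) measurable
  then show ?case
    using integral_impulse_measure[OF h elim] by (simp add: conv_op_def mconv_def)
qed

lemma impulse_conv_L2:
  assumes h: "h \<in> Hp_set" and u: "u \<in> L2"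
  shows "impulse_conv h u \<in> L2" "L2_norm (impulse_conv h u) \<le> (\<Sum>i. wt h i) * L2_norm u"
  using finite_measure.mconv_L2[OF impulse_measure_mass(1)[OF h] impulse_measurable u, of "loc h"]
  by (simp_all add: impulse_measure_mass(2)[OF h])

lemma dens_conv_L2:
  assumes h: "h \<in> Hp_set" and u: "u \<in> L2"
  shows "dens_conv h u \<in> L2" "L2_norm (dens_conv h u) \<le> (\<integral>t. dens h t \<partial>lborel) * L2_norm u"
  using finite_measure.mconv_L2[OF dens_measure_mass(1)[OF h] id_dens_measurable u]
  by (simp_all add: dens_measure_mass(2)[OF h])

lemma conv_op_L2:
  assumes h: "h \<in> Hp_set" and u: "u \<in> L2"
  shows "conv_op h u \<in> L2" "L2_norm (conv_op h u) \<le> H_norm h * L2_norm u"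
proof -
  note C = impulse_conv_L2[OF h u] dens_conv_L2[OF h u]
  let ?s = "\<lambda>t. impulse_conv h u t + dens_conv h u t"
  have s: "?s \<in> L2" using C by (intro L2_add)
  have m: "conv_op h u \<in> borel_measurable borel" by (rule conv_op_measurable[OF h L2_measurable[OF u]])
  show "conv_op h u \<in> L2" by (rule L2_AE_cong[OF s m conv_op_AE[OF h u]])
  have "L2_norm (conv_op h u) = L2_norm ?s"
    by (rule L2_norm_cong[OF m L2_measurable[OF s] conv_op_AE[OF h u]])
  also have "\<dots> \<le> H_norm h * L2_norm u"
    using L2_norm_triangle[OF C(1) C(3)] C(2) C(4) by (simp add: Hp_setD(6)[OF h] algebra_simps)
  finally show "L2_norm (conv_op h u) \<le> H_norm h * L2_norm u" .
qed

lemma conv_op_diff: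
  assumes h: "h \<in> Hp_set" and u: "u \<in> L2" and v: "v \<in> L2"
  shows "AE t in lborel. conv_op h (\<lambda>t. u t - v t) t = conv_op h u t - conv_op h v t"
proof -
  interpret I: finite_measure "impulse_measure h" by (rule impulse_measure_mass(1)[OF h])
  interpret D: finite_measure "dens_measure h" by (rule dens_measure_mass(1)[OF h])
  have m: "(\<lambda>s. s) \<in> borel_measurable (dens_measure h)" by (rule id_dens_measurable)
  show ?thesis
    using conv_op_AE[OF h u] conv_op_AE[OF h v] conv_op_AE[OF h L2_diff[OF u v]]
      I.mconv_AE_integrable[OF impulse_measurable u, of "loc h"]
      I.mconv_AE_integrable[OF impulse_measurable v, of "loc h"]
      D.mconv_AE_integrable[OF m u] D.mconv_AE_integrable[OF m v]
    by eventually_elim (simp add: mconv_def)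
qed

lemma conv_op_inner:
  assumes h: "h \<in> Hp_set" and u: "u \<in> L2" and y: "y \<in> L2"
  shows "L2_inner (conv_op h u) y =
    (\<integral>i. cross_corr u y (loc h i) \<partial>impulse_measure h) + (\<integral>s. cross_corr u y s \<partial>dens_measure h)"
proof -
  interpret I: finite_measure "impulse_measure h" by (rule impulse_measure_mass(1)[OF h])
  interpret D: finite_measure "dens_measure h" by (rule dens_measure_mass(1)[OF h])
  have m: "(\<lambda>s. s) \<in> borel_measurable (dens_measure h)" by (rule id_dens_measurable)
  note C = impulse_conv_L2[OF h u] dens_conv_L2[OF h u]
  have "L2_inner (conv_op h u) y = L2_inner (\<lambda>t. impulse_conv h u t + dens_conv h u t) y"
    by (intro L2_inner_cong conv_op_AE h u L2_measurable L2_add C conv_op_L2 y) simp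
  also have "\<dots> = L2_inner (impulse_conv h u) y + L2_inner (dens_conv h u) y"
    by (intro L2_inner_add_left C y)
  finally show ?thesis
    by (simp add: I.mconv_inner[OF impulse_measurable u y] D.mconv_inner[OF m u y])
qed

text \<open>Every shift contributes at most \<open>p\<close>, and the two measures have total mass
  \<open>H_norm h\<close>. Nonnegativity of the response enters here: it is what makes the averages
  monotone.\<close>

lemma conv_op_inner_le:
  assumes h: "h \<in> Hp_set" and u: "u \<in> L2" and y: "y \<in> L2" and le: "\<And>s. cross_corr u y s \<le> p"
  shows "L2_inner (conv_op h u) y \<le> H_norm h * p"
proof -
  interpret I: finite_measure "impulse_measure h" by (rule impulse_measure_mass(1)[OF h])
  interpret D: finite_measure "dens_measure h" by (rule dens_measure_mass(1)[OF h])
  have m: "(\<lambda>s. s) \<in> borel_measurable (dens_measure h)" by (rule id_dens_measurable)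
  have "(\<integral>i. cross_corr u y (loc h i) \<partial>impulse_measure h) \<le> (\<integral>i. p \<partial>impulse_measure h)"
    by (intro integral_mono I.cross_corr_integrable impulse_measurable u y le) simp
  moreover have "(\<integral>s. cross_corr u y s \<partial>dens_measure h) \<le> (\<integral>s. p \<partial>dens_measure h)"
    by (intro integral_mono D.cross_corr_integrable m u y le) simp
  ultimately show ?thesis
    by (simp add: conv_op_inner[OF h u y] impulse_measure_mass(2)[OF h] dens_measure_mass(2)[OF h]
        Hp_setD(6)[OF h] algebra_simps)
qed

text \<open>The upper estimate applied to \<open>- y\<close>.\<close>

lemma conv_op_inner_ge:
  assumes h: "h \<in> Hp_set" and u: "u \<in> L2" and y: "y \<in> L2" and ge: "\<And>s. p \<le> cross_corr u y s"
  shows "H_norm h * p \<le> L2_inner (conv_op h u) y"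
proof -
  have y': "(\<lambda>t. - 1 * y t) \<in> L2" by (rule L2_scale[OF y])
  have "cross_corr u (\<lambda>t. - 1 * y t) s = - cross_corr u y s" for s
    by (simp add: cross_corr_def L2_inner_def)
  then have "L2_inner (conv_op h u) (\<lambda>t. - 1 * y t) \<le> H_norm h * (- p)"
    using ge by (intro conv_op_inner_le h u y') simp
  then show ?thesis by (simp add: L2_inner_def)
qed

text \<open>Reversing the shift exchanges the arguments of a cross-correlation, so reflecting
  locations and density moves the operator to the other side; the weights stay the same.\<close>

lemma conv_op_adjoint:
  assumes h: "h \<in> Hp_set" and u: "u \<in> L2" and y: "y \<in> L2"
  shows "L2_inner (conv_op h u) y = L2_inner u (conv_op (reflect h) y)"
proof -
  have m: "cross_corr u y \<in> borel_measurable borel" "cross_corr y u \<in> borel_measurable borel"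
    by (intro cross_corr_measurable L2_measurable u y)+
  have i: "impulse_measure (reflect h) = impulse_measure h"
    by (simp add: impulse_measure_def reflect_def)
  have "(\<integral>s. cross_corr y u s \<partial>dens_measure (reflect h)) = (\<integral>s. dens h (- s) *\<^sub>R cross_corr u y (- s) \<partial>lborel)"
    using integral_dens_measure[OF reflect_Hp_set(1)[OF h] m(2)]
    by (simp add: reflect_def cross_corr_commute[of y u])
  also have "\<dots> = (\<integral>s. dens h s *\<^sub>R cross_corr u y s \<partial>lborel)"
    using lborel_integral_real_affine[of "-1" "\<lambda>s. dens h s *\<^sub>R cross_corr u y s" 0] by simp
  also have "\<dots> = (\<integral>s. cross_corr u y s \<partial>dens_measure h)"
    by (rule integral_dens_measure[OF h m(1), symmetric])
  finally have d: "(\<integral>s. cross_corr y u s \<partial>dens_measure (reflect h)) = (\<integral>s. cross_corr u y s \<partial>dens_measure h)" .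
  have "(\<integral>i. cross_corr y u (loc (reflect h) i) \<partial>impulse_measure h) = (\<integral>i. cross_corr u y (loc h i) \<partial>impulse_measure h)"
    by (simp add: reflect_def cross_corr_commute[of y u])
  then show ?thesis
    unfolding L2_inner_commute[of u] conv_op_inner[OF h u y] conv_op_inner[OF reflect_Hp_set(1)[OF h] y u] d i
    by simp
qed

lemma cis_integrable:
  assumes "finite_measure N" "f \<in> borel_measurable N" shows "integrable N (\<lambda>i. cis (f i))"
proof -
  note [measurable] = assms(2)
  show ?thesis by (rule finite_measure.integrable_const_bound[OF assms(1), where B = 1]) simp_all
qed

lemma conv_freq_eq:
  assumes h: "h \<in> Hp_set"
  shows "conv_freq h \<omega> = (\<integral>i. cis (- (\<omega> * loc h i)) \<partial>impulse_measure h)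
    + (\<integral>s. cis (- (\<omega> * s)) \<partial>dens_measure h)"
  using integral_impulse_measure[OF h cis_integrable[OF impulse_measure_mass(1)[OF h] impulse_measurable],
      of "\<lambda>i. - (\<omega> * loc h i)"]
    integral_dens_measure[OF h, of "\<lambda>s. cis (- (\<omega> * s))"]
  by (simp add: conv_freq_def scaleR_conv_of_real)

text \<open>The response is real, so reversing time conjugates its transform.\<close>

lemma conv_freq_reflect:
  assumes h: "h \<in> Hp_set" shows "conv_freq (reflect h) \<omega> = cnj (conv_freq h \<omega>)"
proof -
  have i: "impulse_measure (reflect h) = impulse_measure h"
    by (simp add: impulse_measure_def reflect_def)
  have 1: "(\<integral>i. cis (- (\<omega> * loc (reflect h) i)) \<partial>impulse_measure h)
      = cnj (\<integral>i. cis (- (\<omega> * loc h i)) \<partial>impulse_measure h)"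
    unfolding Bochner_Integration.integral_cnj[symmetric]
    by (rule Bochner_Integration.integral_cong) (simp_all add: reflect_def cis_cnj)
  have "(\<integral>s. cis (- (\<omega> * s)) \<partial>dens_measure (reflect h)) = (\<integral>s. dens h (- s) *\<^sub>R cis (- (\<omega> * s)) \<partial>lborel)"
    by (subst integral_dens_measure[OF reflect_Hp_set(1)[OF h]]) (simp_all add: reflect_def)
  also have "\<dots> = (\<integral>s. dens h s *\<^sub>R cis (\<omega> * s) \<partial>lborel)"
    using lborel_integral_real_affine[of "-1" "\<lambda>s. dens h s *\<^sub>R cis (\<omega> * s)" 0] by simp
  also have "\<dots> = (\<integral>s. cis (\<omega> * s) \<partial>dens_measure h)"
    by (rule integral_dens_measure[OF h, symmetric]) simp
  also have "\<dots> = cnj (\<integral>s. cis (- (\<omega> * s)) \<partial>dens_measure h)"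
    unfolding Bochner_Integration.integral_cnj[symmetric]
    by (rule Bochner_Integration.integral_cong) (simp_all add: cis_cnj)
  finally show ?thesis
    unfolding conv_freq_eq[OF h] conv_freq_eq[OF reflect_Hp_set(1)[OF h]] i 1 by simp
qed

lemma conv_op_fourier:
  assumes h: "h \<in> Hp_set" and x: "x \<in> L2" "integrable lborel x"
  shows "integrable lborel (conv_op h x)" "fourier (conv_op h x) \<omega> = conv_freq h \<omega> * fourier x \<omega>"
proof -
  interpret I: finite_measure "impulse_measure h" by (rule impulse_measure_mass(1)[OF h])
  interpret D: finite_measure "dens_measure h" by (rule dens_measure_mass(1)[OF h])
  have m: "(\<lambda>s. s) \<in> borel_measurable (dens_measure h)" by (rule id_dens_measurable)
  note i = I.mconv_fourier[OF impulse_measurable x(2), of "loc h"] and d = D.mconv_fourier[OF m x(2)]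
  have meas [measurable]: "conv_op h x \<in> borel_measurable borel"
    by (rule conv_op_measurable[OF h L2_measurable[OF x(1)]])
  let ?s = "\<lambda>t. impulse_conv h x t + dens_conv h x t"
  have s: "integrable lborel ?s" using i(1) d(1) by simp
  have [measurable]: "?s \<in> borel_measurable borel" using borel_measurable_integrable[OF s] by simp
  show "integrable lborel (conv_op h x)"
    by (rule integrable_cong_AE_imp[OF s]) (use meas conv_op_AE[OF h x(1)] in auto)
  have "fourier (conv_op h x) \<omega> = fourier ?s \<omega>"
    unfolding fourier_def
  proof (rule integral_cong_AE)
    show "AE t in lborel. complex_of_real (conv_op h x t) * cis (- (\<omega> * t))
        = complex_of_real (?s t) * cis (- (\<omega> * t))"
      using conv_op_AE[OF h x(1)] by eventually_elim simp
  qed measurable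
  also have "\<dots> = conv_freq h \<omega> * fourier x \<omega>"
    unfolding fourier_add[OF i(1) d(1)] i(2) d(2) conv_freq_eq[OF h] by (simp add: algebra_simps)
  finally show "fourier (conv_op h x) \<omega> = conv_freq h \<omega> * fourier x \<omega>" .
qed

subsection \<open>The multiplier\<close>

lemma mult_op_L2:
  assumes "h \<in> Hp_set" "k \<in> Hp_set" "u \<in> L2" shows "mult_op h k u \<in> L2"
  unfolding mult_op_def by (intro L2_add L2_diff conv_op_L2 assms)

lemma mult_op_adjoint:
  assumes h: "h \<in> Hp_set" "k \<in> Hp_set" and u: "u \<in> L2" and y: "y \<in> L2"
  shows "L2_inner (mult_op h k u) y = L2_inner u (mult_op (reflect h) (reflect k) y)"
proof -
  note C = conv_op_L2(1)[OF h(1) u] conv_op_L2(1)[OF h(2) u]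
  note R = reflect_Hp_set(1)[OF h(1)] reflect_Hp_set(1)[OF h(2)]
  note C' = conv_op_L2(1)[OF R(1) y] conv_op_L2(1)[OF R(2) y]
  have "L2_inner (mult_op h k u) y = L2_inner u y - L2_inner (conv_op h u) y + L2_inner (conv_op k u) y"
    unfolding mult_op_def L2_inner_add_left[OF L2_diff[OF u C(1)] C(2) y] L2_inner_diff_left[OF u C(1) y] ..
  also have "\<dots> = L2_inner u y - L2_inner u (conv_op (reflect h) y) + L2_inner u (conv_op (reflect k) y)"
    by (simp add: conv_op_adjoint h u y)
  also have "\<dots> = L2_inner u (mult_op (reflect h) (reflect k) y)"
    unfolding mult_op_def L2_inner_add_right[OF L2_diff[OF y C'(1)] C'(2) u] L2_inner_diff_right[OF y C'(1) u] ..
  finally show ?thesis .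
qed

text \<open>Together with \<open>H_norm h + H_norm k < 1\<close> this makes \<open>1 - M\<close> a
  contraction, which drives the continuations beyond \<open>T\<close>.\<close>

lemma mult_op_norm:
  assumes h: "h \<in> Hp_set" "k \<in> Hp_set" and u: "u \<in> L2"
  shows "L2_norm (\<lambda>t. u t - mult_op h k u t) \<le> (H_norm h + H_norm k) * L2_norm u"
proof -
  have "L2_norm (\<lambda>t. u t - mult_op h k u t) = L2_norm (\<lambda>t. conv_op h u t - conv_op k u t)"
    by (simp add: mult_op_def)
  also have "\<dots> \<le> L2_norm (conv_op h u) + L2_norm (conv_op k u)"
    by (intro L2_norm_triangle_diff conv_op_L2 h u)
  also have "\<dots> \<le> (H_norm h + H_norm k) * L2_norm u"
    using conv_op_L2(2)[OF h(1) u] conv_op_L2(2)[OF h(2) u] by (simp add: algebra_simps)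
  finally show ?thesis .
qed

lemma mult_op_diff:
  assumes h: "h \<in> Hp_set" "k \<in> Hp_set" and u: "u \<in> L2" and v: "v \<in> L2"
  shows "AE t in lborel. mult_op h k (\<lambda>t. u t - v t) t = mult_op h k u t - mult_op h k v t"
  using conv_op_diff[OF h(1) u v] conv_op_diff[OF h(2) u v]
  by eventually_elim (simp add: mult_op_def)

lemma mult_op_fourier:
  assumes h: "h \<in> Hp_set" "k \<in> Hp_set" and x: "x \<in> L2" "integrable lborel x"
  shows "integrable lborel (mult_op h k x)" "fourier (mult_op h k x) \<omega> = mult_freq h k \<omega> * fourier x \<omega>"
proof -
  note C = conv_op_fourier[OF h(1) x] conv_op_fourier[OF h(2) x]
  show "integrable lborel (mult_op h k x)" unfolding mult_op_def using x C by simp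
  have "integrable lborel (\<lambda>t. x t - conv_op h x t)" using x C by simp
  then show "fourier (mult_op h k x) \<omega> = mult_freq h k \<omega> * fourier x \<omega>"
    unfolding mult_op_def
    using x C by (simp add: fourier_add fourier_diff mult_freq_def algebra_simps)
qed

lemma mult_freq_reflect:
  assumes "h \<in> Hp_set" "k \<in> Hp_set"
  shows "mult_freq (reflect h) (reflect k) \<omega> = cnj (mult_freq h k \<omega>)"
  using assms by (simp add: mult_freq_def conv_freq_reflect)

subsection \<open>Positivity of the multiplier with the nonlinearity\<close>

lemma lin_bounded_zero: assumes "lin_bounded f" shows "f 0 = 0"
proof -
  obtain C where "\<And>x. \<bar>f x\<bar> \<le> C * \<bar>x\<bar>" using assms by (auto simp: lin_bounded_def)
  from this[of 0] show ?thesis by simp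
qed

lemma mono_comp_L2:
  assumes "mono f" "lin_bounded f" "u \<in> L2"
  shows "(\<lambda>t. f (u t)) \<in> L2"
proof -
  obtain C where C: "\<And>x. \<bar>f x\<bar> \<le> C * \<bar>x\<bar>" using assms(2) by (auto simp: lin_bounded_def)
  note [measurable] = L2_measurable[OF assms(3)] borel_measurable_mono[OF assms(1)]
  show ?thesis by (rule L2_bound[where c = C and y = u]) (use assms(3) C in auto)
qed

text \<open>The oriented integral of \<open>f\<close> from \<open>0\<close> to \<open>x\<close>.
  Writing it as one integral over the line makes it visibly measurable in \<open>x\<close>, and
  half-open intervals join without overlap.\<close>

definition primitive :: "(real \<Rightarrow> real) \<Rightarrow> real \<Rightarrow> real" where
  "primitive f x = (\<integral>\<xi>. (if 0 \<le> \<xi> \<and> \<xi> < x then f \<xi> else if x \<le> \<xi> \<and> \<xi> < 0 then - f \<xi> else 0) \<partial>lborel)"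

lemma mono_interval_integrable:
  fixes f :: "real \<Rightarrow> real"
  assumes "mono f" shows "integrable lborel (\<lambda>\<xi>. indicator {x..<y} \<xi> * f \<xi>)"
proof (rule Bochner_Integration.integrable_bound)
  note [measurable] = borel_measurable_mono[OF assms]
  have "integrable lborel (indicator {x..y} :: real \<Rightarrow> real)"
    by (rule integrable_real_indicator) (simp_all add: emeasure_lborel_Icc_eq)
  then show "integrable lborel (\<lambda>\<xi>. (\<bar>f x\<bar> + \<bar>f y\<bar>) * indicator {x..y} \<xi>)" by simp
  show "(\<lambda>\<xi>. indicator {x..<y} \<xi> * f \<xi>) \<in> borel_measurable lborel" by measurable
  have "\<bar>f \<xi>\<bar> \<le> \<bar>f x\<bar> + \<bar>f y\<bar>" if "x \<le> \<xi>" "\<xi> < y" for \<xi>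
    using monoD[OF assms that(1)] monoD[OF assms less_imp_le[OF that(2)]] by linarith
  then show "AE \<xi> in lborel. norm (indicator {x..<y} \<xi> * f \<xi>) \<le> norm ((\<bar>f x\<bar> + \<bar>f y\<bar>) * indicator {x..y} \<xi>)"
    by (intro always_eventually allI) (simp add: indicator_def)
qed

text \<open>The difference is the integral of \<open>f\<close> over \<open>[x, y)\<close>, where
  monotonicity keeps \<open>f\<close> between \<open>f x\<close> and \<open>f y\<close>.\<close>

lemma primitive_diff:
  assumes f: "mono f" and "x \<le> y"
  shows "f x * (y - x) \<le> primitive f y - primitive f x" "primitive f y - primitive f x \<le> f y * (y - x)"
proof -
  have P: "primitive f z = (\<integral>\<xi>. indicator {0..<z} \<xi> * f \<xi> \<partial>lborel) - (\<integral>\<xi>. indicator {z..<0} \<xi> * f \<xi> \<partial>lborel)" for z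
    unfolding primitive_def
    by (subst Bochner_Integration.integral_diff[symmetric], (rule mono_interval_integrable[OF f])+,
        rule Bochner_Integration.integral_cong) (auto simp: indicator_def)
  note I = mono_interval_integrable[OF f]
  have "primitive f y - primitive f x = (\<integral>\<xi>. (indicator {0..<y} \<xi> * f \<xi> - indicator {y..<0} \<xi> * f \<xi>)
      - (indicator {0..<x} \<xi> * f \<xi> - indicator {x..<0} \<xi> * f \<xi>) \<partial>lborel)"
    unfolding P using I by simp
  also have "\<dots> = (\<integral>\<xi>. indicator {x..<y} \<xi> * f \<xi> \<partial>lborel)"
    by (rule Bochner_Integration.integral_cong) (use \<open>x \<le> y\<close> in \<open>auto simp: indicator_def\<close>)
  finally have eq: "primitive f y - primitive f x = (\<integral>\<xi>. indicator {x..<y} \<xi> * f \<xi> \<partial>lborel)" .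
  have c: "integrable lborel (\<lambda>\<xi>. indicator {x..<y} \<xi> * c)" "(\<integral>\<xi>. indicator {x..<y} \<xi> * c \<partial>lborel) = c * (y - x)" for c :: real
  proof -
    have "integrable lborel (indicator {x..<y} :: real \<Rightarrow> real)"
      by (rule integrable_real_indicator) (use \<open>x \<le> y\<close> in simp_all)
    then show "integrable lborel (\<lambda>\<xi>. indicator {x..<y} \<xi> * c)" by simp
    show "(\<integral>\<xi>. indicator {x..<y} \<xi> * c \<partial>lborel) = c * (y - x)"
      using \<open>x \<le> y\<close> by simp
  qed
  have "f x * (y - x) = (\<integral>\<xi>. indicator {x..<y} \<xi> * f x \<partial>lborel)" by (simp only: c(2))
  also have "\<dots> \<le> (\<integral>\<xi>. indicator {x..<y} \<xi> * f \<xi> \<partial>lborel)"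
    by (rule integral_mono[OF c(1) I]) (use f in \<open>auto simp: indicator_def mono_def\<close>)
  finally show "f x * (y - x) \<le> primitive f y - primitive f x" unfolding eq .
  have "(\<integral>\<xi>. indicator {x..<y} \<xi> * f \<xi> \<partial>lborel) \<le> (\<integral>\<xi>. indicator {x..<y} \<xi> * f y \<partial>lborel)"
    by (rule integral_mono[OF I c(1)]) (use f in \<open>auto simp: indicator_def mono_def\<close>)
  also have "\<dots> = f y * (y - x)" by (simp only: c(2))
  finally show "primitive f y - primitive f x \<le> f y * (y - x)" unfolding eq .
qed

text \<open>Since \<open>f\<close> may jump, its primitive need not be differentiable;
  \<open>f x\<close> still is a slope of a supporting line of this convex function.\<close>

lemma primitive_subgradient:
  assumes "mono f" shows "f x * (y - x) \<le> primitive f y - primitive f x"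
proof (cases "x \<le> y")
  case False
  then have "primitive f x - primitive f y \<le> f x * (x - y)" using primitive_diff(2)[OF assms, of y x] by simp
  then show ?thesis by (simp add: algebra_simps)
qed (rule primitive_diff(1)[OF assms])

lemma primitive_measurable:
  assumes "mono f" shows "primitive f \<in> borel_measurable borel"
proof -
  note [measurable] = borel_measurable_mono[OF assms]
  show ?thesis unfolding primitive_def[abs_def] by measurable
qed

text \<open>The supporting line at \<open>0\<close>, of slope \<open>f 0 = 0\<close>, gives the
  lower bound; the one at \<open>x\<close>, evaluated at \<open>0\<close>, gives the upper. They
  make the primitive integrable along an \<open>L2\<close> signal.\<close>

lemma primitive_bounds:
  assumes f: "mono f" "lin_bounded f"
  shows "0 \<le> primitive f x" "primitive f x \<le> f x * x"
proof -
  have "primitive f 0 = (\<integral>\<xi>. 0 \<partial>(lborel :: real measure))"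
    unfolding primitive_def by (rule Bochner_Integration.integral_cong) auto
  then have "primitive f 0 = 0" by simp
  then show "0 \<le> primitive f x" "primitive f x \<le> f x * x"
    using primitive_subgradient[OF f(1), of 0 x] primitive_subgradient[OF f(1), of x 0] lin_bounded_zero[OF f(2)]
    by simp_all
qed

text \<open>Integrate the subgradient inequality for the convex primitive of \<open>f\<close> along \<open>u\<close>: its right-hand
  side integrates to zero by translation invariance.\<close>

lemma cross_corr_mono_le:
  assumes f: "mono f" "lin_bounded f" and u: "u \<in> L2"
  shows "cross_corr u (\<lambda>t. f (u t)) s \<le> L2_inner u (\<lambda>t. f (u t))"
proof -
  have fu: "(\<lambda>t. f (u t)) \<in> L2" by (rule mono_comp_L2[OF f u])
  note [measurable] = L2_measurable[OF u] primitive_measurable[OF f(1)]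
  have P: "integrable lborel (\<lambda>t. primitive f (u t))"
  proof (rule Bochner_Integration.integrable_bound[OF L2_mult_integrable[OF fu u]])
    show "AE t in lborel. norm (primitive f (u t)) \<le> norm (f (u t) * u t)"
    proof (intro always_eventually allI)
      fix t
      show "norm (primitive f (u t)) \<le> norm (f (u t) * u t)"
        using primitive_bounds[OF f, of "u t"] unfolding real_norm_def by linarith
    qed
  qed measurable
  have Ps: "integrable lborel (\<lambda>t. primitive f (u (t - s)))"
    using lborel_integrable_real_affine[OF P, of 1 "- s"] by simp
  have eq: "(\<integral>t. primitive f (u (t - s)) \<partial>lborel) = (\<integral>t. primitive f (u t) \<partial>lborel)"
    using lborel_integral_real_affine[of 1 "\<lambda>t. primitive f (u (t - s))" s] by simp
  note I = L2_mult_integrable[OF L2_shift(1)[OF u] fu, of s] L2_mult_integrable[OF u fu]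
  have "cross_corr u (\<lambda>t. f (u t)) s - L2_inner u (\<lambda>t. f (u t))
      = (\<integral>t. u (t - s) * f (u t) - u t * f (u t) \<partial>lborel)"
    unfolding cross_corr_def L2_inner_def using I by simp
  also have "\<dots> \<le> (\<integral>t. primitive f (u (t - s)) - primitive f (u t) \<partial>lborel)"
  proof (rule integral_mono)
    show "u (t - s) * f (u t) - u t * f (u t) \<le> primitive f (u (t - s)) - primitive f (u t)" for t
      using primitive_subgradient[OF f(1), of "u t" "u (t - s)"] by (simp add: algebra_simps)
  qed (use I P Ps in simp_all)
  also have "\<dots> = 0" using P Ps eq by simp
  finally show ?thesis by simp
qed

text \<open>The comparison runs through \<open>v = \<bar>u\<bar>\<close>, on which signs no longer
  matter: the negated shifted product is at most \<open>B * (v (t - s) * b (v t))\<close>, the shift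
  inequality for the monotone map \<open>b\<close> removes the shift, and
  \<open>v * b v \<le> u * w\<close> returns to the original pairing.\<close>

lemma cross_corr_quasi_odd_ge:
  assumes b: "mono b" "lin_bounded b" and u: "u \<in> L2" and w: "w \<in> L2" and B: "B \<ge> 0"
    and lo: "AE t in lborel. \<bar>u t\<bar> * b \<bar>u t\<bar> \<le> u t * w t"
    and up: "AE t in lborel. \<bar>w t\<bar> \<le> B * b \<bar>u t\<bar>"
  shows "- (B * L2_inner u w) \<le> cross_corr u w s"
proof -
  define v where "v t = \<bar>u t\<bar>" for t
  have v: "v \<in> L2" unfolding v_def by (rule L2_bound[OF u, of _ 1]) (use L2_measurable[OF u] in auto)
  have bv: "(\<lambda>t. b (v t)) \<in> L2" by (rule mono_comp_L2[OF b v])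
  have us: "(\<lambda>t. u (t - s)) \<in> L2" and vs: "(\<lambda>t. v (t - s)) \<in> L2" using L2_shift(1) u v by blast+
  have "- cross_corr u w s = (\<integral>t. - (u (t - s) * w t) \<partial>lborel)" by (simp add: cross_corr_def L2_inner_def)
  also have "\<dots> \<le> (\<integral>t. B * (v (t - s) * b (v t)) \<partial>lborel)"
  proof (rule integral_mono_AE)
    show "AE t in lborel. - (u (t - s) * w t) \<le> B * (v (t - s) * b (v t))"
      using up
    proof eventually_elim
      case (elim t)
      have "- (u (t - s) * w t) \<le> \<bar>u (t - s)\<bar> * \<bar>w t\<bar>" by (simp add: abs_mult[symmetric])
      also have "\<dots> \<le> \<bar>u (t - s)\<bar> * (B * b \<bar>u t\<bar>)" by (rule mult_left_mono[OF elim]) simp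
      finally show ?case by (simp add: v_def mult_ac)
    qed
  qed (use L2_mult_integrable[OF us w] L2_mult_integrable[OF vs bv] in simp_all)
  also have "\<dots> = B * cross_corr v (\<lambda>t. b (v t)) s" by (simp add: cross_corr_def L2_inner_def)
  also have "\<dots> \<le> B * L2_inner v (\<lambda>t. b (v t))"
    by (rule mult_left_mono[OF cross_corr_mono_le[OF b v] B])
  also have "L2_inner v (\<lambda>t. b (v t)) \<le> L2_inner u w"
    unfolding L2_inner_def
    by (rule integral_mono_AE[OF L2_mult_integrable[OF v bv] L2_mult_integrable[OF u w]])
      (use lo in \<open>simp add: v_def\<close>)
  finally show ?thesis using B by (simp add: mult_left_mono)
qed

text \<open>The chain of slopes from \<open>lo\<close> through \<open>\<phi>\<close> and
  \<open>up\<close> back to \<open>lo\<close> closes up. Slopes are silent where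
  \<open>u t = 0\<close>; there \<open>zero\<close> and \<open>lo 0 = 0\<close> take over.\<close>

lemma nonlinearity_memoryless:
  assumes zero: "\<forall>u\<in>L2e. AE t in lborel. u t = 0 \<longrightarrow> \<phi> u t = 0"
    and bounds: "nonlin_bounded_by \<phi> lo up" and up: "fun_bounded_above_by up lo"
    and lo: "lin_bounded lo" and u: "u \<in> L2e"
  shows "AE t in lborel. \<phi> u t = lo (u t)"
proof -
  have "AE t in lborel. u t \<noteq> 0 \<longrightarrow> lo (u t) / u t \<le> \<phi> u t / u t \<and> \<phi> u t / u t \<le> up (u t) / u t"
    using bounds u by (simp add: nonlin_bounded_by_def)
  moreover have "AE t in lborel. u t = 0 \<longrightarrow> \<phi> u t = 0" using zero u by simp
  ultimately show ?thesis
  proof eventually_elim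
    case (elim t)
    show ?case
    proof (cases "u t = 0")
      case True
      then show ?thesis using elim lin_bounded_zero[OF lo] by simp
    next
      case False
      then have "up (u t) / u t \<le> lo (u t) / u t" using up by (simp add: fun_bounded_above_by_def)
      then have "\<phi> u t / u t = lo (u t) / u t" using elim False by linarith
      then show ?thesis using False by simp
    qed
  qed
qed

text \<open>Oddness makes the slope \<open>lo x / x\<close> even, so \<open>lo \<bar>x\<bar>\<close>
  is \<open>\<bar>x\<bar>\<close> times it. The claims are then
  \<open>lo x / x \<le> y / x \<le> B * (lo x / x)\<close>, multiplied by \<open>x\<^sup>2\<close>
  on the left and by \<open>\<bar>x\<bar>\<close> on the right.\<close>

lemma quasi_odd_pointwise:
  fixes x y :: real
  assumes odd: "odd_fun lo" and lo: "lin_bounded lo" "\<forall>x. x \<noteq> 0 \<longrightarrow> lo x / x \<ge> 0"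
    and zero: "x = 0 \<longrightarrow> y = 0"
    and b: "x \<noteq> 0 \<longrightarrow> lo x / x \<le> y / x \<and> y / x \<le> up x / x"
    and up: "fun_bounded_above_by up (\<lambda>x. B * lo x)"
  shows "\<bar>x\<bar> * lo \<bar>x\<bar> \<le> x * y" "\<bar>y\<bar> \<le> B * lo \<bar>x\<bar>"
proof -
  have "\<bar>x\<bar> * lo \<bar>x\<bar> \<le> x * y \<and> \<bar>y\<bar> \<le> B * lo \<bar>x\<bar>"
  proof (cases "x = 0")
    case True
    then show ?thesis using zero lin_bounded_zero[OF lo(1)] by simp
  next
    case False
    have q: "lo \<bar>x\<bar> = \<bar>x\<bar> * (lo x / x)"
    proof (cases "x > 0")
      case False
      then show ?thesis using odd \<open>x \<noteq> 0\<close> by (simp add: odd_fun_def abs_if)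
    qed simp
    have l: "lo x / x \<le> y / x" "0 \<le> lo x / x" using b lo(2) False by auto
    have u: "y / x \<le> B * (lo x / x)"
      using b up False unfolding fun_bounded_above_by_def by (metis order_trans times_divide_eq_right)
    have y: "y = x * (y / x)" using False by simp
    have "\<bar>x\<bar> * lo \<bar>x\<bar> = x\<^sup>2 * (lo x / x)" unfolding q
      by (simp only: mult.assoc[symmetric] abs_mult_self_eq power2_eq_square)
    also have "\<dots> \<le> x\<^sup>2 * (y / x)" using l(1) by (rule mult_left_mono) simp
    also have "\<dots> = x * y" using False by (simp add: power2_eq_square)
    finally have 1: "\<bar>x\<bar> * lo \<bar>x\<bar> \<le> x * y" .
    have "\<bar>y\<bar> = \<bar>x\<bar> * (y / x)" using l by (subst y) (simp only: abs_mult abs_of_nonneg order_trans)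
    also have "\<dots> \<le> \<bar>x\<bar> * (B * (lo x / x))" using u by (rule mult_left_mono) simp
    also have "\<dots> = B * lo \<bar>x\<bar>" unfolding q by (simp add: mult_ac)
    finally show ?thesis using 1 by simp
  qed
  then show "\<bar>x\<bar> * lo \<bar>x\<bar> \<le> x * y" "\<bar>y\<bar> \<le> B * lo \<bar>x\<bar>" by auto
qed

text \<open>The lower bound \<open>q\<close> is left free in order to cover both finite
  \<open>B\<close>, where it is \<open>B\<close> times the pairing of \<open>u\<close> and
  \<open>w\<close>, and infinite \<open>B\<close>, where \<open>H_norm k = 0\<close> and any
  \<open>q\<close> will do.\<close>

lemma mult_op_inner_nonneg:
  assumes h: "h \<in> Hp_set" "k \<in> Hp_set" and u: "u \<in> L2" and w: "w \<in> L2"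
    and le: "\<And>s. cross_corr u w s \<le> L2_inner u w"
    and ge: "\<And>s. - q \<le> cross_corr u w s"
    and norm: "H_norm k * q \<le> (1 - H_norm h) * L2_inner u w"
  shows "0 \<le> L2_inner (mult_op h k u) w"
proof -
  note C = conv_op_L2(1)[OF h(1) u] conv_op_L2(1)[OF h(2) u]
  have "L2_inner (mult_op h k u) w = L2_inner u w - L2_inner (conv_op h u) w + L2_inner (conv_op k u) w"
    unfolding mult_op_def L2_inner_add_left[OF L2_diff[OF u C(1)] C(2) w] L2_inner_diff_left[OF u C(1) w] ..
  moreover have "L2_inner (conv_op h u) w \<le> H_norm h * L2_inner u w"
    by (rule conv_op_inner_le[OF h(1) u w le])
  moreover have "H_norm k * (- q) \<le> L2_inner (conv_op k u) w"
    by (rule conv_op_inner_ge[OF h(2) u w ge])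
  ultimately show ?thesis using norm by (simp add: algebra_simps)
qed

subsection \<open>Truncation and tails\<close>

definition tail :: "real \<Rightarrow> (real \<Rightarrow> real) \<Rightarrow> real \<Rightarrow> real" where
  "tail T x t = (if t \<le> T then 0 else x t)"

lemma L2_tail: assumes "x \<in> L2" shows "tail T x \<in> L2" "L2_norm (tail T x) \<le> L2_norm x"
proof -
  note [measurable] = L2_measurable[OF assms]
  have m: "tail T x \<in> borel_measurable borel" unfolding tail_def[abs_def] by measurable
  have le: "AE t in lborel. \<bar>tail T x t\<bar> \<le> \<bar>x t\<bar>" by (simp add: tail_def)
  show "tail T x \<in> L2" by (rule L2_bound[OF assms m, of 1]) (use le in simp)
  show "L2_norm (tail T x) \<le> L2_norm x" by (rule L2_norm_mono[OF assms m le])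
qed

text \<open>An error signal that starts after \<open>T\<close> sees only the tail of its partner, so
  a small tail outweighs an error of merely known size.\<close>

lemma L2_inner_tail:
  assumes x: "x \<in> L2" and e: "e \<in> L2" and z: "AE t in lborel. t \<le> T \<longrightarrow> e t = 0"
  shows "\<bar>L2_inner x e\<bar> \<le> L2_norm (tail T x) * L2_norm e"
proof -
  note [measurable] = L2_measurable[OF x] L2_measurable[OF e] L2_measurable[OF L2_tail(1)[OF x]]
  have "L2_inner x e = L2_inner (tail T x) e"
    unfolding L2_inner_def
  proof (rule integral_cong_AE)
    show "AE t in lborel. x t * e t = tail T x t * e t"
      using z by eventually_elim (simp add: tail_def)
  qed measurable
  then show ?thesis using L2_Cauchy_Schwarz[OF L2_tail(1)[OF x] e] by simp
qed

lemma L2_inner_tendsto: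
  assumes x: "x \<in> L2" "\<And>n. X n \<in> L2" "(\<lambda>n. L2_norm (\<lambda>t. x t - X n t)) \<longlonglongrightarrow> 0"
    and y: "y \<in> L2" "\<And>n. Y n \<in> L2" "(\<lambda>n. L2_norm (\<lambda>t. y t - Y n t)) \<longlonglongrightarrow> 0"
  shows "(\<lambda>n. L2_inner (X n) (Y n)) \<longlonglongrightarrow> L2_inner x y"
proof -
  define a b where "a n = L2_norm (\<lambda>t. x t - X n t)" and "b n = L2_norm (\<lambda>t. y t - Y n t)" for n
  have ab: "a \<longlonglongrightarrow> 0" "b \<longlonglongrightarrow> 0" using x(3) y(3) by (simp_all add: a_def[abs_def] b_def[abs_def])
  have le: "\<bar>L2_inner x y - L2_inner (X n) (Y n)\<bar> \<le> a n * L2_norm y + (L2_norm x + a n) * b n" for n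
  proof -
    have dx: "(\<lambda>t. x t - X n t) \<in> L2" and dy: "(\<lambda>t. y t - Y n t) \<in> L2"
      using x y by (auto intro: L2_diff)
    have "L2_inner x y - L2_inner (X n) (Y n)
        = L2_inner (\<lambda>t. x t - X n t) y + L2_inner (X n) (\<lambda>t. y t - Y n t)"
      by (simp add: L2_inner_diff_left x y L2_inner_diff_right)
    moreover have "\<bar>L2_inner (\<lambda>t. x t - X n t) y\<bar> \<le> a n * L2_norm y"
      unfolding a_def by (rule L2_Cauchy_Schwarz[OF dx y(1)])
    moreover have "\<bar>L2_inner (X n) (\<lambda>t. y t - Y n t)\<bar> \<le> L2_norm (X n) * b n"
      unfolding b_def by (rule L2_Cauchy_Schwarz[OF x(2) dy])
    moreover have "L2_norm (X n) * b n \<le> (L2_norm x + a n) * b n"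
      using L2_norm_triangle_diff[OF x(1) dx] by (intro mult_right_mono) (simp_all add: a_def b_def)
    ultimately show ?thesis by linarith
  qed
  have "(\<lambda>n. a n * L2_norm y + (L2_norm x + a n) * b n) \<longlonglongrightarrow> 0 * L2_norm y + (L2_norm x + 0) * 0"
    by (intro tendsto_intros ab)
  then have lim: "(\<lambda>n. a n * L2_norm y + (L2_norm x + a n) * b n) \<longlonglongrightarrow> 0" by simp
  have "(\<lambda>n. L2_inner x y - L2_inner (X n) (Y n)) \<longlonglongrightarrow> 0"
    by (rule Lim_null_comparison[OF _ lim]) (use le in simp)
  then show ?thesis by (rule Lim_transform2[OF tendsto_const])
qed

text \<open>The truncated energies increase and stay below \<open>R\<^sup>2\<close>; monotone
  convergence concludes.\<close>

lemma L2_of_bounded_truncations: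
  assumes x: "x \<in> L2e" and R: "\<And>T. L2_norm (trunc T x) \<le> R"
  shows "x \<in> L2"
proof -
  define I where "I n = (\<integral>t. (trunc (real n) x t)\<^sup>2 \<partial>lborel)" for n :: nat
  have int: "integrable lborel (\<lambda>t. (trunc (real n) x t)\<^sup>2)" for n
    by (rule L2_square_integrable[OF L2e_trunc[OF x]])
  have "incseq I" unfolding I_def
    by (intro incseq_SucI integral_mono int) (simp add: trunc_def)
  moreover have "I n \<le> R\<^sup>2" for n
    using power_mono[OF R[of "real n"], of 2] by (simp add: I_def L2_norm_def)
  ultimately obtain L where L: "I \<longlonglongrightarrow> L" using incseq_convergent[of I "R\<^sup>2"] by blast
  have "integrable lborel (\<lambda>t. (x t)\<^sup>2)"
  proof (rule integrable_monotone_convergence[OF int])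
    show "AE t in lborel. mono (\<lambda>n. (trunc (real n) x t)\<^sup>2)"
      by (intro always_eventually allI monoI) (simp add: trunc_def)
    show "AE t in lborel. (\<lambda>n. (trunc (real n) x t)\<^sup>2) \<longlonglongrightarrow> (x t)\<^sup>2"
    proof (intro always_eventually allI, rule tendsto_eventually)
      fix t
      obtain m where "t \<le> real m" using real_arch_simple by blast
      then show "\<forall>\<^sub>F n in sequentially. (trunc (real n) x t)\<^sup>2 = (x t)\<^sup>2"
        by (intro eventually_sequentiallyI[of m]) (simp add: trunc_def)
    qed
    show "(\<lambda>n. \<integral>t. (trunc (real n) x t)\<^sup>2 \<partial>lborel) \<longlonglongrightarrow> L" using L by (simp add: I_def[abs_def])
    show "(\<lambda>t. (x t)\<^sup>2) \<in> borel_measurable lborel" using L2e_measurable[OF x] by simp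
  qed
  then show ?thesis using L2e_measurable[OF x] by (simp add: L2_def)
qed

text \<open>A truncation can be continued beyond \<open>T\<close> so that its image under \<open>M\<close> almost vanishes there.
  The continuation solves a fixed-point equation whose contraction constant is \<open>\<rho>\<close>; the
  Picard iterates suffice, so completeness of \<open>L2\<close> is not needed.\<close>

lemma tail_correction:
  assumes M: "\<And>x. x \<in> L2 \<Longrightarrow> M x \<in> L2"
    and norm: "\<And>x. x \<in> L2 \<Longrightarrow> L2_norm (\<lambda>t. x t - M x t) \<le> \<rho> * L2_norm x"
    and diff: "\<And>x y. x \<in> L2 \<Longrightarrow> y \<in> L2 \<Longrightarrow> AE t in lborel. M (\<lambda>t. x t - y t) t = M x t - M y t"
    and \<rho>: "0 \<le> \<rho>" "\<rho> < 1" and u: "u \<in> L2" and \<delta>: "\<delta> > 0"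
  obtains v where "v \<in> L2" "trunc T v = trunc T u" "L2_norm (tail T (M v)) \<le> \<delta>"
    "L2_norm v \<le> L2_norm u / (1 - \<rho>)"
proof -
  \<comment> \<open>A fixed point of \<open>S\<close> would agree with \<open>u\<close> up to
    \<open>T\<close> and have an image under \<open>M\<close> that vanishes afterwards.\<close>
  define S where "S x = (\<lambda>t. trunc T u t + tail T (\<lambda>t. x t - M x t) t)" for x
  define V where "V n = (S ^^ n) (trunc T u)" for n
  have V0: "V 0 = trunc T u" and VS: "V (Suc n) = S (V n)" for n by (simp_all add: V_def)
  have R: "(\<lambda>t. x t - M x t) \<in> L2" if "x \<in> L2" for x using M that by (intro L2_diff)
  have V: "V n \<in> L2" for n
  proof (induction n)
    case 0
    show ?case unfolding V0 by (rule L2_trunc(1)[OF u])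
  next
    case (Suc n)
    show ?case unfolding VS S_def by (intro L2_add L2_trunc L2_tail R Suc u)
  qed
  have trunc_S: "trunc T (S x) = trunc T u" for x by (auto simp: S_def trunc_def tail_def)
  have trunc_V: "trunc T (V n) = trunc T u" for n
    by (cases n) (auto simp: V0 VS trunc_S, auto simp: trunc_def)
  \<comment> \<open>\<open>L2_norm u / (1 - \<rho>)\<close> is the fixed point of
    \<open>a \<mapsto> L2_norm u + \<rho> * a\<close>, hence preserved by the induction
    step.\<close>
  have bound: "L2_norm (V n) \<le> L2_norm u / (1 - \<rho>)" for n
  proof (induction n)
    case 0
    have "L2_norm (V 0) \<le> L2_norm u" unfolding V0 by (rule L2_trunc(2)[OF u])
    also have "L2_norm u * (1 - \<rho>) \<le> L2_norm u * 1" using \<rho> by (intro mult_left_mono) simp_all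
    then have "L2_norm u \<le> L2_norm u / (1 - \<rho>)" using \<rho> by (simp add: pos_le_divide_eq)
    finally show ?case .
  next
    case (Suc n)
    have "L2_norm (V (Suc n)) \<le> L2_norm (trunc T u) + L2_norm (tail T (\<lambda>t. V n t - M (V n) t))"
      unfolding VS S_def by (intro L2_norm_triangle L2_trunc L2_tail R V u)
    also have "\<dots> \<le> L2_norm u + \<rho> * L2_norm (V n)"
      by (intro add_mono L2_trunc u order_trans[OF L2_tail(2) norm] R V)
    also have "\<dots> \<le> L2_norm u + \<rho> * (L2_norm u / (1 - \<rho>))"
      using Suc \<rho> by (intro add_left_mono mult_left_mono) simp_all
    also have "\<dots> = L2_norm u / (1 - \<rho>)" using \<rho> by (simp add: field_simps)
    finally show ?case .
  qed
  \<comment> \<open>The tail to be made small is exactly the increment of the iteration, which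
    decays geometrically.\<close>
  have tail_eq: "tail T (M (V n)) = (\<lambda>t. V n t - V (Suc n) t)" for n
  proof
    fix t
    show "tail T (M (V n)) t = V n t - V (Suc n) t"
      using fun_cong[OF trunc_V[of n], of t] fun_cong[OF trunc_V[of "Suc n"], of t]
      by (cases "t \<le> T") (simp_all add: VS S_def tail_def trunc_def)
  qed
  have geom: "L2_norm (\<lambda>t. V n t - V (Suc n) t) \<le> \<rho> ^ n * L2_norm (\<lambda>t. V 0 t - V (Suc 0) t)" for n
  proof (induction n)
    case (Suc n)
    let ?d = "\<lambda>t. V n t - V (Suc n) t"
    have d: "?d \<in> L2" by (intro L2_diff V)
    have L: "(\<lambda>t. V (Suc n) t - V (Suc (Suc n)) t) \<in> L2" by (intro L2_diff V)
    have "AE t in lborel. V (Suc n) t - V (Suc (Suc n)) t = tail T (\<lambda>t. ?d t - M ?d t) t"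
      using diff[OF V[of n] V[of "Suc n"]]
      by eventually_elim (simp add: VS[of n] VS[of "Suc n"] S_def tail_def)
    then have "L2_norm (\<lambda>t. V (Suc n) t - V (Suc (Suc n)) t) = L2_norm (tail T (\<lambda>t. ?d t - M ?d t))"
      by (intro L2_norm_cong L2_measurable[OF L] L2_measurable[OF L2_tail(1)] R d)
    also have "\<dots> \<le> \<rho> * L2_norm ?d" by (intro order_trans[OF L2_tail(2) norm] R d)
    also have "\<dots> \<le> \<rho> * (\<rho> ^ n * L2_norm (\<lambda>t. V 0 t - V (Suc 0) t))"
      by (rule mult_left_mono[OF Suc \<rho>(1)])
    finally show ?case by simp
  qed simp
  have "(\<lambda>n. \<rho> ^ n * L2_norm (\<lambda>t. V 0 t - V (Suc 0) t)) \<longlonglongrightarrow> 0"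
    using tendsto_mult_right[OF LIMSEQ_power_zero[of \<rho>]] \<rho> by simp
  then have "\<forall>\<^sub>F n in sequentially. \<rho> ^ n * L2_norm (\<lambda>t. V 0 t - V (Suc 0) t) < \<delta>"
    using \<delta> by (rule order_tendstoD)
  then obtain n where n: "\<rho> ^ n * L2_norm (\<lambda>t. V 0 t - V (Suc 0) t) < \<delta>"
    using eventually_happens' sequentially_bot by blast
  show ?thesis
    by (rule that[of "V n"]) (use V trunc_V bound geom[of n] n in \<open>simp_all add: tail_eq\<close>)
qed

subsection \<open>The stability argument\<close>

text \<open>Cutoffs of \<open>z\<close> are integrable and converge to \<open>z\<close>; boundedness
  of \<open>G\<close> and of the adjoint multiplier carries the inequality to the limit.\<close>

lemma freq_positive_L2:
  assumes G: "linear_op G" "is_freq_response G Gj"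
    and bound: "\<And>x. x \<in> L2 \<Longrightarrow> G x \<in> L2" "\<And>x. x \<in> L2 \<Longrightarrow> L2_norm (G x) \<le> c * L2_norm x"
    and h: "h \<in> Hp_set" "k \<in> Hp_set"
    and pos: "\<And>\<omega>. Re (mult_freq h k \<omega> * Gj \<omega>) \<ge> \<epsilon>"
    and z: "z \<in> L2"
  shows "\<epsilon> * (L2_norm z)\<^sup>2 \<le> L2_inner (G z) (mult_op (reflect h) (reflect k) z)"
proof -
  let ?N = "mult_op (reflect h) (reflect k)"
  define Z where "Z n = cutoff (real n) z" for n :: nat
  note R = reflect_Hp_set(1)[OF h(1)] reflect_Hp_set(1)[OF h(2)]
  have Z: "Z n \<in> L2" "integrable lborel (Z n)" for n
    using z by (simp_all add: Z_def cutoff_L2 cutoff_integrable)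
  have d: "(\<lambda>t. z t - Z n t) \<in> L2" for n by (intro L2_diff z Z)
  have Z_lim: "(\<lambda>n. L2_norm (\<lambda>t. z t - Z n t)) \<longlonglongrightarrow> 0"
    unfolding Z_def by (rule cutoff_tendsto[OF z filterlim_real_sequentially])
  have "L2_norm (\<lambda>t. G z t - G (Z n) t) \<le> c * L2_norm (\<lambda>t. z t - Z n t)" for n
  proof -
    have "AE t in lborel. G (\<lambda>s. 1 * z s + (-1) * Z n s) t = 1 * G z t + (-1) * G (Z n) t"
      using G(1) z Z(1)[of n] L2_subset_L2e unfolding linear_op_def by blast
    then have "L2_norm (\<lambda>t. G z t - G (Z n) t) = L2_norm (G (\<lambda>t. z t - Z n t))"
      by (intro L2_norm_cong L2_measurable L2_diff bound z Z d) (auto elim: eventually_mono)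
    then show ?thesis using bound(2)[OF d[of n]] by simp
  qed
  then have G_lim: "(\<lambda>n. L2_norm (\<lambda>t. G z t - G (Z n) t)) \<longlonglongrightarrow> 0"
    by (intro Lim_null_comparison[OF _ tendsto_mult_right_zero[OF Z_lim, of c]]) simp
  let ?r = "1 + (H_norm (reflect h) + H_norm (reflect k))"
  have "L2_norm (\<lambda>t. ?N z t - ?N (Z n) t) \<le> ?r * L2_norm (\<lambda>t. z t - Z n t)" for n
  proof -
    let ?d = "\<lambda>t. z t - Z n t"
    have "L2_norm (\<lambda>t. ?N z t - ?N (Z n) t) = L2_norm (?N ?d)"
      using mult_op_diff[OF R z Z(1)[of n]]
      by (intro L2_norm_cong L2_measurable L2_diff mult_op_L2 R z Z d) (auto elim: eventually_mono)
    also have "?N ?d = (\<lambda>t. ?d t - (?d t - ?N ?d t))" by simp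
    also have "L2_norm \<dots> \<le> L2_norm ?d + L2_norm (\<lambda>t. ?d t - ?N ?d t)"
      by (rule L2_norm_triangle_diff[OF d L2_diff[OF d mult_op_L2[OF R d]]])
    also have "\<dots> \<le> ?r * L2_norm ?d" using mult_op_norm[OF R d[of n]] by (simp add: algebra_simps)
    finally show ?thesis .
  qed
  then have N_lim: "(\<lambda>n. L2_norm (\<lambda>t. ?N z t - ?N (Z n) t)) \<longlonglongrightarrow> 0"
    by (intro Lim_null_comparison[OF _ tendsto_mult_right_zero[OF Z_lim, of ?r]]) simp
  have rhs: "(\<lambda>n. L2_inner (G (Z n)) (?N (Z n))) \<longlonglongrightarrow> L2_inner (G z) (?N z)"
    by (rule L2_inner_tendsto[OF bound(1)[OF z] bound(1)[OF Z(1)] G_lim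
          mult_op_L2[OF R z] mult_op_L2[OF R Z(1)] N_lim])
  have lhs: "(\<lambda>n. \<epsilon> * L2_inner (Z n) (Z n)) \<longlonglongrightarrow> \<epsilon> * L2_inner z z"
    by (intro tendsto_mult_left L2_inner_tendsto z Z Z_lim)
  have "\<epsilon> * L2_inner (Z n) (Z n) \<le> L2_inner (G (Z n)) (?N (Z n))" for n
    unfolding L2_norm_power2[symmetric]
    by (rule freq_response_positive[where Mj = "mult_freq h k", OF G(2) bound(1)[OF Z(1)] Z mult_op_L2[OF R Z(1)]
          mult_op_fourier(1)[OF R Z]])
      (use mult_op_fourier(2)[OF R Z] pos in \<open>simp_all add: mult_freq_reflect[OF h]\<close>)
  then have "\<epsilon> * L2_inner z z \<le> L2_inner (G z) (?N z)"
    by (intro LIMSEQ_le[OF lhs rhs]) simp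
  then show ?thesis by (simp add: L2_norm_power2)
qed

text \<open>The assumption \<open>loop\<close> is quantified over all continuations \<open>z\<close>
  of \<open>w\<close>, because the right one is constructed only inside the proof. The resulting
  bound is independent of \<open>T\<close>.\<close>

lemma truncated_output_bound:
  assumes h: "h \<in> Hp_set" "k \<in> Hp_set" and \<rho>: "H_norm h + H_norm k < 1"
    and \<phi>: "\<And>v. v \<in> L2 \<Longrightarrow> \<phi> v \<in> L2" "\<And>v. v \<in> L2 \<Longrightarrow> L2_norm (\<phi> v) \<le> C * L2_norm v"
      "\<And>v. v \<in> L2 \<Longrightarrow> 0 \<le> L2_inner (mult_op h k v) (\<phi> v)"
      "\<And>v. v \<in> L2e \<Longrightarrow> AE t in lborel. \<phi> v t = \<alpha> (v t)"
    and G: "\<And>x. x \<in> L2 \<Longrightarrow> G x \<in> L2" "\<And>x. x \<in> L2 \<Longrightarrow> L2_norm (G x) \<le> c * L2_norm x"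
    and pos: "\<And>z. z \<in> L2 \<Longrightarrow> \<epsilon> * (L2_norm z)\<^sup>2 \<le> L2_inner (G z) (mult_op (reflect h) (reflect k) z)"
    and cC: "c \<ge> 0" "C \<ge> 0" and \<epsilon>: "\<epsilon> > 0"
    and u: "u \<in> L2e" and w: "w \<in> L2e" and f: "f \<in> L2" and wu: "AE t in lborel. w t = \<alpha> (u t)"
    and loop: "\<And>z. z \<in> L2 \<Longrightarrow> AE t in lborel. t \<le> T \<longrightarrow> z t = w t \<Longrightarrow>
      AE t in lborel. t \<le> T \<longrightarrow> u t = f t - G z t"
  shows "L2_norm (trunc T w) \<le> 2 * L2_norm f / \<epsilon> + 1"
proof -
  let ?M = "mult_op h k" and ?N = "mult_op (reflect h) (reflect k)"
  note R = reflect_Hp_set(1)[OF h(1)] reflect_Hp_set(1)[OF h(2)]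
  define r where "r = H_norm h + H_norm k"
  have r: "0 \<le> r" "r < 1" using \<rho> H_norm_nonneg h by (auto simp: r_def)
  have Mn: "L2_norm (\<lambda>t. x t - ?M x t) \<le> r * L2_norm x"
    and Nn: "L2_norm (\<lambda>t. x t - ?N x t) \<le> r * L2_norm x" if "x \<in> L2" for x
    using mult_op_norm[OF h that] mult_op_norm[OF R that] reflect_Hp_set(2) h by (simp_all add: r_def)
  define A A' where "A = L2_norm (trunc T u) / (1 - r)" and "A' = L2_norm (trunc T w) / (1 - r)"
  \<comment> \<open>The sum of bounds on the norms of the two discrepancies,
    \<open>\<phi> v - z\<close> and \<open>v - (f - G z)\<close>. It depends on \<open>T\<close>,
    but \<open>\<delta>\<close> is chosen after it.\<close>
  define K where "K = C * A + A' + (A + (L2_norm f + c * A'))"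
  have AA: "A \<ge> 0" "A' \<ge> 0" using r by (simp_all add: A_def A'_def)
  have K: "K \<ge> 0" using AA cC by (simp add: K_def)
  define \<delta> where "\<delta> = \<epsilon> / (K + 1)"
  have \<delta>: "\<delta> > 0" "\<delta> * K \<le> \<epsilon>" using K \<epsilon> by (simp_all add: \<delta>_def field_simps)
  obtain v where v: "v \<in> L2" "trunc T v = trunc T (trunc T u)" "L2_norm (tail T (?M v)) \<le> \<delta>" "L2_norm v \<le> A"
    using tail_correction[OF mult_op_L2[OF h] Mn mult_op_diff[OF h] r L2e_trunc[OF u] \<delta>(1), of T]
    unfolding A_def by metis
  obtain z where z: "z \<in> L2" "trunc T z = trunc T (trunc T w)" "L2_norm (tail T (?N z)) \<le> \<delta>" "L2_norm z \<le> A'"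
    using tail_correction[OF mult_op_L2[OF R] Nn mult_op_diff[OF R] r L2e_trunc[OF w] \<delta>(1), of T]
    unfolding A'_def by metis
  have vt: "v t = u t" and zt: "z t = w t" if "t \<le> T" for t
    using fun_cong[OF v(2), of t] fun_cong[OF z(2), of t] that by (simp_all add: trunc_def)
  define y where "y = \<phi> v"
  have y: "y \<in> L2" "L2_norm y \<le> C * A"
    using \<phi>(1,2)[OF v(1)] mult_left_mono[OF v(4) cC(2)] by (simp_all add: y_def)
  have yz: "AE t in lborel. t \<le> T \<longrightarrow> y t - z t = 0"
    using \<phi>(4)[OF L2_subset_L2e[OF v(1)]] wu by eventually_elim (simp add: y_def vt zt)
  define g where "g t = f t - G z t" for t
  have g: "g \<in> L2" unfolding g_def[abs_def] by (intro L2_diff f G z)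
  have gn: "L2_norm g \<le> L2_norm f + c * A'"
    using L2_norm_triangle_diff[OF f G(1)[OF z(1)]] G(2)[OF z(1)] mult_left_mono[OF z(4) cC(1)]
    by (simp add: g_def[abs_def])
  have vg: "AE t in lborel. t \<le> T \<longrightarrow> v t - g t = 0"
  proof -
    have "AE t in lborel. t \<le> T \<longrightarrow> u t = f t - G z t" by (rule loop[OF z(1)]) (simp add: zt)
    then show ?thesis by eventually_elim (simp add: g_def vt)
  qed
  have Mv: "?M v \<in> L2" and Nz: "?N z \<in> L2" by (intro mult_op_L2 h R v z)+
  have "\<bar>L2_inner (?M v) (\<lambda>t. y t - z t)\<bar> \<le> L2_norm (tail T (?M v)) * L2_norm (\<lambda>t. y t - z t)"
    by (rule L2_inner_tail[OF Mv L2_diff[OF y(1) z(1)] yz])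
  also have "\<dots> \<le> \<delta> * (C * A + A')"
    by (rule mult_mono[OF v(3) order_trans[OF L2_norm_triangle_diff[OF y(1) z(1)] add_mono[OF y(2) z(4)]]])
      (use \<delta> in simp_all)
  finally have e1: "\<bar>L2_inner (?M v) (\<lambda>t. y t - z t)\<bar> \<le> \<delta> * (C * A + A')" .
  have "\<bar>L2_inner (?N z) (\<lambda>t. v t - g t)\<bar> \<le> L2_norm (tail T (?N z)) * L2_norm (\<lambda>t. v t - g t)"
    by (rule L2_inner_tail[OF Nz L2_diff[OF v(1) g] vg])
  also have "\<dots> \<le> \<delta> * (A + (L2_norm f + c * A'))"
    by (rule mult_mono[OF z(3) order_trans[OF L2_norm_triangle_diff[OF v(1) g] add_mono[OF v(4) gn]]])
      (use \<delta> in simp_all)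
  finally have e2: "\<bar>L2_inner (?N z) (\<lambda>t. v t - g t)\<bar> \<le> \<delta> * (A + (L2_norm f + c * A'))" .
  \<comment> \<open>Since \<open>?N\<close> differs from the identity by a contraction, its norm is
    at most \<open>1 + r \<le> 2\<close>; this is the \<open>2\<close> in the final bound.\<close>
  have "L2_norm (?N z) = L2_norm (\<lambda>t. z t - (z t - ?N z t))" by simp
  also have "\<dots> \<le> L2_norm z + r * L2_norm z"
    using L2_norm_triangle_diff[OF z(1) L2_diff[OF z(1) Nz]] Nn[OF z(1)] by linarith
  also have "\<dots> \<le> 2 * L2_norm z" using r mult_right_mono[of r 1 "L2_norm z"] by simp
  finally have "L2_norm f * L2_norm (?N z) \<le> L2_norm f * (2 * L2_norm z)" by (rule mult_left_mono) simp
  then have fN: "L2_inner f (?N z) \<le> 2 * L2_norm f * L2_norm z"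
    using L2_Cauchy_Schwarz[OF f Nz] by (simp add: mult_ac)
  \<comment> \<open>Positivity is now moved over to \<open>z\<close>: replacing \<open>y\<close> by
    \<open>z\<close> costs \<open>e1\<close>, and after passing to the adjoint, replacing
    \<open>v\<close> by \<open>g\<close> costs \<open>e2\<close>.\<close>
  have "0 \<le> L2_inner (?M v) y" using \<phi>(3)[OF v(1)] by (simp add: y_def)
  also have "\<dots> = L2_inner (?M v) z + L2_inner (?M v) (\<lambda>t. y t - z t)"
    by (simp add: L2_inner_diff_right[OF y(1) z(1) Mv])
  also have "L2_inner (?M v) z = L2_inner v (?N z)" by (rule mult_op_adjoint[OF h v(1) z(1)])
  also have "\<dots> = L2_inner g (?N z) + L2_inner (?N z) (\<lambda>t. v t - g t)"
    unfolding L2_inner_diff_right[OF v(1) g Nz] by (simp add: L2_inner_commute[of "?N z"])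
  also have "L2_inner g (?N z) = L2_inner f (?N z) - L2_inner (G z) (?N z)"
    unfolding g_def[abs_def] by (rule L2_inner_diff_left[OF f G(1)[OF z(1)] Nz])
  finally have "0 \<le> 2 * L2_norm f * L2_norm z - \<epsilon> * (L2_norm z)\<^sup>2 + \<delta> * (A + (L2_norm f + c * A')) + \<delta> * (C * A + A')"
    using fN pos[OF z(1)] e1 e2 by linarith
  then have main: "\<epsilon> * (L2_norm z)\<^sup>2 \<le> 2 * L2_norm f * L2_norm z + \<epsilon>"
    using \<delta>(2) by (simp add: K_def algebra_simps)
  \<comment> \<open>Otherwise \<open>L2_norm z\<close> exceeds \<open>1\<close>, and multiplying the
    negated bound by \<open>\<epsilon> * L2_norm z\<close> makes the quadratic term larger than
    \<open>main\<close> allows.\<close>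
  have "L2_norm z \<le> 2 * L2_norm f / \<epsilon> + 1"
  proof (rule ccontr)
    assume "\<not> ?thesis"
    then have gt: "L2_norm z > 2 * L2_norm f / \<epsilon> + 1" by simp
    have "0 \<le> 2 * L2_norm f / \<epsilon>" using \<epsilon> by simp
    then have z1: "L2_norm z > 1" using gt by linarith
    have "\<epsilon> * (2 * L2_norm f / \<epsilon> + 1) < \<epsilon> * L2_norm z" using gt \<epsilon> by (rule mult_strict_left_mono)
    moreover have "\<epsilon> * (2 * L2_norm f / \<epsilon> + 1) = 2 * L2_norm f + \<epsilon>" using \<epsilon> by (simp add: distrib_left)
    ultimately have "2 * L2_norm f + \<epsilon> < \<epsilon> * L2_norm z" by simp
    then have "(2 * L2_norm f + \<epsilon>) * L2_norm z < \<epsilon> * L2_norm z * L2_norm z"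
      using z1 by (intro mult_strict_right_mono) simp_all
    moreover have "\<epsilon> * 1 < \<epsilon> * L2_norm z" using z1 \<epsilon> by (rule mult_strict_left_mono)
    ultimately show False using main by (simp add: power2_eq_square algebra_simps)
  qed
  moreover have "trunc T z = trunc T w" using z(2) by (auto simp: trunc_def fun_eq_iff)
  ultimately show ?thesis using L2_trunc(2)[OF z(1), of T] by simp
qed

text \<open>Up to \<open>T\<close> the input \<open>u1\<close> coincides with \<open>r1 - z\<close>,
  so by causality \<open>G\<close> responds equally to both there; linearity splits the
  response.\<close>

lemma feedback_loop_truncated:
  assumes G: "L2e_operator G" "linear_op G" "causal G"
    and sol: "lurye_solution G \<phi> r1 r2 u1 u2 y1 y2" and r: "r1 \<in> L2" "r2 \<in> L2"
    and z: "z \<in> L2" "AE t in lborel. t \<le> T \<longrightarrow> z t = y2 t"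
  shows "AE t in lborel. t \<le> T \<longrightarrow> u2 t = (G r1 t + r2 t) - G z t"
proof -
  have S: "u1 \<in> L2e" "AE t in lborel. y1 t = G u1 t" "AE t in lborel. u1 t = r1 t - y2 t"
    "AE t in lborel. u2 t = y1 t + r2 t"
    using sol by (auto simp: lurye_solution_def)
  let ?x = "\<lambda>t. 1 * r1 t + (-1) * z t"
  have x: "?x \<in> L2e" using L2_diff[OF r(1) z(1)] by (intro L2_subset_L2e) simp
  have "AE t in lborel. trunc T u1 t = trunc T ?x t"
    using S(3) z(2) by eventually_elim (simp add: trunc_def)
  then have "AE t in lborel. G (trunc T u1) t = G (trunc T ?x) t"
    using G(1) L2_subset_L2e[OF L2e_trunc[OF S(1), of T]] L2_subset_L2e[OF L2e_trunc[OF x, of T]]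
    unfolding L2e_operator_def by blast
  moreover have "AE t in lborel. trunc T (G u1) t = trunc T (G (trunc T u1)) t"
    "AE t in lborel. trunc T (G ?x) t = trunc T (G (trunc T ?x)) t"
    using G(3) S(1) x unfolding causal_def by blast+
  moreover have "AE t in lborel. G ?x t = 1 * G r1 t + (-1) * G z t"
    using G(2) L2_subset_L2e[OF r(1)] L2_subset_L2e[OF z(1)] unfolding linear_op_def by blast
  ultimately show ?thesis
    using S(2,4) by eventually_elim (auto simp: trunc_def)
qed

theorem corollary1:
  fixes G \<phi> :: operator
    and \<alpha>_lo \<alpha>_up \<beta>_lo \<beta>_up :: "real \<Rightarrow> real"
    and B :: ereal
    and h_plus h_minus :: impulse_response
  assumes G: "L2e_operator G" "linear_op G" "time_invariant G" "causal G" "stable_op G"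
    and phi: "L2e_operator \<phi>"
    and well_posed: "lurye_well_posed G \<phi>"
    and zero: "\<forall>u\<in>L2e. AE t in lborel. u t = 0 \<longrightarrow> \<phi> u t = 0"
    and alpha_bounds: "nonlin_bounded_by \<phi> \<alpha>_lo \<alpha>_up"
    and alpha_lo: "mono \<alpha>_lo" "lin_bounded \<alpha>_lo" "\<forall>x. x \<noteq> 0 \<longrightarrow> \<alpha>_lo x / x \<ge> 0"
    and alpha_up: "mono \<alpha>_up" "lin_bounded \<alpha>_up"
    and beta_bounds: "nonlin_bounded_by \<phi> \<beta>_lo \<beta>_up"
    and beta_lo: "mono \<beta>_lo" "lin_bounded \<beta>_lo" "odd_fun \<beta>_lo" "\<forall>x. x \<noteq> 0 \<longrightarrow> \<beta>_lo x / x \<ge> 0"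
    and beta_up: "mono \<beta>_up" "lin_bounded \<beta>_up" "odd_fun \<beta>_up"
    and alpha: "fun_bounded_above_by \<alpha>_up \<alpha>_lo"
    and B: "B \<ge> 1"
    and beta: "B \<noteq> \<infinity> \<longrightarrow> fun_bounded_above_by \<beta>_up (\<lambda>x. real_of_ereal B * \<beta>_lo x)"
    and h: "h_plus \<in> Hp_set" "h_minus \<in> Hp_set"
    and norm: "ereal (H_norm h_plus) + B * ereal (H_norm h_minus) < 1"
  shows "(\<forall>u\<in>L2. integrable lborel (\<lambda>t. mult_op h_plus h_minus u t * \<phi> u t) \<and>
                  (\<integral>t. mult_op h_plus h_minus u t * \<phi> u t \<partial>lborel) \<ge> 0) \<and>
         (\<forall>Gj. is_freq_response G Gj \<longrightarrow>
            (\<exists>\<epsilon>>0. \<forall>\<omega>. Re (mult_freq h_plus h_minus \<omega> * Gj \<omega>) \<ge> \<epsilon>) \<longrightarrow>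
            lurye_stable G \<phi>)"
proof -
  note memless = nonlinearity_memoryless[OF zero alpha_bounds alpha alpha_lo(2)]
  obtain C where C: "C \<ge> 0" "\<And>x. \<bar>\<alpha>_lo x\<bar> \<le> C * \<bar>x\<bar>" using alpha_lo(2) by (auto simp: lin_bounded_def)
  have phi_meas: "\<phi> u \<in> borel_measurable borel" if "u \<in> L2" for u
    using phi L2_subset_L2e[OF that] by (intro L2e_measurable) (simp add: L2e_operator_def)
  have phi_le: "AE t in lborel. \<bar>\<phi> u t\<bar> \<le> C * \<bar>u t\<bar>" if "u \<in> L2" for u
    using memless[OF L2_subset_L2e[OF that]] by eventually_elim (simp add: C)
  have phi_L2: "\<phi> u \<in> L2" if "u \<in> L2" for u
    by (rule L2_bound[OF that phi_meas[OF that] phi_le[OF that]])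
  have phi_norm: "L2_norm (\<phi> u) \<le> C * L2_norm u" if "u \<in> L2" for u
  proof -
    have "L2_norm (\<phi> u) \<le> L2_norm (\<lambda>t. C * u t)"
      by (rule L2_norm_mono[OF L2_scale[OF that] phi_meas[OF that]])
        (use phi_le[OF that] C(1) in \<open>simp add: abs_mult\<close>)
    then show ?thesis using C(1) by (simp add: L2_norm_scale)
  qed
  note H0 = H_norm_nonneg[OF h(1)] H_norm_nonneg[OF h(2)]
  \<comment> \<open>As \<open>B \<ge> 1\<close>, the weighted bound implies the unweighted one,
    which is the contraction condition for the stability part.\<close>
  have norm_real: "H_norm h_plus + H_norm h_minus < 1"
  proof -
    have "ereal (H_norm h_minus) \<le> B * ereal (H_norm h_minus)"
      using ereal_mult_right_mono[OF B, of "ereal (H_norm h_minus)"] H0 by simp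
    then have "ereal (H_norm h_plus) + ereal (H_norm h_minus) < 1"
      using norm by (meson add_left_mono le_less_trans)
    then show ?thesis by simp
  qed
  have positive: "0 \<le> L2_inner (mult_op h_plus h_minus u) (\<phi> u)" if u: "u \<in> L2" for u
  proof -
    define p where "p = L2_inner u (\<phi> u)"
    have a: "(\<lambda>t. \<alpha>_lo (u t)) \<in> L2" by (rule mono_comp_L2[OF alpha_lo(1,2) u])
    have phi_a: "AE t in lborel. \<phi> u t = \<alpha>_lo (u t)" by (rule memless[OF L2_subset_L2e[OF u]])
    have cross: "cross_corr u (\<phi> u) s = cross_corr u (\<lambda>t. \<alpha>_lo (u t)) s" for s
      unfolding cross_corr_def
      by (intro L2_inner_cong L2_measurable L2_shift u phi_L2 a phi_a) simp
    have p: "p = L2_inner u (\<lambda>t. \<alpha>_lo (u t))"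
      unfolding p_def by (intro L2_inner_cong L2_measurable u phi_L2 a phi_a) simp
    have le: "cross_corr u (\<phi> u) s \<le> p" for s
      unfolding cross p by (rule cross_corr_mono_le[OF alpha_lo(1,2) u])
    have p0: "0 \<le> p"
      unfolding p L2_inner_def
    proof (rule Bochner_Integration.integral_nonneg)
      fix t
      show "0 \<le> u t * \<alpha>_lo (u t)"
        using alpha_lo(3)[rule_format, of "u t"] by (cases "u t = 0") (auto simp: zero_le_divide_iff zero_le_mult_iff)
    qed
    show ?thesis
    proof (cases "B = \<infinity>")
      case True
      \<comment> \<open>An infinite \<open>B\<close> times a positive norm would make the left side
        of \<open>norm\<close> infinite.\<close>
      have "H_norm h_minus = 0"
      proof (rule ccontr)
        assume "H_norm h_minus \<noteq> 0"
        then have inf: "B * ereal (H_norm h_minus) = \<infinity>" using True H0 by simp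
        show False using norm unfolding inf by simp
      qed
      \<comment> \<open>Any finite lower bound serves, as it gets multiplied by
        \<open>H_norm h_minus = 0\<close>; Cauchy-Schwarz provides one.\<close>
      moreover have "- (L2_norm u * L2_norm (\<phi> u)) \<le> cross_corr u (\<phi> u) s" for s
        using cross_corr_bound[OF u phi_L2[OF u], of s] by linarith
      ultimately show ?thesis
        using p0 norm_real
        by (intro mult_op_inner_nonneg[OF h u phi_L2[OF u], where q = "L2_norm u * L2_norm (\<phi> u)"])
          (simp_all add: le[unfolded p_def] p_def)
    next
      case False
      then obtain b where b: "B = ereal b" "b \<ge> 1" using B by (cases B) auto
      have up: "fun_bounded_above_by \<beta>_up (\<lambda>x. b * \<beta>_lo x)" using beta False b by simp
      have "AE t in lborel. u t \<noteq> 0 \<longrightarrow>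
          \<beta>_lo (u t) / u t \<le> \<phi> u t / u t \<and> \<phi> u t / u t \<le> \<beta>_up (u t) / u t"
        using beta_bounds L2_subset_L2e[OF u] by (simp add: nonlin_bounded_by_def)
      moreover have "AE t in lborel. u t = 0 \<longrightarrow> \<phi> u t = 0" using zero L2_subset_L2e[OF u] by simp
      ultimately have q: "AE t in lborel. \<bar>u t\<bar> * \<beta>_lo \<bar>u t\<bar> \<le> u t * \<phi> u t \<and> \<bar>\<phi> u t\<bar> \<le> b * \<beta>_lo \<bar>u t\<bar>"
      proof eventually_elim
        case (elim t)
        show ?case using quasi_odd_pointwise[OF beta_lo(3,2,4) elim(2,1) up] by blast
      qed
      have ge: "- (b * p) \<le> cross_corr u (\<phi> u) s" for s
        unfolding p_def
        by (rule cross_corr_quasi_odd_ge[OF beta_lo(1,2) u phi_L2[OF u]])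
          (use b q in \<open>auto elim: eventually_mono\<close>)
      have "H_norm h_plus + b * H_norm h_minus < 1" using norm b by simp
      then have "(b * H_norm h_minus) * p \<le> (1 - H_norm h_plus) * p"
        using p0 by (intro mult_right_mono) simp_all
      then have "H_norm h_minus * (b * p) \<le> (1 - H_norm h_plus) * L2_inner u (\<phi> u)"
        by (simp add: p_def mult_ac)
      then show ?thesis
        by (intro mult_op_inner_nonneg[OF h u phi_L2[OF u] le[unfolded p_def] ge])
    qed
  qed
  show ?thesis
  proof (intro conjI ballI allI impI)
    fix u assume u: "u \<in> L2"
    show "integrable lborel (\<lambda>t. mult_op h_plus h_minus u t * \<phi> u t)"
      by (rule L2_mult_integrable[OF mult_op_L2[OF h u] phi_L2[OF u]])
    show "0 \<le> (\<integral>t. mult_op h_plus h_minus u t * \<phi> u t \<partial>lborel)"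
      using positive[OF u] by (simp add: L2_inner_def)
  next
    fix Gj
    assume Gj: "is_freq_response G Gj"
      and "\<exists>\<epsilon>>0. \<forall>\<omega>. Re (mult_freq h_plus h_minus \<omega> * Gj \<omega>) \<ge> \<epsilon>"
    then obtain \<epsilon> where \<epsilon>: "\<epsilon> > 0" "\<And>\<omega>. Re (mult_freq h_plus h_minus \<omega> * Gj \<omega>) \<ge> \<epsilon>" by blast
    obtain c where c: "\<And>x. x \<in> L2 \<Longrightarrow> G x \<in> L2" "\<And>x. x \<in> L2 \<Longrightarrow> L2_norm (G x) \<le> c * L2_norm x"
      using G(5) by (auto simp: stable_op_def)
    \<comment> \<open>\<open>stable_op\<close> does not fix the sign of its constant, whereas the
      estimates to come multiply by a nonnegative one.\<close>
    have c': "L2_norm (G x) \<le> \<bar>c\<bar> * L2_norm x" if "x \<in> L2" for x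
      using c(2)[OF that] mult_right_mono[OF abs_ge_self[of c], of "L2_norm x"] by simp
    note pos = freq_positive_L2[OF G(2) Gj c(1) c' h \<epsilon>(2)]
    show "lurye_stable G \<phi>"
      unfolding lurye_stable_def
    proof (intro ballI allI impI)
      fix r1 r2 u1 u2 y1 y2
      assume r: "r1 \<in> L2" "r2 \<in> L2" and sol: "lurye_solution G \<phi> r1 r2 u1 u2 y1 y2"
      then have S: "u1 \<in> L2e" "u2 \<in> L2e" "y1 \<in> L2e" "y2 \<in> L2e" "AE t in lborel. y1 t = G u1 t"
        "AE t in lborel. y2 t = \<phi> u2 t" "AE t in lborel. u1 t = r1 t - y2 t" "AE t in lborel. u2 t = y1 t + r2 t"
        by (auto simp: lurye_solution_def)
      have "AE t in lborel. y2 t = \<alpha>_lo (u2 t)"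
        using S(6) memless[OF S(2)] by eventually_elim simp
      then have "L2_norm (trunc T y2) \<le> 2 * L2_norm (\<lambda>t. G r1 t + r2 t) / \<epsilon> + 1" for T
        by (intro truncated_output_bound[where \<phi> = \<phi> and \<alpha> = \<alpha>_lo and G = G and c = "\<bar>c\<bar>" and C = C and u = u2,
              OF h norm_real phi_L2 phi_norm positive memless c(1) c' pos])
          (use feedback_loop_truncated[OF G(1,2,4) sol r] S C \<epsilon> L2_add[OF c(1)[OF r(1)] r(2)] in simp_all)
      \<comment> \<open>The bound uniform in \<open>T\<close> puts the output of the nonlinearity
        into \<open>L2\<close>; the loop equations and stability of \<open>G\<close> propagate this
        around the loop.\<close>
      then have y2: "y2 \<in> L2" by (rule L2_of_bounded_truncations[OF S(4)])
      have u1: "u1 \<in> L2" by (rule L2_AE_cong[OF L2_diff[OF r(1) y2] L2e_measurable[OF S(1)] S(7)])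
      have y1: "y1 \<in> L2" by (rule L2_AE_cong[OF c(1)[OF u1] L2e_measurable[OF S(3)] S(5)])
      have "u2 \<in> L2" by (rule L2_AE_cong[OF L2_add[OF y1 r(2)] L2e_measurable[OF S(2)] S(8)])
      with u1 y1 y2 show "u1 \<in> L2 \<and> u2 \<in> L2 \<and> y1 \<in> L2 \<and> y2 \<in> L2" by blast
    qed
  qed
qed

end
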